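(* Let $(M,\varphi,\xi_\alpha,\eta^\alpha,g)$ be a $(2n+s)$-dimensional indefinite $\mathcal{S}$-manifold, with $n\geqslant2$ and $s\geqslant1$, which is $\eta$-Einstein, and let $h$ be the smooth function on $M$ such that $$\mathrm{Ric}(X,Y)=h\,g(\varphi X,\varphi Y)+2n\,\bar\eta(X)\bar\eta(Y)$$ for any $X,Y\in\Gamma(TM)$, where $\bar\eta=\sum_{\alpha=1}^s\varepsilon_\alpha\eta^\alpha$ and $\varepsilon_\alpha=g(\xi_\alpha,\xi_\alpha)=\pm1$. Then $h$ is constant.
   Context: All manifolds are connected, and all manifolds, tensor fields and maps are smooth. A globally framed $f$-manifold ($g.f.f$-manifold) $(M,\varphi,\xi_\alpha,\eta^\alpha)$, $\alpha\in\{1,\ldots,s\}$, $s\geqslant1$, is a $(2n+s)$-dimensional manifold with a $(1,1)$-tensor field $\varphi$ of constant rank $2n$ satisfying $\varphi^3+\varphi=0$, together with $s$ linearly independent global vector fields $\xi_\alpha$ and $s$ one-forms $\eta^\alpha$ such that $\varphi^2=-I+\sum_{\alpha=1}^s\eta^\alpha\otimes\xi_\alpha$ and $\eta^\alpha(\xi_\beta)=\delta^\alpha_\beta$. It is normal if $[\varphi,\varphi]+2\sum_{\alpha=1}^s d\eta^\alpha\otimes\xi_\alpha=0$, where $[\varphi,\varphi](X,Y)=\varphi^2[X,Y]+[\varphi X,\varphi Y]-\varphi[\varphi X,Y]-\varphi[X,\varphi Y]$. The convention for the exterior derivative of a 1-form is $2\,d\eta(X,Y)=X(\eta(Y))-Y(\eta(X))-\eta([X,Y])$.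 An indefinite (metric) $g.f.f$-manifold is a $g.f.f$-manifold with a semi-Riemannian metric $g$ such that $g(\varphi X,\varphi Y)=g(X,Y)-\sum_{\alpha=1}^s\varepsilon_\alpha\eta^\alpha(X)\eta^\alpha(Y)$ for all vector fields $X,Y$, where $\varepsilon_\alpha=g(\xi_\alpha,\xi_\alpha)=\pm1$. Its fundamental 2-form is $\Phi(X,Y)=g(X,\varphi Y)$. An indefinite $\mathcal{S}$-manifold is a normal indefinite $g.f.f$-manifold such that $\Phi=d\eta^\alpha$ for every $\alpha\in\{1,\ldots,s\}$. With $\nabla$ the Levi-Civita connection of $g$, the curvature tensor is $R(X,Y,Z,W)=g(R(Z,W)Y,X)=g(([\nabla_Z,\nabla_W]-\nabla_{[Z,W]})Y,X)$, and the Ricci tensor is $\mathrm{Ric}(X,Y)=\sum_i g(E_i,E_i)R(X,E_i,Y,E_i)$ for any local orthonormal frame $(E_i)$. $\Gamma(TM)$ denotes the smooth vector fields on $M$. An indefinite $g.f.f$-manifold is $\eta$-Einstein if there exist smooth functions $h,k$ on $M$ such that $\mathrm{Ric}(X,Y)=h\,g(\varphi X,\varphi Y)+k\,\bar\eta(X)\bar\eta(Y)$ for any $X,Y\in\Gamma(TM)$. A $(2n+s)$-dimensional indefinite $\mathcal{S}$-manifold is $\eta$-Einstein if and only if this holds with $k=2n$. *)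

theory Defs
  imports "HOL-Analysis.Analysis" "HOL-Library.Function_Algebras"
begin

text \<open>
  Tangent vectors are directional-derivative operators on real functions and vector fields are
  functions into tangent vectors. Both are added and scaled pointwise: addition comes from
  Function_Algebras, scaling from the instance below.
\<close>

instantiation "fun" :: (type, real_vector) real_vector
begin

definition scaleR_fun_def: "scaleR r f = (\<lambda>x. r *\<^sub>R f x)"

instance
  by standard (auto simp: scaleR_fun_def plus_fun_def fun_eq_iff algebra_simps)

end


section \<open>Smooth manifolds\<close>

primrec Ck_on :: "nat \<Rightarrow> ('e::euclidean_space \<Rightarrow> 'b::real_normed_vector) \<Rightarrow> 'e set \<Rightarrow> bool" where
  "Ck_on 0 f S \<longleftrightarrow> continuous_on S f"
| "Ck_on (Suc k) f S \<longleftrightarrow>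
     (\<forall>x\<in>S. f differentiable (at x)) \<and> (\<forall>v. Ck_on k (\<lambda>x. frechet_derivative f (at x) v) S)"

text \<open>Only used for open \<open>S\<close>.\<close>

definition smooth_on :: "('e::euclidean_space \<Rightarrow> 'b::real_normed_vector) \<Rightarrow> 'e set \<Rightarrow> bool" where
  "smooth_on f S \<longleftrightarrow> (\<forall>k. Ck_on k f S)"

text \<open>
  A chart is a pair of a domain and a coordinate map; the values of the coordinate map outside
  the domain are irrelevant. The atlas need not be maximal.
\<close>

type_synonym ('a, 'e) chart = "'a set \<times> ('a \<Rightarrow> 'e)"

record ('a, 'e) mfd =
  mtop :: "'a topology"
  atlas :: "('a, 'e) chart set"

abbreviation pts :: "('a, 'e) mfd \<Rightarrow> 'a set" where
  "pts M \<equiv> topspace (mtop M)"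

definition is_chart :: "'a topology \<Rightarrow> 'a set \<Rightarrow> ('a \<Rightarrow> 'e::euclidean_space) \<Rightarrow> bool" where
  "is_chart T U x \<longleftrightarrow> openin T U \<and> open (x ` U) \<and>
     homeomorphic_map (subtopology T U) (top_of_set (x ` U)) x"

definition smooth_manifold :: "('a, 'e::euclidean_space) mfd \<Rightarrow> bool" where
  "smooth_manifold M \<longleftrightarrow>
     Hausdorff_space (mtop M) \<and> second_countable (mtop M) \<and> connected_space (mtop M) \<and>
     (\<forall>(U, x)\<in>atlas M. is_chart (mtop M) U x) \<and>
     (\<Union>(U, x)\<in>atlas M. U) = pts M \<and>
     (\<forall>(U, x)\<in>atlas M. \<forall>(V, y)\<in>atlas M. smooth_on (y \<circ> inv_into U x) (x ` (U \<inter> V)))"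

text \<open>Smoothness of \<open>f\<close> on an open subset \<open>V\<close> of the manifold.\<close>

definition smooth_fun :: "('a, 'e::euclidean_space) mfd \<Rightarrow> 'a set \<Rightarrow> ('a \<Rightarrow> real) \<Rightarrow> bool" where
  "smooth_fun M V f \<longleftrightarrow> (\<forall>(U, x)\<in>atlas M. smooth_on (f \<circ> inv_into U x) (x ` (U \<inter> V)))"

definition smooth_near :: "('a, 'e::euclidean_space) mfd \<Rightarrow> 'a \<Rightarrow> ('a \<Rightarrow> real) \<Rightarrow> bool" where
  "smooth_near M p f \<longleftrightarrow> (\<exists>V. openin (mtop M) V \<and> p \<in> V \<and> smooth_fun M V f)"


section \<open>Tangent vectors and vector fields\<close>

type_synonym 'a tvec = "('a \<Rightarrow> real) \<Rightarrow> real"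
type_synonym 'a vfield = "'a \<Rightarrow> 'a tvec"

text \<open>
  The directional derivative at \<open>p\<close> along the coordinate vector \<open>a\<close> of the chart \<open>(U, x)\<close>. It is a
  total operator: functions that are not smooth near \<open>p\<close> are sent to \<open>0\<close>, so that the operator is
  determined by its values on functions smooth near \<open>p\<close>.
\<close>

definition dir_deriv ::
    "('a, 'e::euclidean_space) mfd \<Rightarrow> 'a set \<Rightarrow> ('a \<Rightarrow> 'e) \<Rightarrow> 'a \<Rightarrow> 'e \<Rightarrow> 'a tvec" where
  "dir_deriv M U x p a =
     (\<lambda>f. if smooth_near M p f then frechet_derivative (f \<circ> inv_into U x) (at (x p)) a else 0)"

definition tangent_space :: "('a, 'e::euclidean_space) mfd \<Rightarrow> 'a \<Rightarrow> 'a tvec set" where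
  "tangent_space M p = {dir_deriv M U x p a | U x a. (U, x) \<in> atlas M \<and> p \<in> U}"

text \<open>
  Smooth vector fields on the open set \<open>U\<close>; \<open>vfields M (pts M)\<close> is \<open>\<Gamma>(TM)\<close>. A field \<open>X\<close> is smooth if
  \<open>X(f)\<close> is smooth for every locally defined smooth \<open>f\<close>. Values outside \<open>U\<close> are irrelevant.
\<close>

definition vfields :: "('a, 'e::euclidean_space) mfd \<Rightarrow> 'a set \<Rightarrow> 'a vfield set" where
  "vfields M U = {X. (\<forall>p\<in>U. X p \<in> tangent_space M p) \<and>
     (\<forall>V f. openin (mtop M) V \<and> V \<subseteq> U \<and> smooth_fun M V f \<longrightarrow> smooth_fun M V (\<lambda>p. X p f))}"

definition lie_bracket ::
    "('a, 'e::euclidean_space) mfd \<Rightarrow> 'a vfield \<Rightarrow> 'a vfield \<Rightarrow> 'a vfield" where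
  "lie_bracket M X Y = (\<lambda>p f.
     if smooth_near M p f then X p (\<lambda>q. Y q f) - Y p (\<lambda>q. X q f) else 0)"


section \<open>Tensor fields\<close>

text \<open>
  Tensor fields are families of multilinear maps on the tangent spaces. They are smooth if they
  send smooth vector fields on open sets to smooth functions (or smooth vector fields).
\<close>

definition lin_on :: "'v::real_vector set \<Rightarrow> ('v \<Rightarrow> 'w::real_vector) \<Rightarrow> bool" where
  "lin_on V F \<longleftrightarrow> (\<forall>u\<in>V. \<forall>v\<in>V. \<forall>a b. F (a *\<^sub>R u + b *\<^sub>R v) = a *\<^sub>R F u + b *\<^sub>R F v)"

definition one_form ::
    "('a, 'e::euclidean_space) mfd \<Rightarrow> ('a \<Rightarrow> 'a tvec \<Rightarrow> real) \<Rightarrow> bool" where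
  "one_form M \<eta> \<longleftrightarrow>
     (\<forall>p\<in>pts M. lin_on (tangent_space M p) (\<eta> p)) \<and>
     (\<forall>U. openin (mtop M) U \<longrightarrow> (\<forall>X\<in>vfields M U. smooth_fun M U (\<lambda>p. \<eta> p (X p))))"

definition tensor_1_1 ::
    "('a, 'e::euclidean_space) mfd \<Rightarrow> ('a \<Rightarrow> 'a tvec \<Rightarrow> 'a tvec) \<Rightarrow> bool" where
  "tensor_1_1 M \<phi> \<longleftrightarrow>
     (\<forall>p\<in>pts M. lin_on (tangent_space M p) (\<phi> p) \<and> \<phi> p ` tangent_space M p \<subseteq> tangent_space M p) \<and>
     (\<forall>U. openin (mtop M) U \<longrightarrow> (\<forall>X\<in>vfields M U. (\<lambda>p. \<phi> p (X p)) \<in> vfields M U))"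

definition metric_index ::
    "('a, 'e::euclidean_space) mfd \<Rightarrow> ('a \<Rightarrow> 'a tvec \<Rightarrow> 'a tvec \<Rightarrow> real) \<Rightarrow> 'a \<Rightarrow> nat" where
  "metric_index M g p =
     Max {dim W | W. subspace W \<and> W \<subseteq> tangent_space M p \<and> (\<forall>w\<in>W. w \<noteq> 0 \<longrightarrow> g p w w < 0)}"

definition semi_riemannian_metric ::
    "('a, 'e::euclidean_space) mfd \<Rightarrow> ('a \<Rightarrow> 'a tvec \<Rightarrow> 'a tvec \<Rightarrow> real) \<Rightarrow> bool" where
  "semi_riemannian_metric M g \<longleftrightarrow>
     (\<forall>p\<in>pts M. \<forall>u\<in>tangent_space M p.
        lin_on (tangent_space M p) (g p u) \<and>
        (\<forall>v\<in>tangent_space M p. g p u v = g p v u) \<and>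
        ((\<forall>v\<in>tangent_space M p. g p u v = 0) \<longrightarrow> u = 0)) \<and>
     (\<exists>\<nu>. \<forall>p\<in>pts M. metric_index M g p = \<nu>) \<and>
     (\<forall>U. openin (mtop M) U \<longrightarrow>
        (\<forall>X\<in>vfields M U. \<forall>Y\<in>vfields M U. smooth_fun M U (\<lambda>p. g p (X p) (Y p))))"

text \<open>The convention is \<open>2 d\<eta>(X,Y) = X(\<eta>(Y)) - Y(\<eta>(X)) - \<eta>([X,Y])\<close>.\<close>

definition ext_deriv :: "('a, 'e::euclidean_space) mfd \<Rightarrow> ('a \<Rightarrow> 'a tvec \<Rightarrow> real) \<Rightarrow>
    'a vfield \<Rightarrow> 'a vfield \<Rightarrow> 'a \<Rightarrow> real" where
  "ext_deriv M \<eta> X Y p =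
     (X p (\<lambda>q. \<eta> q (Y q)) - Y p (\<lambda>q. \<eta> q (X q)) - \<eta> p (lie_bracket M X Y p)) / 2"

definition nijenhuis :: "('a, 'e::euclidean_space) mfd \<Rightarrow> ('a \<Rightarrow> 'a tvec \<Rightarrow> 'a tvec) \<Rightarrow>
    'a vfield \<Rightarrow> 'a vfield \<Rightarrow> 'a vfield" where
  "nijenhuis M \<phi> X Y p =
     \<phi> p (\<phi> p (lie_bracket M X Y p))
     + lie_bracket M (\<lambda>q. \<phi> q (X q)) (\<lambda>q. \<phi> q (Y q)) p
     - \<phi> p (lie_bracket M (\<lambda>q. \<phi> q (X q)) Y p)
     - \<phi> p (lie_bracket M X (\<lambda>q. \<phi> q (Y q)) p)"


section \<open>Levi-Civita connection and curvature\<close>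

text \<open>
  A connection acts on vector fields defined on arbitrary open sets, as is needed to apply it to
  local frames; \<open>D X Y\<close> stands for \<open>\<nabla>\<^sub>X Y\<close>. The axioms over all open \<open>U\<close> (with functions \<open>f\<close> that
  need only be smooth on \<open>U\<close>) force \<open>D X Y p\<close> to depend only on the germs of \<open>X\<close> and \<open>Y\<close> at \<open>p\<close>, so
  that a single operator describes the connection together with all its restrictions to open sets.
\<close>

definition connection ::
    "('a, 'e::euclidean_space) mfd \<Rightarrow> ('a vfield \<Rightarrow> 'a vfield \<Rightarrow> 'a vfield) \<Rightarrow> bool" where
  "connection M D \<longleftrightarrow> (\<forall>U. openin (mtop M) U \<longrightarrow>
     (\<forall>X\<in>vfields M U. \<forall>Y\<in>vfields M U.
        D X Y \<in> vfields M U \<and>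
        (\<forall>Z\<in>vfields M U. \<forall>p\<in>U.
           D (X + Z) Y p = D X Y p + D Z Y p \<and>
           D X (Y + Z) p = D X Y p + D X Z p) \<and>
        (\<forall>f. smooth_fun M U f \<longrightarrow> (\<forall>p\<in>U.
           D (\<lambda>q. f q *\<^sub>R X q) Y p = f p *\<^sub>R D X Y p \<and>
           D X (\<lambda>q. f q *\<^sub>R Y q) p = X p f *\<^sub>R Y p + f p *\<^sub>R D X Y p))))"

definition levi_civita :: "('a, 'e::euclidean_space) mfd \<Rightarrow>
    ('a \<Rightarrow> 'a tvec \<Rightarrow> 'a tvec \<Rightarrow> real) \<Rightarrow> ('a vfield \<Rightarrow> 'a vfield \<Rightarrow> 'a vfield) \<Rightarrow> bool" where
  "levi_civita M g D \<longleftrightarrow> connection M D \<and>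
     (\<forall>U. openin (mtop M) U \<longrightarrow>
        (\<forall>X\<in>vfields M U. \<forall>Y\<in>vfields M U. \<forall>p\<in>U.
           D X Y p - D Y X p = lie_bracket M X Y p \<and>
           (\<forall>Z\<in>vfields M U.
              X p (\<lambda>q. g q (Y q) (Z q)) = g p (D X Y p) (Z p) + g p (Y p) (D X Z p))))"

definition curv_op :: "('a, 'e::euclidean_space) mfd \<Rightarrow> ('a vfield \<Rightarrow> 'a vfield \<Rightarrow> 'a vfield) \<Rightarrow>
    'a vfield \<Rightarrow> 'a vfield \<Rightarrow> 'a vfield \<Rightarrow> 'a vfield" where
  "curv_op M D Z W Y = D Z (D W Y) - D W (D Z Y) - D (lie_bracket M Z W) Y"

definition curv :: "('a, 'e::euclidean_space) mfd \<Rightarrow> ('a \<Rightarrow> 'a tvec \<Rightarrow> 'a tvec \<Rightarrow> real) \<Rightarrow>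
    ('a vfield \<Rightarrow> 'a vfield \<Rightarrow> 'a vfield) \<Rightarrow>
    'a vfield \<Rightarrow> 'a vfield \<Rightarrow> 'a vfield \<Rightarrow> 'a vfield \<Rightarrow> 'a \<Rightarrow> real" where
  "curv M g D X Y Z W p = g p (curv_op M D Z W Y p) (X p)"

text \<open>Local frames \<open>E 0, \<dots>, E (DIM('e) - 1)\<close>, where \<open>DIM('e)\<close> is the dimension of the manifold.\<close>

definition orthonormal_frame :: "('a, 'e::euclidean_space) mfd \<Rightarrow>
    ('a \<Rightarrow> 'a tvec \<Rightarrow> 'a tvec \<Rightarrow> real) \<Rightarrow> 'a set \<Rightarrow> (nat \<Rightarrow> 'a vfield) \<Rightarrow> bool" where
  "orthonormal_frame M g U E \<longleftrightarrow>
     (\<forall>i<DIM('e). E i \<in> vfields M U) \<and>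
     (\<forall>p\<in>U. \<forall>i<DIM('e). \<forall>j<DIM('e).
        (if i = j then \<bar>g p (E i p) (E j p)\<bar> = 1 else g p (E i p) (E j p) = 0))"

text \<open>The sum does not depend on the local orthonormal frame, so any frame near \<open>p\<close> may be chosen.\<close>

definition Ricci :: "('a, 'e::euclidean_space) mfd \<Rightarrow> ('a \<Rightarrow> 'a tvec \<Rightarrow> 'a tvec \<Rightarrow> real) \<Rightarrow>
    ('a vfield \<Rightarrow> 'a vfield \<Rightarrow> 'a vfield) \<Rightarrow> 'a vfield \<Rightarrow> 'a vfield \<Rightarrow> 'a \<Rightarrow> real" where
  "Ricci M g D X Y p =
     (let E = (SOME E. \<exists>U. openin (mtop M) U \<and> p \<in> U \<and> orthonormal_frame M g U E)
      in \<Sum>i<DIM('e). g p (E i p) (E i p) * curv M g D X (E i) Y (E i) p)"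


section \<open>Indefinite S-manifolds\<close>

definition gff_manifold :: "nat \<Rightarrow> nat \<Rightarrow> ('a, 'e::euclidean_space) mfd \<Rightarrow>
    ('a \<Rightarrow> 'a tvec \<Rightarrow> 'a tvec) \<Rightarrow> (nat \<Rightarrow> 'a vfield) \<Rightarrow> (nat \<Rightarrow> 'a \<Rightarrow> 'a tvec \<Rightarrow> real) \<Rightarrow> bool" where
  "gff_manifold n s M \<phi> \<xi> \<eta> \<longleftrightarrow>
     smooth_manifold M \<and> DIM('e) = 2 * n + s \<and> s \<ge> 1 \<and>
     tensor_1_1 M \<phi> \<and>
     (\<forall>\<alpha>\<in>{1..s}. \<xi> \<alpha> \<in> vfields M (pts M) \<and> one_form M (\<eta> \<alpha>)) \<and>
     (\<forall>p\<in>pts M.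
        dim (\<phi> p ` tangent_space M p) = 2 * n \<and>
        inj_on (\<lambda>\<alpha>. \<xi> \<alpha> p) {1..s} \<and> independent ((\<lambda>\<alpha>. \<xi> \<alpha> p) ` {1..s}) \<and>
        (\<forall>v\<in>tangent_space M p.
           \<phi> p (\<phi> p (\<phi> p v)) + \<phi> p v = 0 \<and>
           \<phi> p (\<phi> p v) = - v + (\<Sum>\<alpha>=1..s. \<eta> \<alpha> p v *\<^sub>R \<xi> \<alpha> p)) \<and>
        (\<forall>\<alpha>\<in>{1..s}. \<forall>\<beta>\<in>{1..s}. \<eta> \<alpha> p (\<xi> \<beta> p) = (if \<alpha> = \<beta> then 1 else 0)))"

definition normal_gff :: "nat \<Rightarrow> ('a, 'e::euclidean_space) mfd \<Rightarrow>
    ('a \<Rightarrow> 'a tvec \<Rightarrow> 'a tvec) \<Rightarrow> (nat \<Rightarrow> 'a vfield) \<Rightarrow> (nat \<Rightarrow> 'a \<Rightarrow> 'a tvec \<Rightarrow> real) \<Rightarrow> bool" where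
  "normal_gff s M \<phi> \<xi> \<eta> \<longleftrightarrow>
     (\<forall>X\<in>vfields M (pts M). \<forall>Y\<in>vfields M (pts M). \<forall>p\<in>pts M.
        nijenhuis M \<phi> X Y p + 2 *\<^sub>R (\<Sum>\<alpha>=1..s. ext_deriv M (\<eta> \<alpha>) X Y p *\<^sub>R \<xi> \<alpha> p) = 0)"

definition indefinite_gff_manifold :: "nat \<Rightarrow> nat \<Rightarrow> ('a, 'e::euclidean_space) mfd \<Rightarrow>
    ('a \<Rightarrow> 'a tvec \<Rightarrow> 'a tvec) \<Rightarrow> (nat \<Rightarrow> 'a vfield) \<Rightarrow> (nat \<Rightarrow> 'a \<Rightarrow> 'a tvec \<Rightarrow> real) \<Rightarrow>
    ('a \<Rightarrow> 'a tvec \<Rightarrow> 'a tvec \<Rightarrow> real) \<Rightarrow> (nat \<Rightarrow> real) \<Rightarrow> bool" where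
  "indefinite_gff_manifold n s M \<phi> \<xi> \<eta> g \<epsilon> \<longleftrightarrow>
     gff_manifold n s M \<phi> \<xi> \<eta> \<and> semi_riemannian_metric M g \<and>
     (\<forall>\<alpha>\<in>{1..s}. \<epsilon> \<alpha> \<in> {1, -1} \<and> (\<forall>p\<in>pts M. g p (\<xi> \<alpha> p) (\<xi> \<alpha> p) = \<epsilon> \<alpha>)) \<and>
     (\<forall>p\<in>pts M. \<forall>u\<in>tangent_space M p. \<forall>v\<in>tangent_space M p.
        g p (\<phi> p u) (\<phi> p v) = g p u v - (\<Sum>\<alpha>=1..s. \<epsilon> \<alpha> * \<eta> \<alpha> p u * \<eta> \<alpha> p v))"

definition fundamental_form :: "('a \<Rightarrow> 'a tvec \<Rightarrow> 'a tvec) \<Rightarrow> ('a \<Rightarrow> 'a tvec \<Rightarrow> 'a tvec \<Rightarrow> real) \<Rightarrow>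
    'a vfield \<Rightarrow> 'a vfield \<Rightarrow> 'a \<Rightarrow> real" where
  "fundamental_form \<phi> g X Y p = g p (X p) (\<phi> p (Y p))"

definition indefinite_S_manifold :: "nat \<Rightarrow> nat \<Rightarrow> ('a, 'e::euclidean_space) mfd \<Rightarrow>
    ('a \<Rightarrow> 'a tvec \<Rightarrow> 'a tvec) \<Rightarrow> (nat \<Rightarrow> 'a vfield) \<Rightarrow> (nat \<Rightarrow> 'a \<Rightarrow> 'a tvec \<Rightarrow> real) \<Rightarrow>
    ('a \<Rightarrow> 'a tvec \<Rightarrow> 'a tvec \<Rightarrow> real) \<Rightarrow> (nat \<Rightarrow> real) \<Rightarrow> bool" where
  "indefinite_S_manifold n s M \<phi> \<xi> \<eta> g \<epsilon> \<longleftrightarrow>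
     indefinite_gff_manifold n s M \<phi> \<xi> \<eta> g \<epsilon> \<and> normal_gff s M \<phi> \<xi> \<eta> \<and>
     (\<forall>\<alpha>\<in>{1..s}. \<forall>X\<in>vfields M (pts M). \<forall>Y\<in>vfields M (pts M). \<forall>p\<in>pts M.
        fundamental_form \<phi> g X Y p = ext_deriv M (\<eta> \<alpha>) X Y p)"

definition eta_bar :: "nat \<Rightarrow> (nat \<Rightarrow> real) \<Rightarrow> (nat \<Rightarrow> 'a \<Rightarrow> 'a tvec \<Rightarrow> real) \<Rightarrow>
    'a \<Rightarrow> 'a tvec \<Rightarrow> real" where
  "eta_bar s \<epsilon> \<eta> p v = (\<Sum>\<alpha>=1..s. \<epsilon> \<alpha> * \<eta> \<alpha> p v)"

text \<open>
  The \<open>\<eta>\<close>-Einstein condition with prescribed coefficient functions \<open>h\<close> and \<open>k\<close>; a manifold is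
  \<open>\<eta>\<close>-Einstein if this holds for some \<open>h\<close> and \<open>k\<close>.
\<close>

definition eta_Einstein_with :: "nat \<Rightarrow> ('a, 'e::euclidean_space) mfd \<Rightarrow>
    ('a \<Rightarrow> 'a tvec \<Rightarrow> 'a tvec) \<Rightarrow> (nat \<Rightarrow> 'a \<Rightarrow> 'a tvec \<Rightarrow> real) \<Rightarrow>
    ('a \<Rightarrow> 'a tvec \<Rightarrow> 'a tvec \<Rightarrow> real) \<Rightarrow> (nat \<Rightarrow> real) \<Rightarrow>
    ('a vfield \<Rightarrow> 'a vfield \<Rightarrow> 'a vfield) \<Rightarrow> ('a \<Rightarrow> real) \<Rightarrow> ('a \<Rightarrow> real) \<Rightarrow> bool" where
  "eta_Einstein_with s M \<phi> \<eta> g \<epsilon> D h k \<longleftrightarrow>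
     smooth_fun M (pts M) h \<and> smooth_fun M (pts M) k \<and>
     (\<forall>X\<in>vfields M (pts M). \<forall>Y\<in>vfields M (pts M). \<forall>p\<in>pts M.
        Ricci M g D X Y p =
          h p * g p (\<phi> p (X p)) (\<phi> p (Y p)) + k p * eta_bar s \<epsilon> \<eta> p (X p) * eta_bar s \<epsilon> \<eta> p (Y p))"

end

theory Submission
  imports Defs
begin

text \<open>
  The metric identifies \<open>\<eta>\<^sup>\<alpha>\<close> with \<open>\<epsilon>\<^sub>\<alpha> g(\<cdot>, \<xi>\<^sub>\<alpha>)\<close>, so the Ricci tensor is
  \<open>h (g - \<Sum> \<epsilon>\<^sub>\<alpha> \<theta>\<^sub>\<alpha> \<otimes> \<theta>\<^sub>\<alpha>) + 2n \<theta> \<otimes> \<theta>\<close>, where \<open>\<theta>\<^sub>\<alpha>\<close> and \<open>\<theta>\<close> are dual to \<open>\<xi>\<^sub>\<alpha>\<close> and to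
  \<open>\<Sum> \<xi>\<^sub>\<alpha>\<close>. The fields \<open>\<xi>\<^sub>\<alpha>\<close> are Killing: normality gives that they preserve \<open>\<phi>\<close>, and
  \<open>d\<eta>\<^sup>\<alpha> = \<Phi>\<close> gives that they preserve \<open>\<Phi>\<close>. For a Killing field of constant length the
  square of the dual form is divergence free, and the scalar curvature is \<open>2n h\<close> up to a constant.
  The contracted second Bianchi identity therefore reads
  \<open>2n X(h) = 2 (X(h) - \<Sum> \<eta>\<^sup>\<alpha>(X) \<xi>\<^sub>\<alpha>(h))\<close>. Taking \<open>X = \<xi>\<^sub>\<beta>\<close> gives \<open>\<xi>\<^sub>\<beta>(h) = 0\<close>, and then
  \<open>(2n - 2) X(h) = 0\<close> for every \<open>X\<close>.
\<close>


section \<open>Smooth functions on Euclidean spaces\<close>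

text \<open>The axioms of an S-manifold and the Einstein equation speak of global fields, while
  orthonormal frames exist only locally. The Killing property is therefore proved on all of
  \<open>pts M\<close> and carried to a frame domain by cutoff extensions. Tensor identities are
  proved in an abstract calculus; the fields on an open set form a model of it once they are set to
  0 outside, because identities on the set then become equations between functions. For a Killing
  field Z with dual form \<theta>, the divergence of \<theta> \<otimes> \<theta> is (div Z) \<theta>
  + g(\<nabla>_Z Z, \<cdot>). Here div Z is the trace of a skew form, and g(\<nabla>_Z Z, X) is
  minus half the derivative of g(Z,Z) along X, hence 0 for constant length. The 2n in the scalar
  curvature is the trace 2n + s of g minus s unit squares. Indefiniteness has two costs:
  Gram-Schmidt must avoid null vectors, and the signs of a frame must be kept constant near a
  point.\<close>

lemma Ck_on_cong:
  assumes "open S" "\<And>x. x \<in> S \<Longrightarrow> f x = g x"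
  shows "Ck_on k f S \<longleftrightarrow> Ck_on k g S"
  using assms
proof (induction k arbitrary: f g)
  case 0
  then show ?case by (auto intro: continuous_on_eq)
next
  case (Suc k)
  have d: "f differentiable (at x) \<longleftrightarrow> g differentiable (at x)" if "x \<in> S" for x
    unfolding differentiable_def
    using has_derivative_transform_within_open[of f _ x UNIV S g, OF _ Suc.prems(1) that]
      has_derivative_transform_within_open[of g _ x UNIV S f, OF _ Suc.prems(1) that] Suc.prems(2)
    by (metis (no_types))
  have fd: "frechet_derivative f (at x) = frechet_derivative g (at x)"
    if "x \<in> S" "f differentiable (at x)" for x
    using frechet_derivative_transform_within_open[of f x S g] Suc.prems that by auto
  show ?case
  proof (cases "\<forall>x\<in>S. f differentiable (at x)")
    case True
    have "Ck_on k (\<lambda>x. frechet_derivative f (at x) v) S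
        \<longleftrightarrow> Ck_on k (\<lambda>x. frechet_derivative g (at x) v) S" for v
      by (rule Suc.IH) (use Suc.prems fd True in auto)
    then show ?thesis using d True by auto
  next
    case False
    then show ?thesis using d by auto
  qed
qed

lemma Ck_on_subset: "Ck_on k f S \<Longrightarrow> T \<subseteq> S \<Longrightarrow> Ck_on k f T"
  by (induction k arbitrary: f) (auto intro: continuous_on_subset)

lemma Ck_on_SucD: "Ck_on (Suc k) f S \<Longrightarrow> Ck_on k f S"
  by (induction k arbitrary: f)
    (auto intro!: differentiable_imp_continuous_on differentiable_at_imp_differentiable_on)

text \<open>Continuity and differentiability are tested pointwise, and each directional derivative
  satisfies the local hypothesis again, so the neighbourhoods need no uniformity.\<close>

lemma Ck_on_local:
  assumes "\<And>x. x \<in> S \<Longrightarrow> \<exists>T. open T \<and> x \<in> T \<and> Ck_on k f T"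
  shows "Ck_on k f S"
  using assms
proof (induction k arbitrary: f)
  case 0
  have "continuous (at x) f" if "x \<in> S" for x
    using 0[OF that] by (auto simp: continuous_on_eq_continuous_at)
  then show ?case by (simp add: continuous_at_imp_continuous_on)
next
  case (Suc k)
  have "f differentiable (at x)" if "x \<in> S" for x
    using Suc.prems[OF that] by auto
  moreover have "Ck_on k (\<lambda>x. frechet_derivative f (at x) v) S" for v
    by (rule Suc.IH) (use Suc.prems in fastforce)
  ultimately show ?case by simp
qed

lemma Ck_on_const: "Ck_on k (\<lambda>x. c) S"
  by (induction k arbitrary: c) auto

lemma frechet_derivative_eqI: "(f has_derivative f') (at x) \<Longrightarrow> frechet_derivative f (at x) = f'"
  by (metis frechet_derivative_at)

lemma has_frechet_derivative:
  "f differentiable (at x) \<Longrightarrow> (f has_derivative frechet_derivative f (at x)) (at x)"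
  by (simp add: frechet_derivative_works)

lemma Ck_on_bounded_linear:
  assumes L: "bounded_linear L" and S: "open S"
  shows "Ck_on k f S \<Longrightarrow> Ck_on k (\<lambda>x. L (f x)) S"
proof (induction k arbitrary: f)
  case 0
  then show ?case by (simp add: bounded_linear.continuous_on[OF L])
next
  case (Suc k)
  have d: "((\<lambda>x. L (f x)) has_derivative (\<lambda>v. L (frechet_derivative f (at x) v))) (at x)"
    if "x \<in> S" for x
    using Suc.prems that
    by (intro bounded_linear.has_derivative[OF L] has_frechet_derivative) auto
  have "Ck_on k (\<lambda>x. frechet_derivative (\<lambda>x. L (f x)) (at x) v) S" for v
    using Suc by (subst Ck_on_cong[OF S, where g="\<lambda>x. L (frechet_derivative f (at x) v)"])
      (auto simp: frechet_derivative_eqI[OF d])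
  then show ?case using d by (auto simp: differentiable_def)
qed

lemma Ck_on_linear:
  assumes "bounded_linear L"
  shows "Ck_on k L S"
proof (rule Ck_on_subset[where S=UNIV])
  show "Ck_on k L UNIV"
  proof (cases k)
    case 0
    then show ?thesis using assms by (simp add: linear_continuous_on)
  next
    case (Suc l)
    then show ?thesis
      using frechet_derivative_eqI[OF bounded_linear_imp_has_derivative[OF assms]] assms
      by (auto simp: Ck_on_const bounded_linear_imp_differentiable)
  qed
qed auto

lemma Ck_on_add:
  assumes S: "open S"
  shows "Ck_on k f S \<Longrightarrow> Ck_on k g S \<Longrightarrow> Ck_on k (\<lambda>x. f x + g x) S"
proof (induction k arbitrary: f g)
  case 0
  then show ?case by (auto intro: continuous_on_add)
next
  case (Suc k)
  have d: "((\<lambda>x. f x + g x) has_derivative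
      (\<lambda>v. frechet_derivative f (at x) v + frechet_derivative g (at x) v)) (at x)"
    if "x \<in> S" for x
    using Suc.prems that by (intro has_derivative_add has_frechet_derivative) auto
  have "Ck_on k (\<lambda>x. frechet_derivative (\<lambda>x. f x + g x) (at x) v) S" for v
    using Suc by (subst Ck_on_cong[OF S,
          where g="\<lambda>x. frechet_derivative f (at x) v + frechet_derivative g (at x) v"])
      (auto simp: frechet_derivative_eqI[OF d])
  then show ?case using d by (auto simp: differentiable_def)
qed

lemma Ck_on_mult:
  fixes f g :: "'e::euclidean_space \<Rightarrow> real"
  assumes S: "open S"
  shows "Ck_on k f S \<Longrightarrow> Ck_on k g S \<Longrightarrow> Ck_on k (\<lambda>x. f x * g x) S"
proof (induction k arbitrary: f g)
  case 0
  then show ?case by (auto intro: continuous_on_mult)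
next
  case (Suc k)
  have d: "((\<lambda>x. f x * g x) has_derivative
      (\<lambda>v. f x * frechet_derivative g (at x) v + frechet_derivative f (at x) v * g x)) (at x)"
    if "x \<in> S" for x
    using Suc.prems that by (intro has_derivative_mult has_frechet_derivative) auto
  have "Ck_on k (\<lambda>x. frechet_derivative (\<lambda>x. f x * g x) (at x) v) S" for v
    using Suc.prems Suc.prems[THEN Ck_on_SucD]
    by (subst Ck_on_cong[OF S,
          where g="\<lambda>x. f x * frechet_derivative g (at x) v + frechet_derivative f (at x) v * g x"])
      (auto simp: frechet_derivative_eqI[OF d] intro!: Ck_on_add[OF S] Suc.IH)
  then show ?case using d by (auto simp: differentiable_def)
qed

lemma Ck_on_sum:
  assumes S: "open S" and "finite I" "\<And>i. i \<in> I \<Longrightarrow> Ck_on k (f i) S"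
  shows "Ck_on k (\<lambda>x. \<Sum>i\<in>I. f i x) S"
  using assms(2,3)
  by (induction I rule: finite_induct) (auto simp: Ck_on_const intro: Ck_on_add[OF S])

text \<open>The induction varies \<open>g\<close> and keeps \<open>f\<close> fixed. In coordinates
  the chain rule writes each directional derivative of the composite as a finite sum of products of
  a component of the derivative of \<open>f\<close> with a partial derivative of \<open>g\<close>
  composed with \<open>f\<close>, and the induction hypothesis covers the latter.\<close>

lemma Ck_on_compose:
  fixes f :: "'e::euclidean_space \<Rightarrow> 'd::euclidean_space" and g :: "'d \<Rightarrow> real"
  assumes S: "open S"
  shows "f ` S \<subseteq> T \<Longrightarrow> Ck_on k f S \<Longrightarrow> Ck_on k g T \<Longrightarrow> Ck_on k (\<lambda>x. g (f x)) S"
proof (induction k arbitrary: g)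
  case 0
  then have "continuous_on S f" "continuous_on T g" "f ` S \<subseteq> T" by auto
  then show ?case by (simp add: continuous_on_compose2)
next
  case (Suc k)
  have d0: "((\<lambda>x. g (f x)) has_derivative
      (\<lambda>v. frechet_derivative g (at (f x)) (frechet_derivative f (at x) v))) (at x)"
    if "x \<in> S" for x
  proof -
    have "f differentiable (at x)" "g differentiable (at (f x))" using Suc.prems(1-3) that by auto
    then show ?thesis
      using has_derivative_compose[OF has_frechet_derivative has_frechet_derivative] by blast
  qed
  have d: "frechet_derivative (\<lambda>x. g (f x)) (at x) v =
      (\<Sum>b\<in>Basis. (frechet_derivative f (at x) v \<bullet> b) * frechet_derivative g (at (f x)) b)"
    if "x \<in> S" for x v
  proof -
    have l: "linear (frechet_derivative g (at (f x)))"
      using Suc.prems that by (intro linear_frechet_derivative) auto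
    have "frechet_derivative g (at (f x)) w = (\<Sum>b\<in>Basis. (w \<bullet> b) * frechet_derivative g (at (f x)) b)"
      for w
      by (subst (1) euclidean_representation[of w, symmetric])
        (simp only: linear_sum[OF l] linear_cmul[OF l] real_scaleR_def)
    then show ?thesis
      using frechet_derivative_eqI[OF d0[OF that]] by metis
  qed
  have g: "Ck_on k (\<lambda>x. frechet_derivative g (at (f x)) b) S" for b
    using Suc.prems Ck_on_SucD[OF Suc.prems(2)] by (intro Suc.IH) auto
  have "Ck_on k (\<lambda>x. \<Sum>b\<in>Basis. (frechet_derivative f (at x) v \<bullet> b)
          * frechet_derivative g (at (f x)) b) S" for v
    using Suc.prems
    by (intro Ck_on_sum[OF S] Ck_on_mult[OF S] g
        Ck_on_bounded_linear[OF bounded_linear_inner_left S]) auto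
  then have "Ck_on k (\<lambda>x. frechet_derivative (\<lambda>x. g (f x)) (at x) v) S" for v
    by (subst Ck_on_cong[OF S, where g="\<lambda>x. \<Sum>b\<in>Basis. (frechet_derivative f (at x) v \<bullet> b)
          * frechet_derivative g (at (f x)) b"]) (auto simp: d)
  then show ?case using d0 by (auto simp: differentiable_def)
qed

lemma Ck_on_realI:
  fixes f :: "real \<Rightarrow> real"
  assumes S: "open S" and "\<And>t. t \<in> S \<Longrightarrow> (f has_real_derivative f' t) (at t)" "Ck_on k f' S"
  shows "Ck_on (Suc k) f S"
proof -
  have d: "(f has_derivative (\<lambda>v. f' t * v)) (at t)" if "t \<in> S" for t
    using assms(2)[OF that] by (simp add: has_field_derivative_def)
  have "Ck_on k (\<lambda>x. frechet_derivative f (at x) v) S" for v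
    using assms(3) by (subst Ck_on_cong[OF S, where g="\<lambda>x. f' x * v"])
      (auto simp: frechet_derivative_eqI[OF d] intro!: Ck_on_mult[OF S] Ck_on_const)
  then show ?thesis using d by (auto simp: differentiable_def)
qed

section \<open>Reciprocals, square roots and cutoff functions\<close>

lemma smooth_on_inverse: "smooth_on (inverse :: real \<Rightarrow> real) (- {0})"
  unfolding smooth_on_def
proof
  fix k show "Ck_on k (inverse :: real \<Rightarrow> real) (- {0})"
  proof (induction k)
    case 0
    then show ?case by (auto intro: continuous_intros)
  next
    case (Suc k)
    have "Ck_on k (\<lambda>t::real. (-1) * (inverse t * inverse t)) (- {0})"
      by (intro Ck_on_mult Ck_on_const Suc.IH) auto
    then show ?case
      by (rule Ck_on_realI[rotated 2]) (auto intro!: derivative_eq_intros)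
  qed
qed

lemma has_real_derivative_inverse_sqrt_abs:
  assumes "t \<noteq> (0::real)"
  shows "((\<lambda>t. inverse (sqrt \<bar>t\<bar>)) has_real_derivative
    (- 1 / 2) * (inverse (sqrt \<bar>t\<bar>) * inverse t)) (at t)"
proof (cases "t > 0")
  case True
  have "((\<lambda>t. inverse (sqrt t)) has_real_derivative
    (- 1 / 2) * (inverse (sqrt \<bar>t\<bar>) * inverse t)) (at t)"
    using True by (auto intro!: derivative_eq_intros simp: field_simps power2_eq_square)
  then show ?thesis
    by (rule has_field_derivative_transform_within_open[where S="{0<..}"]) (use True in auto)
next
  case False
  then have n: "t < 0" using assms by simp
  have "((\<lambda>t. inverse (sqrt (- t))) has_real_derivative
    (- 1 / 2) * (inverse (sqrt \<bar>t\<bar>) * inverse t)) (at t)"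
    using n by (auto intro!: derivative_eq_intros simp: field_simps power2_eq_square)
  then show ?thesis
    by (rule has_field_derivative_transform_within_open[where S="{..<0}"]) (use n in auto)
qed

text \<open>Up to a constant the derivative is the function itself times \<open>inverse\<close>,
  which closes the induction. The absolute value makes the function fit for normalising fields of
  negative squared length.\<close>

lemma smooth_on_inverse_sqrt_abs: "smooth_on (\<lambda>t::real. inverse (sqrt \<bar>t\<bar>)) (- {0})"
  unfolding smooth_on_def
proof
  fix k show "Ck_on k (\<lambda>t::real. inverse (sqrt \<bar>t\<bar>)) (- {0})"
  proof (induction k)
    case 0
    then show ?case by (auto intro!: continuous_intros)
  next
    case (Suc k)
    have "Ck_on k (\<lambda>t::real. (- 1 / 2) * (inverse (sqrt \<bar>t\<bar>) * inverse t)) (- {0})"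
      using smooth_on_inverse unfolding smooth_on_def
      by (intro Ck_on_mult Ck_on_const Suc.IH) auto
    then show ?case
      by (rule Ck_on_realI[OF _ has_real_derivative_inverse_sqrt_abs, rotated 2]) auto
  qed
qed

text \<open>The family is closed under differentiation, hence consists of smooth functions.\<close>

definition flat_exp :: "nat \<Rightarrow> real \<Rightarrow> real" where
  "flat_exp k t = (if t > 0 then inverse t ^ k * exp (- inverse t) else 0)"

text \<open>Substituting u = 1/t turns the right limit into that of u^k / exp u at infinity; on the
  left the function is identically 0.\<close>

lemma flat_exp_tendsto_0: "(flat_exp k \<longlongrightarrow> 0) (at 0)"
proof -
  have "((\<lambda>u::real. u ^ k / exp u) \<longlongrightarrow> 0) at_top"
    by (rule tendsto_power_div_exp_0)
  then have "((\<lambda>t::real. inverse t ^ k / exp (inverse t)) \<longlongrightarrow> 0) (at_right 0)"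
    by (rule filterlim_compose) (rule filterlim_inverse_at_top_right)
  then have "(flat_exp k \<longlongrightarrow> 0) (at_right 0)"
    by (rule Lim_transform_eventually)
      (auto simp: eventually_at_filter flat_exp_def exp_minus divide_inverse)
  moreover have "(flat_exp k \<longlongrightarrow> 0) (at_left 0)"
    by (rule Lim_transform_eventually[of "\<lambda>_. 0"])
      (auto simp: eventually_at_filter flat_exp_def)
  ultimately show ?thesis by (simp add: filterlim_split_at)
qed

lemma has_real_derivative_flat_exp:
  "(flat_exp k has_real_derivative (flat_exp (k + 2) t - real k * flat_exp (k + 1) t)) (at t)"
proof (cases t "0::real" rule: linorder_cases)
  case less
  have "((\<lambda>_. 0) has_real_derivative (flat_exp (k + 2) t - real k * flat_exp (k + 1) t)) (at t)"
    using less by (simp add: flat_exp_def)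
  then show ?thesis
    by (rule has_field_derivative_transform_within_open[where S="{..<0}"])
      (use less in \<open>auto simp: flat_exp_def\<close>)
next
  case equal
  \<comment> \<open>At 0 the difference quotient is again a member of the family, so its limit is
    the one already computed.\<close>
  have "(\<lambda>h. flat_exp k h / h) = flat_exp (Suc k)"
    by (auto simp: flat_exp_def fun_eq_iff divide_inverse mult_ac)
  then show ?thesis using flat_exp_tendsto_0[of "Suc k"] equal
    by (simp add: DERIV_def flat_exp_def[of _ 0])
next
  case greater
  \<comment> \<open>The exponent \<open>k - 1\<close> is a truncated subtraction; for
    \<open>k = 0\<close> the factor \<open>real k\<close> makes both sides 0.\<close>
  have e: "real k * inverse t ^ (k - 1) * (inverse t * inverse t) = real k * inverse t ^ (k + 1)"
    by (cases k) (auto simp: mult_ac)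
  have "((\<lambda>t. inverse t ^ k * exp (- inverse t)) has_real_derivative
     (flat_exp (k + 2) t - real k * flat_exp (k + 1) t)) (at t)"
    using greater e
    by (auto intro!: derivative_eq_intros simp: flat_exp_def algebra_simps)
  then show ?thesis
    by (rule has_field_derivative_transform_within_open[where S="{0<..}"])
      (use greater in \<open>auto simp: flat_exp_def\<close>)
qed

lemma Ck_on_flat_exp: "Ck_on l (flat_exp k) UNIV"
proof (induction l arbitrary: k)
  case 0
  then show ?case
    using has_real_derivative_flat_exp by (auto intro!: DERIV_continuous_on)
next
  case (Suc l)
  have "Ck_on l (\<lambda>t. flat_exp (k + 2) t + (- real k) * flat_exp (k + 1) t) UNIV"
    by (intro Ck_on_add Ck_on_mult Ck_on_const Suc.IH) auto
  then show ?case
    by (rule Ck_on_realI[rotated 2]) (use has_real_derivative_flat_exp[of k] in auto)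
qed

lemma smooth_bump:
  fixes c :: "'e::euclidean_space"
  assumes "r > 0"
  obtains \<beta> :: "'e \<Rightarrow> real" and d where "smooth_on \<beta> UNIV" "0 < d" "d \<le> r"
    "\<And>x. dist x c < d \<Longrightarrow> \<beta> x = 1" "\<And>x. dist x c \<ge> r \<Longrightarrow> \<beta> x = 0"
proof -
  \<comment> \<open>A quadratic polynomial in the coordinates, so the norm need not be
    differentiated at the centre. It is at most 0 from distance \<open>r\<close> on, and at least 1
    up to distance r / sqrt 2, which covers the radius \<open>r / 2\<close> chosen for
    \<open>d\<close>.\<close>
  define q where "q x = 2 + (-2 / r\<^sup>2) * ((x - c) \<bullet> (x - c))" for x
  define F where "F = flat_exp 0"
  \<comment> \<open>At least one of \<open>q x\<close> and \<open>1 - q x\<close> is positive, so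
    the denominator never vanishes.\<close>
  define \<beta> where "\<beta> x = F (q x) * inverse (F (q x) + F (1 - q x))" for x
  have Fpos: "F t > 0" if "t > 0" for t using that by (auto simp: F_def flat_exp_def)
  have F0: "F t = 0" if "t \<le> 0" for t using that by (auto simp: F_def flat_exp_def)
  have Fn: "F t \<ge> 0" for t using Fpos[of t] F0[of t] by linarith
  have den: "F (q x) + F (1 - q x) > 0" for x
  proof (cases "q x > 0")
    case True then show ?thesis using Fpos[of "q x"] Fn[of "1 - q x"] by linarith
  next
    case False then show ?thesis using Fpos[of "1 - q x"] Fn[of "q x"] by linarith
  qed
  have qx: "q x = 2 - 2 * (dist x c)\<^sup>2 / r\<^sup>2" for x
    by (simp add: q_def dist_norm power2_norm_eq_inner)
  have Ckq: "Ck_on k q UNIV" for k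
  proof -
    have i: "(x - c) \<bullet> (x - c) = (\<Sum>b\<in>Basis. ((x \<bullet> b) + - (c \<bullet> b)) * ((x \<bullet> b) + - (c \<bullet> b)))" for x
      by (subst euclidean_inner) (simp add: inner_diff_left)
    show ?thesis unfolding q_def i
      by (intro Ck_on_add Ck_on_mult Ck_on_sum Ck_on_const Ck_on_linear bounded_linear_inner_left)
        auto
  qed
  have CkF: "Ck_on k F UNIV" for k unfolding F_def by (rule Ck_on_flat_exp)
  have A: "Ck_on k (\<lambda>x. F (q x)) UNIV" for k
    by (rule Ck_on_compose[OF _ _ Ckq CkF]) auto
  have B: "Ck_on k (\<lambda>x. F (1 - q x)) UNIV" for k
  proof (rule Ck_on_compose[OF _ _ _ CkF])
    have "Ck_on k (\<lambda>x. 1 + (-1) * q x) UNIV"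
      by (intro Ck_on_add Ck_on_mult Ck_on_const Ckq) auto
    then show "Ck_on k (\<lambda>x. 1 - q x) UNIV" by simp
  qed auto
  have C: "Ck_on k (\<lambda>x. inverse (F (q x) + F (1 - q x))) UNIV" for k
    by (rule Ck_on_compose[where T="- {0}", OF _ _ Ck_on_add[OF _ A B]])
      (use smooth_on_inverse den in \<open>auto simp: smooth_on_def less_le\<close>)
  show ?thesis
  proof (rule that[of \<beta> "r / 2"])
    show "smooth_on \<beta> UNIV" unfolding smooth_on_def \<beta>_def
      by (intro allI Ck_on_mult A C) auto
    show "\<beta> x = 1" if "dist x c < r / 2" for x
    proof -
      have "(dist x c)\<^sup>2 \<le> (r / 2)\<^sup>2" using that by (intro power_mono) auto
      then have "2 * (dist x c)\<^sup>2 \<le> r\<^sup>2"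
        by (simp add: power_divide) (use zero_le_power2[of "dist x c"] in linarith)
      then have "q x \<ge> 1" using assms by (simp add: qx field_simps)
      then show ?thesis using den[of x] F0[of "1 - q x"] by (simp add: \<beta>_def)
    qed
    show "\<beta> x = 0" if "dist x c \<ge> r" for x
    proof -
      have "(dist x c)\<^sup>2 \<ge> r\<^sup>2" using that assms by (intro power_mono) auto
      then have "q x \<le> 0" using assms by (simp add: qx field_simps)
      then show ?thesis using F0 by (simp add: \<beta>_def)
    qed
  qed (use assms in auto)
qed


section \<open>Germs, tangent vectors and vector fields\<close>

locale smooth_mfd =
  fixes M :: "('a, 'e::euclidean_space) mfd"
  assumes smooth_manifold: "smooth_manifold M"
begin

abbreviation opn :: "'a set \<Rightarrow> bool" where "opn \<equiv> openin (mtop M)"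
abbreviation P :: "'a set" where "P \<equiv> pts M"
abbreviation T :: "'a \<Rightarrow> 'a tvec set" where "T \<equiv> tangent_space M"
abbreviation near :: "'a \<Rightarrow> ('a \<Rightarrow> real) \<Rightarrow> bool" where "near \<equiv> smooth_near M"

section \<open>Charts and germs of smooth functions\<close>

lemma chart_at:
  assumes "p \<in> P" obtains U x where "(U, x) \<in> atlas M" "p \<in> U"
proof -
  have "(\<Union>(U, x)\<in>atlas M. U) = P" using smooth_manifold unfolding smooth_manifold_def by blast
  then have "p \<in> (\<Union>(U, x)\<in>atlas M. U)" using assms by simp
  then show ?thesis using that by blast
qed

context
  fixes U x assumes c: "(U, x) \<in> atlas M"
begin

lemma is_chart: "is_chart (mtop M) U x"
  using smooth_manifold c unfolding smooth_manifold_def by auto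

lemma chart_open: "opn U" using is_chart unfolding is_chart_def by auto

lemma chart_subset: "U \<subseteq> P" using chart_open by (rule openin_subset)

lemma chart_homeo: "homeomorphic_map (subtopology (mtop M) U) (top_of_set (x ` U)) x"
  using is_chart unfolding is_chart_def by auto

lemma chart_inj: "inj_on x U"
  using homeomorphic_imp_injective_map[OF chart_homeo] chart_subset by (simp add: Int_absorb1)

lemma chart_inv [simp]: "q \<in> U \<Longrightarrow> inv_into U x (x q) = q"
  using chart_inj by simp

lemma chart_image_open:
  assumes "opn W" "W \<subseteq> U" shows "open (x ` W)"
proof -
  have "openin (subtopology (mtop M) U) W"
    using assms by (auto simp: openin_subtopology)
  then have "openin (top_of_set (x ` U)) (x ` W)"
    using homeomorphic_imp_open_map[OF chart_homeo] by (auto simp: open_map_def)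
  moreover have "open (x ` U)" using is_chart unfolding is_chart_def by auto
  ultimately show ?thesis by (metis openin_open_eq)
qed

lemma chart_vimage_open:
  assumes "open S" shows "opn {q \<in> U. x q \<in> S}"
proof -
  have "openin (subtopology (mtop M) U) {q \<in> topspace (subtopology (mtop M) U). x q \<in> S \<inter> x ` U}"
    by (rule openin_continuous_map_preimage[OF homeomorphic_imp_continuous_map[OF chart_homeo]])
      (use assms in \<open>auto simp: openin_open\<close>)
  moreover have "{q \<in> topspace (subtopology (mtop M) U). x q \<in> S \<inter> x ` U} = {q \<in> U. x q \<in> S}"
    using chart_subset by auto
  ultimately show ?thesis using chart_open by (metis openin_trans_full)
qed

end

lemma transition:
  assumes "(U, x) \<in> atlas M" "(V, y) \<in> atlas M"
  shows "smooth_on (y \<circ> inv_into U x) (x ` (U \<inter> V))"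
  using smooth_manifold assms unfolding smooth_manifold_def by fastforce

lemma smooth_on_subset: "smooth_on f S \<Longrightarrow> S' \<subseteq> S \<Longrightarrow> smooth_on f S'"
  unfolding smooth_on_def by (blast intro: Ck_on_subset)

lemma smooth_fun_subset: "smooth_fun M V f \<Longrightarrow> W \<subseteq> V \<Longrightarrow> smooth_fun M W f"
  unfolding smooth_fun_def by (fastforce intro: smooth_on_subset)

lemma nearI: "smooth_fun M V f \<Longrightarrow> opn V \<Longrightarrow> p \<in> V \<Longrightarrow> near p f"
  unfolding smooth_near_def by auto

lemma near_nhd: "near p f \<Longrightarrow> \<exists>V. opn V \<and> p \<in> V \<and> (\<forall>q\<in>V. near q f)"
  unfolding smooth_near_def by metis

lemma near_in_P: "near p f \<Longrightarrow> p \<in> P"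
  unfolding smooth_near_def using openin_subset by fastforce

text \<open>Composition with a smooth transition map moves a smooth local representative into every
  other chart, so smoothness near a point can be checked in a single chart of choice.\<close>

lemma near_chart_iff:
  assumes c: "(U, x) \<in> atlas M" and p: "p \<in> U"
  shows "near p f \<longleftrightarrow> (\<exists>S. open S \<and> x p \<in> S \<and> S \<subseteq> x ` U \<and> smooth_on (f \<circ> inv_into U x) S)"
proof
  assume "near p f"
  then obtain V where V: "opn V" "p \<in> V" "smooth_fun M V f" unfolding smooth_near_def by auto
  show "\<exists>S. open S \<and> x p \<in> S \<and> S \<subseteq> x ` U \<and> smooth_on (f \<circ> inv_into U x) S"
  proof (intro exI conjI)
    show "open (x ` (U \<inter> V))"
      using chart_image_open[OF c] chart_open[OF c] V by auto
    show "smooth_on (f \<circ> inv_into U x) (x ` (U \<inter> V))"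
      using V c unfolding smooth_fun_def by fastforce
  qed (use V p in auto)
next
  assume "\<exists>S. open S \<and> x p \<in> S \<and> S \<subseteq> x ` U \<and> smooth_on (f \<circ> inv_into U x) S"
  then obtain S where S: "open S" "x p \<in> S" "S \<subseteq> x ` U" "smooth_on (f \<circ> inv_into U x) S" by auto
  define V where "V = {q \<in> U. x q \<in> S}"
  have V: "opn V" "p \<in> V" "V \<subseteq> U"
    using chart_vimage_open[OF c S(1)] p S by (auto simp: V_def)
  have "smooth_on (f \<circ> inv_into W y) (y ` (W \<inter> V))" if d: "(W, y) \<in> atlas M" for W y
    unfolding smooth_on_def
  proof
    fix k
    have o: "open (y ` (W \<inter> V))"
      using chart_image_open[OF d] chart_open[OF d] V by auto
    have "Ck_on k (x \<circ> inv_into W y) (y ` (W \<inter> V))"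
      using smooth_on_subset[OF transition[OF d c], of "y ` (W \<inter> V)"] V
      unfolding smooth_on_def by auto
    moreover have "(x \<circ> inv_into W y) ` (y ` (W \<inter> V)) \<subseteq> S"
      using d by (auto simp: V_def)
    moreover have "Ck_on k (f \<circ> inv_into U x) S"
      using S unfolding smooth_on_def by auto
    ultimately have "Ck_on k (\<lambda>z. (f \<circ> inv_into U x) ((x \<circ> inv_into W y) z)) (y ` (W \<inter> V))"
      using Ck_on_compose[OF o] by blast
    then show "Ck_on k (f \<circ> inv_into W y) (y ` (W \<inter> V))"
      by (subst Ck_on_cong[OF o, where g="\<lambda>z. (f \<circ> inv_into U x) ((x \<circ> inv_into W y) z)"])
        (use c d V in auto)
  qed
  then have "smooth_fun M V f" unfolding smooth_fun_def by auto
  then show "near p f" using V nearI by auto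
qed

text \<open>Replaces the quantification over all charts by a condition on germs, so that later
  smoothness arguments can be made point by point.\<close>

lemma smooth_fun_iff:
  assumes V: "opn V"
  shows "smooth_fun M V f \<longleftrightarrow> (\<forall>p\<in>V. near p f)"
proof
  assume n: "\<forall>p\<in>V. near p f"
  show "smooth_fun M V f"
    unfolding smooth_fun_def smooth_on_def
  proof (safe, rule Ck_on_local)
    fix U x k z assume c: "(U, x) \<in> atlas M" and z: "z \<in> x ` (U \<inter> V)"
    then obtain p where p: "z = x p" "p \<in> U" "p \<in> V" by auto
    then show "\<exists>S. open S \<and> z \<in> S \<and> Ck_on k (f \<circ> inv_into U x) S"
      using n near_chart_iff[OF c p(2), of f] unfolding smooth_on_def by auto
  qed
qed (use nearI V in auto)

lemma near_cong_imp:
  assumes "opn V" "p \<in> V" "\<And>q. q \<in> V \<Longrightarrow> f q = g q" "near p f"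
  shows "near p g"
proof -
  obtain W where W: "opn W" "p \<in> W" "smooth_fun M W f" using assms unfolding smooth_near_def by auto
  have "smooth_on (g \<circ> inv_into U x) (x ` (U \<inter> (V \<inter> W)))" if c: "(U, x) \<in> atlas M" for U x
  proof -
    have o: "open (x ` (U \<inter> (V \<inter> W)))"
      by (rule chart_image_open[OF c]) (use chart_open[OF c] assms W in auto)
    have "smooth_fun M (V \<inter> W) f" using W smooth_fun_subset by blast
    then have "smooth_on (f \<circ> inv_into U x) (x ` (U \<inter> (V \<inter> W)))"
      using c unfolding smooth_fun_def by fastforce
    then show ?thesis
      unfolding smooth_on_def
      by (subst Ck_on_cong[OF o, where g="f \<circ> inv_into U x"]) (use c assms in auto)
  qed
  then show ?thesis
    using assms W by (intro nearI[of "V \<inter> W"]) (auto simp: smooth_fun_def)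
qed

lemma near_cong:
  assumes "opn V" "p \<in> V" "\<And>q. q \<in> V \<Longrightarrow> f q = g q"
  shows "near p f \<longleftrightarrow> near p g"
  using near_cong_imp[OF assms(1,2), of f g] near_cong_imp[OF assms(1,2), of g f] assms(3) by auto

lemma near_const: "p \<in> P \<Longrightarrow> near p (\<lambda>_. c)"
  by (rule nearI[of P]) (auto simp: smooth_fun_def smooth_on_def comp_def Ck_on_const)

lemma near_add:
  assumes "near p f" "near p g" shows "near p (\<lambda>q. f q + g q)"
proof -
  obtain U x where c: "(U, x) \<in> atlas M" "p \<in> U" using near_in_P[OF assms(1)] chart_at by blast
  obtain S where S: "open S" "x p \<in> S" "S \<subseteq> x ` U" "smooth_on (f \<circ> inv_into U x) S"
    using near_chart_iff[OF c] assms by blast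
  obtain S' where S': "open S'" "x p \<in> S'" "S' \<subseteq> x ` U" "smooth_on (g \<circ> inv_into U x) S'"
    using near_chart_iff[OF c] assms by blast
  have "smooth_on (\<lambda>z. (f \<circ> inv_into U x) z + (g \<circ> inv_into U x) z) (S \<inter> S')"
    using S(4) S'(4) S(1) S'(1) unfolding smooth_on_def
    by (intro allI Ck_on_add open_Int) (blast intro: Ck_on_subset)+
  then show ?thesis unfolding near_chart_iff[OF c] comp_def
    using S S' by (intro exI[of _ "S \<inter> S'"]) auto
qed

lemma near_mult:
  assumes "near p f" "near p g" shows "near p (\<lambda>q. f q * g q)"
proof -
  obtain U x where c: "(U, x) \<in> atlas M" "p \<in> U" using near_in_P[OF assms(1)] chart_at by blast
  obtain S where S: "open S" "x p \<in> S" "S \<subseteq> x ` U" "smooth_on (f \<circ> inv_into U x) S"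
    using near_chart_iff[OF c] assms by blast
  obtain S' where S': "open S'" "x p \<in> S'" "S' \<subseteq> x ` U" "smooth_on (g \<circ> inv_into U x) S'"
    using near_chart_iff[OF c] assms by blast
  have "smooth_on (\<lambda>z. (f \<circ> inv_into U x) z * (g \<circ> inv_into U x) z) (S \<inter> S')"
    using S(4) S'(4) S(1) S'(1) unfolding smooth_on_def
    by (intro allI Ck_on_mult open_Int) (blast intro: Ck_on_subset)+
  then show ?thesis unfolding near_chart_iff[OF c] comp_def
    using S S' by (intro exI[of _ "S \<inter> S'"]) auto
qed

lemma near_uminus: "near p f \<Longrightarrow> near p (\<lambda>q. - f q)"
  using near_mult[OF near_const[of p "-1"], of f] near_in_P by fastforce

lemma near_continuous:
  assumes "near p f" "open S" "f p \<in> S"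
  obtains V where "opn V" "p \<in> V" "\<And>q. q \<in> V \<Longrightarrow> f q \<in> S"
proof -
  obtain U x where c: "(U, x) \<in> atlas M" "p \<in> U" using near_in_P[OF assms(1)] chart_at by blast
  obtain S' where S': "open S'" "x p \<in> S'" "S' \<subseteq> x ` U" "smooth_on (f \<circ> inv_into U x) S'"
    using near_chart_iff[OF c] assms by blast
  have "continuous_on S' (f \<circ> inv_into U x)" using S'(4) unfolding smooth_on_def
    by (metis Ck_on.simps(1))
  then have o: "open (S' \<inter> (f \<circ> inv_into U x) -` S)"
    using S' assms by (intro continuous_open_preimage)
  show ?thesis
    by (rule that[OF chart_vimage_open[OF c(1) o]]) (use c assms S' in auto)
qed

lemma near_compose:
  fixes \<psi> :: "real \<Rightarrow> real"
  assumes "near p f" "open S" "f p \<in> S" "smooth_on \<psi> S"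
  shows "near p (\<lambda>q. \<psi> (f q))"
proof -
  obtain U x where c: "(U, x) \<in> atlas M" "p \<in> U" using near_in_P[OF assms(1)] chart_at by blast
  obtain S' where S': "open S'" "x p \<in> S'" "S' \<subseteq> x ` U" "smooth_on (f \<circ> inv_into U x) S'"
    using near_chart_iff[OF c] assms by blast
  define S2 where "S2 = S' \<inter> (f \<circ> inv_into U x) -` S"
  have "continuous_on S' (f \<circ> inv_into U x)" using S'(4) unfolding smooth_on_def
    by (metis Ck_on.simps(1))
  then have o: "open S2"
    using S' assms unfolding S2_def by (intro continuous_open_preimage)
  have "Ck_on k (\<lambda>z. \<psi> ((f \<circ> inv_into U x) z)) S2" for k
    by (rule Ck_on_compose[OF o, where T=S and f="f \<circ> inv_into U x" and g=\<psi>])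
      (use assms S' in \<open>auto simp: S2_def smooth_on_def simp del: comp_apply intro: Ck_on_subset\<close>)
  then show ?thesis unfolding near_chart_iff[OF c]
    using o S' c assms by (intro exI[of _ S2]) (auto simp: S2_def smooth_on_def comp_def)
qed

lemma near_chart_component:
  assumes c: "(U, x) \<in> atlas M" "p \<in> U"
  shows "near p (\<lambda>q. x q \<bullet> b)"
  unfolding near_chart_iff[OF c]
proof (intro exI conjI)
  show o: "open (x ` U)" using is_chart[OF c(1)] unfolding is_chart_def by auto
  show "smooth_on ((\<lambda>q. x q \<bullet> b) \<circ> inv_into U x) (x ` U)"
    unfolding smooth_on_def
    by (subst Ck_on_cong[OF o, where g="\<lambda>z. z \<bullet> b"])
      (use c in \<open>auto intro: Ck_on_linear bounded_linear_inner_left\<close>)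
qed (use c in auto)


section \<open>Tangent vectors as derivations\<close>

lemma near_chart_diff:
  assumes c: "(U, x) \<in> atlas M" "p \<in> U" and "near p f"
  shows "(f \<circ> inv_into U x) differentiable (at (x p))"
  using assms(3) unfolding near_chart_iff[OF c] smooth_on_def by (metis Ck_on.simps(2))

lemma frechet_derivative_chart_cong:
  assumes c: "(U, x) \<in> atlas M" "p \<in> U" and V: "opn V" "p \<in> V"
    and e: "\<And>q. q \<in> V \<Longrightarrow> f q = g q" and n: "near p f"
  shows "frechet_derivative (f \<circ> inv_into U x) (at (x p)) = frechet_derivative (g \<circ> inv_into U x) (at (x p))"
proof (rule frechet_derivative_transform_within_open)
  show "(f \<circ> inv_into U x) differentiable at (x p)" by (rule near_chart_diff[OF c n])
  show "open (x ` (U \<inter> V))" using chart_image_open[OF c(1)] chart_open[OF c(1)] V(1) by auto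
  show "x p \<in> x ` (U \<inter> V)" using c(2) V(2) by simp
  fix z assume "z \<in> x ` (U \<inter> V)"
  then obtain q where "q \<in> U" "q \<in> V" "z = x q" by blast
  then show "(f \<circ> inv_into U x) z = (g \<circ> inv_into U x) z" using c(1) e by simp
qed

text \<open>The chain rule for the transition map. On functions that are not smooth near
  \<open>p\<close> both operators have the default value 0, so they agree as total
  operators.\<close>

lemma dir_deriv_chart_change:
  assumes c: "(U, x) \<in> atlas M" "p \<in> U" and d: "(W, y) \<in> atlas M" "p \<in> W"
  shows "dir_deriv M U x p a =
    dir_deriv M W y p (frechet_derivative (y \<circ> inv_into U x) (at (x p)) a)"
proof
  fix f
  show "dir_deriv M U x p a f =
    dir_deriv M W y p (frechet_derivative (y \<circ> inv_into U x) (at (x p)) a) f"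
  proof (cases "near p f")
    case True
    have "Ck_on (Suc 0) (y \<circ> inv_into U x) (x ` (U \<inter> W))"
      using transition[OF c(1) d(1)] unfolding smooth_on_def by auto
    then have yd: "(y \<circ> inv_into U x) differentiable (at (x p))"
      using c d by auto
    have p: "(y \<circ> inv_into U x) (x p) = y p" using c by simp
    have fd: "((f \<circ> inv_into W y) has_derivative frechet_derivative (f \<circ> inv_into W y) (at (y p)))
        (at ((y \<circ> inv_into U x) (x p)))"
      unfolding p by (rule has_frechet_derivative[OF near_chart_diff[OF d True]])
    have "((\<lambda>z. (f \<circ> inv_into W y) ((y \<circ> inv_into U x) z)) has_derivative
       (\<lambda>v. frechet_derivative (f \<circ> inv_into W y) (at (y p))
          (frechet_derivative (y \<circ> inv_into U x) (at (x p)) v))) (at (x p))"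
      by (rule has_derivative_compose[OF has_frechet_derivative[OF yd] fd])
    moreover have "open (x ` (U \<inter> W))"
      using chart_image_open[OF c(1)] chart_open[OF c(1)] chart_open[OF d(1)] by auto
    ultimately have "((f \<circ> inv_into U x) has_derivative
       (\<lambda>v. frechet_derivative (f \<circ> inv_into W y) (at (y p))
          (frechet_derivative (y \<circ> inv_into U x) (at (x p)) v))) (at (x p))"
      by (rule has_derivative_transform_within_open) (use c d in auto)
    then show ?thesis using True by (simp add: dir_deriv_def frechet_derivative_eqI)
  qed (simp add: dir_deriv_def)
qed

text \<open>All charts at \<open>p\<close> yield the same operators, so the union over charts in the
  definition is the image of a single map; its linearity then makes the tangent space a
  subspace.\<close>

lemma tangent_space_chart:
  assumes "(U, x) \<in> atlas M" "p \<in> U"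
  shows "T p = range (dir_deriv M U x p)"
  unfolding tangent_space_def using dir_deriv_chart_change[OF _ _ assms] assms by blast

lemma linear_dir_deriv:
  assumes c: "(U, x) \<in> atlas M" "p \<in> U"
  shows "linear (dir_deriv M U x p)"
proof -
  have "linear (frechet_derivative (f \<circ> inv_into U x) (at (x p)))" if "near p f" for f
    using near_chart_diff[OF c that] by (rule linear_frechet_derivative)
  then show ?thesis
    by (intro linearI)
      (auto simp: dir_deriv_def fun_eq_iff scaleR_fun_def linear_add linear_cmul)
qed

lemma dir_deriv_component:
  assumes c: "(U, x) \<in> atlas M" "p \<in> U"
  shows "dir_deriv M U x p v (\<lambda>q. x q \<bullet> i) = v \<bullet> i"
proof -
  have o: "open (x ` U)" using is_chart[OF c(1)] unfolding is_chart_def by blast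
  have "((\<lambda>z. z \<bullet> i) has_derivative (\<lambda>z. z \<bullet> i)) (at (x p))"
    by (intro bounded_linear_imp_has_derivative bounded_linear_inner_left)
  then have "(((\<lambda>q. x q \<bullet> i) \<circ> inv_into U x) has_derivative (\<lambda>z. z \<bullet> i)) (at (x p))"
  proof (rule has_derivative_transform_within_open[OF _ o])
    show "x p \<in> x ` U" using c(2) by simp
    fix z assume "z \<in> x ` U"
    then obtain q where "q \<in> U" "z = x q" by blast
    then show "z \<bullet> i = ((\<lambda>q. x q \<bullet> i) \<circ> inv_into U x) z" using c(1) by simp
  qed
  then have "frechet_derivative ((\<lambda>q. x q \<bullet> i) \<circ> inv_into U x) (at (x p)) = (\<lambda>z. z \<bullet> i)"
    by (rule frechet_derivative_eqI)
  then show ?thesis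
    unfolding dir_deriv_def using near_chart_component[OF c] by simp
qed

text \<open>Evaluation on the coordinate functions recovers the components of the coordinate
  vector.\<close>

lemma inj_dir_deriv:
  assumes c: "(U, x) \<in> atlas M" "p \<in> U"
  shows "inj (dir_deriv M U x p)"
proof (rule injI)
  fix a b assume e: "dir_deriv M U x p a = dir_deriv M U x p b"
  have "dir_deriv M U x p a (\<lambda>q. x q \<bullet> i) = dir_deriv M U x p b (\<lambda>q. x q \<bullet> i)" for i
    by (simp only: e)
  then have ab: "a \<bullet> i = b \<bullet> i" for i
    by (simp only: dir_deriv_component[OF c])
  show "a = b" by (rule euclidean_eqI) (rule ab)
qed

lemma subspace_T:
  assumes "p \<in> P" shows "subspace (T p)"
proof -
  obtain U x where c: "(U, x) \<in> atlas M" "p \<in> U" using assms chart_at by blast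
  show ?thesis unfolding tangent_space_chart[OF c]
    using linear_subspace_image[OF linear_dir_deriv[OF c] subspace_UNIV] .
qed

context
  fixes p v assumes p: "p \<in> P" and v: "v \<in> T p"
begin

lemma tv_chart:
  obtains U x a where "(U, x) \<in> atlas M" "p \<in> U" "v = dir_deriv M U x p a"
  using v unfolding tangent_space_def by auto

text \<open>Both the smoothness test and the derivative see only the germ at \<open>p\<close>, and
  nonsmooth germs have the default value 0, so the equality covers arbitrary functions.\<close>

lemma tv_cong:
  assumes "opn V" "p \<in> V" "\<And>q. q \<in> V \<Longrightarrow> f q = g q"
  shows "v f = v g"
proof -
  obtain U x a where c: "(U, x) \<in> atlas M" "p \<in> U" "v = dir_deriv M U x p a" by (rule tv_chart)
  show ?thesis
    using frechet_derivative_chart_cong[OF c(1,2) assms] near_cong[OF assms]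
    by (simp add: c dir_deriv_def)
qed

lemma tv_const: "v (\<lambda>_. k) = 0"
  by (rule tv_chart) (simp add: dir_deriv_def comp_def)

lemma tv_add:
  assumes "near p f" "near p g" shows "v (\<lambda>q. f q + g q) = v f + v g"
proof -
  obtain U x a where c: "(U, x) \<in> atlas M" "p \<in> U" "v = dir_deriv M U x p a" by (rule tv_chart)
  have "((\<lambda>z. (f \<circ> inv_into U x) z + (g \<circ> inv_into U x) z) has_derivative
      (\<lambda>a. frechet_derivative (f \<circ> inv_into U x) (at (x p)) a
         + frechet_derivative (g \<circ> inv_into U x) (at (x p)) a)) (at (x p))"
    by (intro has_derivative_add has_frechet_derivative near_chart_diff[OF c(1,2)] assms)
  then show ?thesis
    using assms near_add[OF assms] by (auto simp: c dir_deriv_def comp_def dest!: frechet_derivative_eqI)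
qed

lemma tv_mult:
  assumes "near p f" "near p g" shows "v (\<lambda>q. f q * g q) = f p * v g + g p * v f"
proof -
  obtain U x a where c: "(U, x) \<in> atlas M" "p \<in> U" "v = dir_deriv M U x p a" by (rule tv_chart)
  have "((\<lambda>z. (f \<circ> inv_into U x) z * (g \<circ> inv_into U x) z) has_derivative
      (\<lambda>a. (f \<circ> inv_into U x) (x p) * frechet_derivative (g \<circ> inv_into U x) (at (x p)) a
         + frechet_derivative (f \<circ> inv_into U x) (at (x p)) a * (g \<circ> inv_into U x) (x p))) (at (x p))"
    by (intro has_derivative_mult has_frechet_derivative near_chart_diff[OF c(1,2)] assms)
  then show ?thesis
    using assms near_mult[OF assms] c(1,2)
    by (auto simp: c(3) dir_deriv_def comp_def dest!: frechet_derivative_eqI)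
qed

lemma tv_uminus:
  assumes "near p f" shows "v (\<lambda>q. - f q) = - v f"
  using tv_mult[OF near_const[OF p, of "-1"] assms] by (simp add: tv_const)

lemma tv_diff:
  assumes "near p f" "near p g" shows "v (\<lambda>q. f q - g q) = v f - v g"
  using tv_add[OF assms(1) near_uminus[OF assms(2)]] tv_uminus[OF assms(2)] by simp

end

section \<open>Smooth vector fields\<close>

lemma vfields_iff:
  assumes U: "opn U"
  shows "X \<in> vfields M U \<longleftrightarrow> (\<forall>p\<in>U. X p \<in> T p \<and> (\<forall>f. near p f \<longrightarrow> near p (\<lambda>q. X q f)))"
proof (intro iffI ballI conjI allI impI)
  fix p f assume X: "X \<in> vfields M U" and p: "p \<in> U" and "near p f"
  then obtain V where V: "opn V" "p \<in> V" "smooth_fun M V f" unfolding smooth_near_def by auto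
  then have "smooth_fun M (U \<inter> V) f" "opn (U \<inter> V)" using smooth_fun_subset[of V f "U \<inter> V"] U by auto
  then have "smooth_fun M (U \<inter> V) (\<lambda>q. X q f)" using X by (auto simp: vfields_def)
  then show "near p (\<lambda>q. X q f)" using nearI \<open>opn (U \<inter> V)\<close> p V by blast
next
  assume *: "\<forall>p\<in>U. X p \<in> T p \<and> (\<forall>f. near p f \<longrightarrow> near p (\<lambda>q. X q f))"
  then show "X \<in> vfields M U" unfolding vfields_def by (auto simp: smooth_fun_iff)
qed (auto simp: vfields_def)

lemma vfields_T: "X \<in> vfields M U \<Longrightarrow> p \<in> U \<Longrightarrow> X p \<in> T p"
  by (simp add: vfields_def)

lemma vfields_near: "X \<in> vfields M U \<Longrightarrow> opn U \<Longrightarrow> p \<in> U \<Longrightarrow> near p f \<Longrightarrow> near p (\<lambda>q. X q f)"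
  using vfields_iff by blast

lemma vfields_subset: "X \<in> vfields M U \<Longrightarrow> W \<subseteq> U \<Longrightarrow> X \<in> vfields M W"
  unfolding vfields_def by blast

lemma vfields_cong:
  assumes U: "opn U" and e: "\<And>p. p \<in> U \<Longrightarrow> X p = Y p" and X: "X \<in> vfields M U"
  shows "Y \<in> vfields M U"
  unfolding vfields_iff[OF U]
proof (intro ballI conjI allI impI)
  fix p assume p: "p \<in> U"
  show "Y p \<in> T p" using vfields_T[OF X p] e[OF p] by simp
  fix f assume "near p f"
  then have "near p (\<lambda>q. X q f)" using vfields_near[OF X U p] by simp
  then show "near p (\<lambda>q. Y q f)" by (rule near_cong_imp[OF U p, rotated]) (simp add: e)
qed

lemma vfields_add:
  assumes U: "opn U" and X: "X \<in> vfields M U" and Y: "Y \<in> vfields M U"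
  shows "(\<lambda>p. X p + Y p) \<in> vfields M U"
  unfolding vfields_iff[OF U]
proof (intro ballI conjI allI impI)
  fix p assume p: "p \<in> U"
  then have "p \<in> P" using openin_subset[OF U] by blast
  then show "X p + Y p \<in> T p"
    using subspace_T subspace_add vfields_T[OF X p] vfields_T[OF Y p] by blast
  fix k assume "near p k"
  then have "near p (\<lambda>q. X q k + Y q k)"
    using near_add vfields_near[OF X U p] vfields_near[OF Y U p] by blast
  then show "near p (\<lambda>q. (X q + Y q) k)" by simp
qed

lemma vfields_zero:
  assumes U: "opn U" shows "(\<lambda>p. 0) \<in> vfields M U"
  unfolding vfields_iff[OF U]
  using openin_subset[OF U] by (auto intro!: near_const subspace_0 subspace_T)

lemma vfields_scale:
  assumes U: "opn U" and X: "X \<in> vfields M U" and f: "smooth_fun M U f"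
  shows "(\<lambda>p. f p *\<^sub>R X p) \<in> vfields M U"
  unfolding vfields_iff[OF U]
proof (intro ballI conjI allI impI)
  fix p assume p: "p \<in> U"
  then have "p \<in> P" using openin_subset[OF U] by blast
  then show "f p *\<^sub>R X p \<in> T p" using subspace_T subspace_scale vfields_T[OF X p] by blast
  fix k assume "near p k"
  then have "near p (\<lambda>q. f q * X q k)"
    using near_mult vfields_near[OF X U p] f p smooth_fun_iff[OF U] by blast
  then show "near p (\<lambda>q. (f q *\<^sub>R X q) k)" by (simp add: scaleR_fun_def)
qed

lemma vfields_sum:
  assumes "opn U" "\<And>i. i \<in> I \<Longrightarrow> X i \<in> vfields M U"
  shows "(\<lambda>p. \<Sum>i\<in>I. X i p) \<in> vfields M U"
  using assms(2)
  by (induction I rule: infinite_finite_induct)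
    (auto intro: vfields_add assms(1) simp: vfields_zero[OF assms(1)])

text \<open>In the chart, the derivative of \<open>f\<close> along the field is represented by a
  directional derivative of the representative of \<open>f\<close>. This costs one order of
  differentiability, hence the use of \<open>Suc k\<close>.\<close>

lemma coordinate_field:
  assumes c: "(U, x) \<in> atlas M"
  shows "(\<lambda>p. dir_deriv M U x p a) \<in> vfields M U"
  unfolding vfields_iff[OF chart_open[OF c]]
proof (intro ballI conjI allI impI)
  fix p assume p: "p \<in> U"
  show "dir_deriv M U x p a \<in> T p" using c p unfolding tangent_space_def by auto
  fix f assume n: "near p f"
  then obtain S where S: "open S" "x p \<in> S" "S \<subseteq> x ` U" "smooth_on (f \<circ> inv_into U x) S"
    using near_chart_iff[OF c p] by blast
  have sub: "near (inv_into U x z) f" if "z \<in> S" for z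
    using near_chart_iff[OF c, of "inv_into U x z" f] S that
    by (metis f_inv_into_f inv_into_into subsetD)
  show "near p (\<lambda>q. dir_deriv M U x q a f)"
    unfolding near_chart_iff[OF c p] smooth_on_def
  proof (intro exI[of _ S] conjI allI S)
    fix k
    have "Ck_on (Suc k) (f \<circ> inv_into U x) S" using S unfolding smooth_on_def by blast
    then have "Ck_on k (\<lambda>z. frechet_derivative (f \<circ> inv_into U x) (at z) a) S" by simp
    then show "Ck_on k ((\<lambda>q. dir_deriv M U x q a f) \<circ> inv_into U x) S"
      by (subst Ck_on_cong[OF S(1), where g="\<lambda>z. frechet_derivative (f \<circ> inv_into U x) (at z) a"])
        (use S(3) sub in \<open>auto simp: dir_deriv_def f_inv_into_f subset_iff\<close>)
  qed
qed

section \<open>Cutoffs and global extension of local fields\<close>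

lemma bump:
  assumes W: "opn W" and p: "p \<in> W"
  obtains b V K where "\<And>q. q \<in> P \<Longrightarrow> near q b" "opn V" "p \<in> V" "V \<subseteq> W" "\<And>q. q \<in> V \<Longrightarrow> b q = 1"
    "K \<subseteq> W" "closedin (mtop M) K" "\<And>q. q \<notin> K \<Longrightarrow> b q = 0"
proof -
  have pP: "p \<in> P" using W p openin_subset by blast
  obtain U x where c: "(U, x) \<in> atlas M" "p \<in> U" using pP chart_at by blast
  have "open (x ` (U \<inter> W))" using chart_image_open[OF c(1)] chart_open[OF c(1)] W by auto
  then obtain r where r: "r > 0" "cball (x p) r \<subseteq> x ` (U \<inter> W)"
    using c p open_contains_cball by blast
  obtain \<beta> :: "'e \<Rightarrow> real" and d where \<beta>: "smooth_on \<beta> UNIV" "0 < d" "d \<le> r"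
    "\<And>z. dist z (x p) < d \<Longrightarrow> \<beta> z = 1" "\<And>z. dist z (x p) \<ge> r \<Longrightarrow> \<beta> z = 0"
    using smooth_bump[OF r(1)] by blast
  define K where "K = inv_into U x ` cball (x p) r"
  define b where "b q = (if q \<in> U then \<beta> (x q) else 0)" for q
  have K: "K \<subseteq> U \<inter> W" using r c unfolding K_def by fastforce
  have xK: "q \<in> K \<longleftrightarrow> q \<in> U \<and> dist (x q) (x p) \<le> r" for q
  proof
    assume q: "q \<in> K"
    then obtain z where z: "z \<in> cball (x p) r" "q = inv_into U x z" unfolding K_def by auto
    then have "x q = z" using r by (auto simp: f_inv_into_f subset_iff)
    then show "q \<in> U \<and> dist (x q) (x p) \<le> r" using z q K by (auto simp: dist_commute)
  next
    assume "q \<in> U \<and> dist (x q) (x p) \<le> r"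
    then show "q \<in> K" unfolding K_def
      by (intro image_eqI[of _ _ "x q"]) (use c in \<open>auto simp: dist_commute\<close>)
  qed
  \<comment> \<open>Compact sets in a Hausdorff space are closed, so the complement of
    \<open>K\<close> is an open set on which the cutoff is 0; this gives smoothness at the points
    outside the chart.\<close>
  have "compactin (mtop M) K"
  proof -
    obtain x' where h: "homeomorphic_maps (subtopology (mtop M) U) (top_of_set (x ` U)) x x'"
      using chart_homeo[OF c(1)] unfolding homeomorphic_map_maps by auto
    have "compactin (top_of_set (x ` U)) (cball (x p) r)"
      using r by (auto simp: compactin_subtopology)
    then have "compactin (subtopology (mtop M) U) (x' ` cball (x p) r)"
      using h unfolding homeomorphic_maps_def by (blast intro: image_compactin)
    moreover have "x' ` cball (x p) r = K"
    proof -
      have "x' z = inv_into U x z" if z: "z \<in> cball (x p) r" for z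
      proof -
        have "inv_into U x z \<in> U" "x (inv_into U x z) = z"
          using r z by (auto simp: f_inv_into_f inv_into_into subset_iff)
        then show ?thesis using h chart_subset[OF c(1)] unfolding homeomorphic_maps_def
          by (metis Int_iff subsetD topspace_subtopology)
      qed
      then show ?thesis unfolding K_def by force
    qed
    ultimately show ?thesis by (simp add: compactin_subtopology)
  qed
  then have closed: "closedin (mtop M) K"
    using smooth_manifold compactin_imp_closedin unfolding smooth_manifold_def by blast
  have out: "b q = 0" if "q \<notin> K" for q
    using that \<beta>(5)[of "x q"] xK[of q] by (auto simp: b_def)
  show ?thesis
  proof (rule that[of b "{q \<in> U. x q \<in> ball (x p) d}" K])
    show "opn {q \<in> U. x q \<in> ball (x p) d}" using chart_vimage_open[OF c(1)] by blast
    show "{q \<in> U. x q \<in> ball (x p) d} \<subseteq> W"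
    proof
      fix q assume "q \<in> {q \<in> U. x q \<in> ball (x p) d}"
      then have "q \<in> K" using xK[of q] \<beta>(3) by (simp add: dist_commute)
      then show "q \<in> W" using K by auto
    qed
    show "b q = 1" if "q \<in> {q \<in> U. x q \<in> ball (x p) d}" for q
      using that \<beta>(4)[of "x q"] by (simp add: b_def dist_commute)
    show "near q b" if q: "q \<in> P" for q
    proof (cases "q \<in> U")
      case True
      have o: "open (x ` U)" using is_chart[OF c(1)] unfolding is_chart_def by auto
      show ?thesis unfolding near_chart_iff[OF c(1) True]
      proof (intro exI[of _ "x ` U"] conjI o)
        show "smooth_on (b \<circ> inv_into U x) (x ` U)" unfolding smooth_on_def
          by (subst Ck_on_cong[OF o, where g=\<beta>])
            (use \<beta>(1) c in \<open>auto simp: b_def smooth_on_def intro: Ck_on_subset\<close>)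
      qed (use True in auto)
    next
      case False
      have "opn (P - K)" using closed by auto
      then show ?thesis
        by (rule near_cong_imp[where f="\<lambda>_. 0"]) (use False q K out in \<open>auto simp: near_const\<close>)
    qed
  qed (use c \<beta> K closed out in auto)
qed

text \<open>Multiplication by a cutoff that is 1 near \<open>p\<close> and vanishes outside a closed
  subset of \<open>U\<close> leaves the germ at \<open>p\<close> unchanged. This is the bridge to
  the hypotheses on the manifold, which concern global fields.\<close>

lemma extend_field:
  assumes U: "opn U" and p: "p \<in> U" and X: "X \<in> vfields M U"
  obtains X' V where "X' \<in> vfields M P" "opn V" "p \<in> V" "V \<subseteq> U" "\<And>q. q \<in> V \<Longrightarrow> X' q = X q"
proof -
  obtain b V K where b: "\<And>q. q \<in> P \<Longrightarrow> near q b" "opn V" "p \<in> V" "V \<subseteq> U" "\<And>q. q \<in> V \<Longrightarrow> b q = 1"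
    "K \<subseteq> U" "closedin (mtop M) K" "\<And>q. q \<notin> K \<Longrightarrow> b q = 0"
    using bump[OF U p] by blast
  define X' where "X' q = b q *\<^sub>R X q" for q
  have "opn P" by simp
  have "X' \<in> vfields M P" unfolding vfields_iff[OF \<open>opn P\<close>]
  proof (intro ballI)
    fix q assume q: "q \<in> P"
    show "X' q \<in> T q \<and> (\<forall>f. near q f \<longrightarrow> near q (\<lambda>q. X' q f))"
    proof (cases "q \<in> U")
      case True
      have "smooth_fun M U b" using b(1) openin_subset[OF U] by (auto simp: smooth_fun_iff[OF U])
      then have "X' \<in> vfields M U" unfolding X'_def using vfields_scale[OF U X] by simp
      then show ?thesis using True by (simp add: vfields_iff[OF U])
    next
      case False
      have o: "opn (P - K)" using b(7) by auto
      have z: "X' q = 0" if "q \<in> P - K" for q using that b(8) by (simp add: X'_def)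
      have m: "q \<in> P - K" using False q b(6) by auto
      have "near q (\<lambda>q. X' q f)" for f
        by (rule near_cong_imp[OF o m, where f="\<lambda>_. 0"]) (use z q in \<open>auto simp: near_const\<close>)
      then show ?thesis using z[OF m] subspace_0[OF subspace_T[OF q]] by simp
    qed
  qed
  then show ?thesis using b(2-5) by (intro that[of X' V]) (auto simp: X'_def)
qed

lemma extend_tvec:
  assumes p: "p \<in> P" and v: "v \<in> T p"
  obtains X where "X \<in> vfields M P" "X p = v"
proof -
  obtain U x a where c: "(U, x) \<in> atlas M" "p \<in> U" "v = dir_deriv M U x p a"
    using tv_chart[OF p v] by blast
  show ?thesis
    using extend_field[OF chart_open[OF c(1)] c(2) coordinate_field[OF c(1), of a]] c(3) that by metis
qed

section \<open>Lie brackets\<close>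

lemma lie_bracket_cong:
  assumes "opn V" "p \<in> V" "\<And>q. q \<in> V \<Longrightarrow> X q = X' q" "\<And>q. q \<in> V \<Longrightarrow> Y q = Y' q"
    "X p \<in> T p" "Y p \<in> T p"
  shows "lie_bracket M X Y p = lie_bracket M X' Y' p"
proof
  fix f
  have p: "p \<in> P" using assms openin_subset by blast
  have "X p (\<lambda>q. Y q f) = X p (\<lambda>q. Y' q f)"
    by (rule tv_cong[OF p assms(5) assms(1,2)]) (simp add: assms)
  moreover have "Y p (\<lambda>q. X q f) = Y p (\<lambda>q. X' q f)"
    by (rule tv_cong[OF p assms(6) assms(1,2)]) (simp add: assms)
  ultimately show "lie_bracket M X Y p f = lie_bracket M X' Y' p f"
    using assms(2-4) by (simp add: lie_bracket_def)
qed

text \<open>Each double bracket expands into four iterated derivatives of \<open>f\<close>, and the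
  twelve terms cancel in pairs. The expansion uses \<open>near_nhd\<close> because a bracket is a
  difference of derivatives only at points near which \<open>f\<close> is smooth.\<close>

lemma jacobi:
  assumes U: "opn U" and p: "p \<in> U"
    and X: "X \<in> vfields M U" and Y: "Y \<in> vfields M U" and Z: "Z \<in> vfields M U"
  shows "lie_bracket M X (lie_bracket M Y Z) p + lie_bracket M Y (lie_bracket M Z X) p
    + lie_bracket M Z (lie_bracket M X Y) p = 0"
proof
  fix f
  have A: "A p (\<lambda>q. lie_bracket M B C q f) = A p (\<lambda>q. B q (\<lambda>r. C r f)) - A p (\<lambda>q. C q (\<lambda>r. B r f))"
    if n: "near p f" and A: "A \<in> vfields M U" and B: "B \<in> vfields M U" and C: "C \<in> vfields M U"
    for A B C
  proof -
    obtain V where V: "opn V" "p \<in> V" "\<forall>q\<in>V. near q f" using near_nhd[OF n] by blast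
    have pP: "p \<in> P" using near_in_P[OF n] .
    have "A p (\<lambda>q. lie_bracket M B C q f) = A p (\<lambda>q. B q (\<lambda>r. C r f) - C q (\<lambda>r. B r f))"
      by (rule tv_cong[OF pP vfields_T[OF A p] V(1,2)]) (simp add: lie_bracket_def V(3))
    then show ?thesis
      using tv_diff[OF pP vfields_T[OF A p]] vfields_near[OF _ U p] B C n by simp
  qed
  show "(lie_bracket M X (lie_bracket M Y Z) p + lie_bracket M Y (lie_bracket M Z X) p
    + lie_bracket M Z (lie_bracket M X Y) p) f = 0 f"
  proof (cases "near p f")
    case True
    have n: "near p (\<lambda>q. B q f)" if "B \<in> vfields M U" for B using vfields_near[OF that U p True] .
    have B: "lie_bracket M B C p (\<lambda>q. A q f) = B p (\<lambda>q. C q (\<lambda>q. A q f)) - C p (\<lambda>q. B q (\<lambda>q. A q f))"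
      if "A \<in> vfields M U" for A B C using n[OF that] by (simp add: lie_bracket_def)
    show ?thesis using True
      by (simp add: lie_bracket_def[of M X "lie_bracket M Y Z"] lie_bracket_def[of M Y "lie_bracket M Z X"]
          lie_bracket_def[of M Z "lie_bracket M X Y"] A[OF True] B X Y Z)
  qed (simp add: lie_bracket_def)
qed

end


section \<open>Curvature identities in an abstract calculus of vector fields\<close>

text \<open>
  \<open>V\<close> plays the role of the vector fields on \<open>U\<close>, \<open>F\<close> of the smooth functions, \<open>sm\<close> of the
  multiplication of a field by a function, \<open>act\<close> of the derivative of a function along a field, \<open>br\<close>
  of the Lie bracket and \<open>gg\<close> of the metric.
\<close>

locale field_calculus =
  fixes U :: "'p set" and V :: "'v::real_vector set" and F :: "('p \<Rightarrow> real) set"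
    and sm :: "('p \<Rightarrow> real) \<Rightarrow> 'v \<Rightarrow> 'v" and act :: "'v \<Rightarrow> ('p \<Rightarrow> real) \<Rightarrow> 'p \<Rightarrow> real"
    and D br :: "'v \<Rightarrow> 'v \<Rightarrow> 'v" and gg :: "'v \<Rightarrow> 'v \<Rightarrow> 'p \<Rightarrow> real"
  assumes subspace_V: "subspace V"
    and F_const [simp]: "(\<lambda>_. c) \<in> F"
    and F_add [simp]: "f \<in> F \<Longrightarrow> f' \<in> F \<Longrightarrow> (\<lambda>p. f p + f' p) \<in> F"
    and F_mult [simp]: "f \<in> F \<Longrightarrow> f' \<in> F \<Longrightarrow> (\<lambda>p. f p * f' p) \<in> F"
    and sm_V [simp]: "f \<in> F \<Longrightarrow> X \<in> V \<Longrightarrow> sm f X \<in> V"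
    and sm_const: "sm (\<lambda>_. c) X = c *\<^sub>R X"
    and sm_add_right: "sm f (X + Y) = sm f X + sm f Y"
    and sm_add_left: "sm (\<lambda>p. f p + f' p) X = sm f X + sm f' X"
    and sm_sm: "sm f (sm f' X) = sm (\<lambda>p. f p * f' p) X"
    and act_F [simp]: "X \<in> V \<Longrightarrow> f \<in> F \<Longrightarrow> act X f \<in> F"
    and act_add_fun: "X \<in> V \<Longrightarrow> f \<in> F \<Longrightarrow> f' \<in> F \<Longrightarrow> act X (\<lambda>p. f p + f' p) p = act X f p + act X f' p"
    and act_mult_fun: "X \<in> V \<Longrightarrow> f \<in> F \<Longrightarrow> f' \<in> F \<Longrightarrow>
          act X (\<lambda>p. f p * f' p) p = f p * act X f' p + f' p * act X f p"
    and act_const: "X \<in> V \<Longrightarrow> act X (\<lambda>_. c) p = 0"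
    and act_cong: "X \<in> V \<Longrightarrow> (\<And>q. q \<in> U \<Longrightarrow> f q = f' q) \<Longrightarrow> act X f p = act X f' p"
    and act_add: "X \<in> V \<Longrightarrow> Y \<in> V \<Longrightarrow> act (X + Y) f p = act X f p + act Y f p"
    and act_sm: "X \<in> V \<Longrightarrow> act (sm f' X) f p = f' p * act X f p"
    and gg_F [simp]: "X \<in> V \<Longrightarrow> Y \<in> V \<Longrightarrow> gg X Y \<in> F"
    and gg_sym: "X \<in> V \<Longrightarrow> Y \<in> V \<Longrightarrow> gg X Y p = gg Y X p"
    and gg_add_left: "X \<in> V \<Longrightarrow> Y \<in> V \<Longrightarrow> Z \<in> V \<Longrightarrow> gg (X + Y) Z p = gg X Z p + gg Y Z p"
    and gg_sm_left: "f \<in> F \<Longrightarrow> X \<in> V \<Longrightarrow> Y \<in> V \<Longrightarrow> gg (sm f X) Y p = f p * gg X Y p"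
    and D_V [simp]: "X \<in> V \<Longrightarrow> Y \<in> V \<Longrightarrow> D X Y \<in> V"
    and D_add_left: "X \<in> V \<Longrightarrow> Y \<in> V \<Longrightarrow> Z \<in> V \<Longrightarrow> D (X + Y) Z = D X Z + D Y Z"
    and D_add_right: "X \<in> V \<Longrightarrow> Y \<in> V \<Longrightarrow> Z \<in> V \<Longrightarrow> D Z (X + Y) = D Z X + D Z Y"
    and D_sm_left: "f \<in> F \<Longrightarrow> X \<in> V \<Longrightarrow> Y \<in> V \<Longrightarrow> D (sm f X) Y = sm f (D X Y)"
    and D_sm_right: "f \<in> F \<Longrightarrow> X \<in> V \<Longrightarrow> Y \<in> V \<Longrightarrow> D X (sm f Y) = sm (act X f) Y + sm f (D X Y)"
    and torsion_free: "X \<in> V \<Longrightarrow> Y \<in> V \<Longrightarrow> br X Y = D X Y - D Y X"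
    and act_br: "X \<in> V \<Longrightarrow> Y \<in> V \<Longrightarrow> f \<in> F \<Longrightarrow>
          act (br X Y) f p = act X (act Y f) p - act Y (act X f) p"
    and br_jacobi: "X \<in> V \<Longrightarrow> Y \<in> V \<Longrightarrow> Z \<in> V \<Longrightarrow>
          br X (br Y Z) + br Y (br Z X) + br Z (br X Y) = 0"
    and metric: "X \<in> V \<Longrightarrow> Y \<in> V \<Longrightarrow> Z \<in> V \<Longrightarrow>
          act X (gg Y Z) p = gg (D X Y) Z p + gg Y (D X Z) p"
begin

section \<open>Linearity rules derived from the axioms\<close>

lemma V_add [simp]: "X \<in> V \<Longrightarrow> Y \<in> V \<Longrightarrow> X + Y \<in> V"
  by (rule subspace_add[OF subspace_V])

lemma V_diff [simp]: "X \<in> V \<Longrightarrow> Y \<in> V \<Longrightarrow> X - Y \<in> V"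
  by (rule subspace_diff[OF subspace_V])

lemma V_minus [simp]: "X \<in> V \<Longrightarrow> - X \<in> V"
  by (rule subspace_neg[OF subspace_V])

lemma V_0 [simp]: "0 \<in> V"
  by (rule subspace_0[OF subspace_V])

lemma V_sum [simp]: "(\<And>i. i \<in> I \<Longrightarrow> X i \<in> V) \<Longrightarrow> (\<Sum>i\<in>I. X i) \<in> V"
  by (rule subspace_sum[OF subspace_V])

lemma br_V [simp]: "X \<in> V \<Longrightarrow> Y \<in> V \<Longrightarrow> br X Y \<in> V"
  by (simp add: torsion_free)

lemma F_sum [simp]: "(\<And>i. i \<in> I \<Longrightarrow> f i \<in> F) \<Longrightarrow> (\<lambda>p. \<Sum>i\<in>I. f i p) \<in> F"
  by (induction I rule: infinite_finite_induct) auto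

lemma F_minus [simp]: "f \<in> F \<Longrightarrow> (\<lambda>p. - f p) \<in> F"
  using F_mult[of "\<lambda>_. -1" f] by simp

lemma F_diff [simp]: "f \<in> F \<Longrightarrow> f' \<in> F \<Longrightarrow> (\<lambda>p. f p - f' p) \<in> F"
  using F_add[of f "\<lambda>p. - f' p"] by simp

lemma act_minus_fun: "X \<in> V \<Longrightarrow> f \<in> F \<Longrightarrow> act X (\<lambda>p. - f p) p = - act X f p"
  using act_mult_fun[of X "\<lambda>_. -1" f p] by (simp add: act_const)

lemma act_diff_fun:
  "X \<in> V \<Longrightarrow> f \<in> F \<Longrightarrow> f' \<in> F \<Longrightarrow> act X (\<lambda>p. f p - f' p) p = act X f p - act X f' p"
  using act_add_fun[of X f "\<lambda>p. - f' p" p] by (simp add: act_minus_fun)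

lemma act_sum_fun:
  "X \<in> V \<Longrightarrow> (\<And>i. i \<in> I \<Longrightarrow> f i \<in> F) \<Longrightarrow> act X (\<lambda>p. \<Sum>i\<in>I. f i p) p = (\<Sum>i\<in>I. act X (f i) p)"
  by (induction I rule: infinite_finite_induct) (auto simp: act_const act_add_fun)

lemma act_cmul_fun: "X \<in> V \<Longrightarrow> f \<in> F \<Longrightarrow> act X (\<lambda>p. c * f p) p = c * act X f p"
  using act_mult_fun[of X "\<lambda>_. c" f p] by (simp add: act_const)

lemma act_0: "act 0 f p = 0"
  using act_add[of 0 0 f p] by simp

lemma act_sum: "(\<And>i. i \<in> I \<Longrightarrow> X i \<in> V) \<Longrightarrow> act (\<Sum>i\<in>I. X i) f p = (\<Sum>i\<in>I. act (X i) f p)"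
  by (induction I rule: infinite_finite_induct) (auto simp: act_0 act_add)

lemma gg_add_right: "X \<in> V \<Longrightarrow> Y \<in> V \<Longrightarrow> Z \<in> V \<Longrightarrow> gg Z (X + Y) p = gg Z X p + gg Z Y p"
  by (metis V_add gg_add_left gg_sym)

lemma gg_sm_right: "f \<in> F \<Longrightarrow> X \<in> V \<Longrightarrow> Y \<in> V \<Longrightarrow> gg Y (sm f X) p = f p * gg Y X p"
  by (metis sm_V gg_sm_left gg_sym)

lemma gg_diff_left: "X \<in> V \<Longrightarrow> Y \<in> V \<Longrightarrow> Z \<in> V \<Longrightarrow> gg (X - Y) Z p = gg X Z p - gg Y Z p"
  using gg_add_left[of "X - Y" Y Z p] by simp

lemma gg_diff_right: "X \<in> V \<Longrightarrow> Y \<in> V \<Longrightarrow> Z \<in> V \<Longrightarrow> gg Z (X - Y) p = gg Z X p - gg Z Y p"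
  using gg_add_right[of "X - Y" Y Z p] by simp

lemma gg_0_left: "Z \<in> V \<Longrightarrow> gg 0 Z p = 0"
  using gg_add_left[of 0 0 Z p] by simp

lemma gg_0_right: "Z \<in> V \<Longrightarrow> gg Z 0 p = 0"
  using gg_add_right[of 0 0 Z p] by simp

lemma gg_minus_left: "X \<in> V \<Longrightarrow> Y \<in> V \<Longrightarrow> gg (- X) Y p = - gg X Y p"
  using gg_diff_left[of 0 X Y p] by (simp add: gg_0_left)

lemma gg_sum_left:
  "(\<And>i. i \<in> I \<Longrightarrow> X i \<in> V) \<Longrightarrow> Z \<in> V \<Longrightarrow> gg (\<Sum>i\<in>I. X i) Z p = (\<Sum>i\<in>I. gg (X i) Z p)"
  by (induction I rule: infinite_finite_induct) (auto simp: gg_add_left gg_0_left)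

lemma gg_sum_right:
  "(\<And>i. i \<in> I \<Longrightarrow> X i \<in> V) \<Longrightarrow> Z \<in> V \<Longrightarrow> gg Z (\<Sum>i\<in>I. X i) p = (\<Sum>i\<in>I. gg Z (X i) p)"
  by (induction I rule: infinite_finite_induct) (auto simp: gg_add_right gg_0_right)

lemma D_diff_left: "X \<in> V \<Longrightarrow> Y \<in> V \<Longrightarrow> Z \<in> V \<Longrightarrow> D (X - Y) Z = D X Z - D Y Z"
  using D_add_left[of "X - Y" Y Z] by simp

lemma D_diff_right: "X \<in> V \<Longrightarrow> Y \<in> V \<Longrightarrow> Z \<in> V \<Longrightarrow> D Z (X - Y) = D Z X - D Z Y"
  using D_add_right[of "X - Y" Y Z] by simp

lemma D_0_right: "X \<in> V \<Longrightarrow> D X 0 = 0"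
  using D_add_right[of 0 0 X] by simp

lemma D_0_left: "X \<in> V \<Longrightarrow> D 0 X = 0"
  using D_add_left[of 0 0 X] by simp

lemma D_sum_right:
  "(\<And>i. i \<in> I \<Longrightarrow> X i \<in> V) \<Longrightarrow> Z \<in> V \<Longrightarrow> D Z (\<Sum>i\<in>I. X i) = (\<Sum>i\<in>I. D Z (X i))"
  by (induction I rule: infinite_finite_induct) (auto simp: D_add_right D_0_right)

lemma D_sum_left:
  "(\<And>i. i \<in> I \<Longrightarrow> X i \<in> V) \<Longrightarrow> Z \<in> V \<Longrightarrow> D (\<Sum>i\<in>I. X i) Z = (\<Sum>i\<in>I. D (X i) Z)"
  by (induction I rule: infinite_finite_induct) (auto simp: D_add_left D_0_left)

lemma sm_diff_right: "sm f (X - Y) = sm f X - sm f Y"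
  using sm_add_right[of f "X - Y" Y] by simp

lemma sm_diff_left: "sm (\<lambda>p. f p - f' p) X = sm f X - sm f' X"
  using sm_add_left[of "\<lambda>p. f p - f' p" f' X] by simp

section \<open>Curvature and its symmetries\<close>

definition R where "R X Y Z = D X (D Y Z) - D Y (D X Z) - D (br X Y) Z"

lemma R_V [simp]: "X \<in> V \<Longrightarrow> Y \<in> V \<Longrightarrow> Z \<in> V \<Longrightarrow> R X Y Z \<in> V"
  by (simp add: R_def)

lemmas D_lin = D_add_left D_add_right D_diff_left D_diff_right

lemma R_add_1: "X \<in> V \<Longrightarrow> X' \<in> V \<Longrightarrow> Y \<in> V \<Longrightarrow> Z \<in> V \<Longrightarrow> R (X + X') Y Z = R X Y Z + R X' Y Z"
  by (simp add: R_def torsion_free D_lin algebra_simps)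

lemma R_add_2: "X \<in> V \<Longrightarrow> X' \<in> V \<Longrightarrow> Y \<in> V \<Longrightarrow> Z \<in> V \<Longrightarrow> R Y (X + X') Z = R Y X Z + R Y X' Z"
  by (simp add: R_def torsion_free D_lin algebra_simps)

lemma R_add_3: "X \<in> V \<Longrightarrow> X' \<in> V \<Longrightarrow> Y \<in> V \<Longrightarrow> Z \<in> V \<Longrightarrow> R Y Z (X + X') = R Y Z X + R Y Z X'"
  by (simp add: R_def torsion_free D_lin algebra_simps)

lemma R_swap: "X \<in> V \<Longrightarrow> Y \<in> V \<Longrightarrow> Z \<in> V \<Longrightarrow> R X Y Z = - R Y X Z"
  by (simp add: R_def torsion_free D_lin algebra_simps)

lemma R_sm_1: "f \<in> F \<Longrightarrow> X \<in> V \<Longrightarrow> Y \<in> V \<Longrightarrow> Z \<in> V \<Longrightarrow> R (sm f X) Y Z = sm f (R X Y Z)"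
  by (simp add: R_def torsion_free D_lin D_sm_left D_sm_right sm_add_right sm_diff_right algebra_simps)

lemma R_sm_2: "f \<in> F \<Longrightarrow> X \<in> V \<Longrightarrow> Y \<in> V \<Longrightarrow> Z \<in> V \<Longrightarrow> R X (sm f Y) Z = sm f (R X Y Z)"
  by (simp add: R_def torsion_free D_lin D_sm_left D_sm_right sm_add_right sm_diff_right algebra_simps)

text \<open>The second derivatives of \<open>f\<close> combine to its derivative along
  \<open>br X Y\<close> and are removed by the bracket term; the first derivatives cancel between
  the two orders of differentiation.\<close>

lemma R_sm_3:
  assumes "f \<in> F" "X \<in> V" "Y \<in> V" "Z \<in> V"
  shows "R X Y (sm f Z) = sm f (R X Y Z)"
proof -
  have e: "act (br X Y) f = (\<lambda>p. act X (act Y f) p - act Y (act X f) p)"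
    using act_br assms by blast
  have "D (br X Y) (sm f Z) = sm (act X (act Y f)) Z - sm (act Y (act X f)) Z + sm f (D (br X Y) Z)"
    using assms by (simp add: D_sm_right e sm_diff_left)
  then show ?thesis
    using assms unfolding R_def
    by (simp add: D_sm_left D_sm_right D_add_right sm_add_right sm_diff_right algebra_simps)
qed

text \<open>The covariant derivative of the curvature tensor, written as the failure of
  \<open>D X\<close> to satisfy the Leibniz rule on \<open>R Y Z W\<close>.\<close>

definition nabla_R where
  "nabla_R X Y Z W = D X (R Y Z W) - R (D X Y) Z W - R Y (D X Z) W - R Y Z (D X W)"

lemma nabla_R_V [simp]:
  "X \<in> V \<Longrightarrow> Y \<in> V \<Longrightarrow> Z \<in> V \<Longrightarrow> W \<in> V \<Longrightarrow> nabla_R X Y Z W \<in> V"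
  by (simp add: nabla_R_def)

text \<open>With every bracket written through \<open>D\<close>, all terms cancel except the
  derivative of \<open>W\<close> along a Jacobi sum, which is 0.\<close>

lemma second_bianchi:
  assumes "X \<in> V" "Y \<in> V" "Z \<in> V" "W \<in> V"
  shows "nabla_R X Y Z W + nabla_R Y Z X W + nabla_R Z X Y W = 0"
proof -
  have "D (br X (br Y Z) + br Y (br Z X) + br Z (br X Y)) W = 0"
    using assms by (simp add: br_jacobi D_0_left)
  then show ?thesis
    using assms by (simp add: nabla_R_def R_def torsion_free D_lin algebra_simps)
qed

text \<open>Differentiate \<open>gg Z W\<close> twice by metric compatibility: the mixed products
  cancel in the commutator, and what remains is the sum of the two curvature terms.\<close>

lemma R_skew:
  assumes "X \<in> V" "Y \<in> V" "Z \<in> V" "W \<in> V"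
  shows "gg (R X Y Z) W p = - gg (R X Y W) Z p"
proof -
  have m: "act A (gg Z W) = (\<lambda>p. gg (D A Z) W p + gg Z (D A W) p)" if "A \<in> V" for A
    using metric that assms by blast
  have "act X (act Y (gg Z W)) p - act Y (act X (gg Z W)) p = act (br X Y) (gg Z W) p"
    using act_br assms by simp
  then show ?thesis
    using assms gg_sym[of Z "D X (D Y W)" p] gg_sym[of Z "D Y (D X W)" p]
      gg_sym[of Z "D (br X Y) W" p]
    by (simp add: m R_def act_add_fun metric gg_diff_left)
qed

text \<open>This is the derivative of \<open>R_skew\<close> along \<open>X\<close>; the correction
  terms are paired off by \<open>R_skew\<close> itself.\<close>

lemma nabla_R_skew:
  assumes "X \<in> V" "Y \<in> V" "Z \<in> V" "W \<in> V" "Q \<in> V"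
  shows "gg (nabla_R X Y Z W) Q p = - gg (nabla_R X Y Z Q) W p"
proof -
  have "gg (R Y Z W) Q = (\<lambda>p. - gg (R Y Z Q) W p)" using R_skew assms by blast
  then have "act X (gg (R Y Z W) Q) p = - act X (gg (R Y Z Q) W) p"
    using assms by (simp add: act_minus_fun)
  then show ?thesis
    using assms R_skew[of Y Z W "D X Q" p] R_skew[of Y Z Q "D X W" p]
      R_skew[of "D X Y" Z W Q p] R_skew[of Y "D X Z" W Q p]
    by (simp add: metric nabla_R_def gg_diff_left)
qed

section \<open>Killing fields\<close>

definition killing where
  "killing Z \<longleftrightarrow> Z \<in> V \<and> (\<forall>X\<in>V. \<forall>Y\<in>V. \<forall>p\<in>U. gg (D X Z) Y p + gg (D Y Z) X p = 0)"

lemma killing_sum: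
  assumes "\<And>i. i \<in> I \<Longrightarrow> killing (Z i)"
  shows "killing (\<Sum>i\<in>I. Z i)"
  unfolding killing_def
proof (intro conjI ballI)
  have V: "Z i \<in> V" if "i \<in> I" for i using assms that unfolding killing_def by blast
  then show "(\<Sum>i\<in>I. Z i) \<in> V" by simp
  fix X Y p assume XY: "X \<in> V" "Y \<in> V" "p \<in> U"
  then show "gg (D X (\<Sum>i\<in>I. Z i)) Y p + gg (D Y (\<Sum>i\<in>I. Z i)) X p = 0"
    using V assms unfolding killing_def
    by (simp add: D_sum_right gg_sum_left sum.distrib[symmetric])
qed

text \<open>Bracketing with \<open>\<xi> \<alpha>\<close> preserves each \<open>eta\<close>, then
  \<open>ph\<close>, then the form g(X, ph Y), and hence the metric against the image of
  \<open>ph\<close>. The remaining directions are spanned by the \<xi> fields, against which the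
  metric is a multiple of \<open>eta\<close>.\<close>

lemma killing_of_normal_contact:
  fixes \<xi> :: "'i \<Rightarrow> 'v" and \<epsilon> :: "'i \<Rightarrow> real" and ph :: "'v \<Rightarrow> 'v"
    and eta :: "'i \<Rightarrow> 'v \<Rightarrow> 'p \<Rightarrow> real"
  defines "eta \<equiv> \<lambda>\<alpha> X p. \<epsilon> \<alpha> * gg X (\<xi> \<alpha>) p"
  assumes xi_V [simp]: "\<And>\<alpha>. \<alpha> \<in> I \<Longrightarrow> \<xi> \<alpha> \<in> V"
    and ph_V [simp]: "\<And>X. X \<in> V \<Longrightarrow> ph X \<in> V"
    and ph_0: "ph 0 = 0"
    and ph_minus: "\<And>X. X \<in> V \<Longrightarrow> ph (- X) = - ph X"
    and ortho: "\<And>\<alpha> \<beta> p. \<alpha> \<in> I \<Longrightarrow> \<beta> \<in> I \<Longrightarrow> p \<in> U \<Longrightarrow>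
        gg (\<xi> \<alpha>) (\<xi> \<beta>) p = (if \<alpha> = \<beta> then \<epsilon> \<alpha> else 0)"
    and sign: "\<And>\<alpha>. \<alpha> \<in> I \<Longrightarrow> \<epsilon> \<alpha> * \<epsilon> \<alpha> = 1"
    and ph2: "\<And>X. X \<in> V \<Longrightarrow> ph (ph X) = - X + (\<Sum>\<alpha>\<in>I. sm (eta \<alpha> X) (\<xi> \<alpha>))"
    and ph3: "\<And>X. X \<in> V \<Longrightarrow> ph (ph (ph X)) = - ph X"
    and ph_xi: "\<And>\<alpha>. \<alpha> \<in> I \<Longrightarrow> ph (\<xi> \<alpha>) = 0"
    and eta_ph: "\<And>\<alpha> X p. \<alpha> \<in> I \<Longrightarrow> X \<in> V \<Longrightarrow> eta \<alpha> (ph X) p = 0"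
    and contact: "\<And>\<alpha> X Y p. \<alpha> \<in> I \<Longrightarrow> X \<in> V \<Longrightarrow> Y \<in> V \<Longrightarrow>
        2 * gg X (ph Y) p = act X (eta \<alpha> Y) p - act Y (eta \<alpha> X) p - eta \<alpha> (br X Y) p"
    and normal: "\<And>X Y. X \<in> V \<Longrightarrow> Y \<in> V \<Longrightarrow>
        ph (ph (br X Y)) + br (ph X) (ph Y) - ph (br (ph X) Y) - ph (br X (ph Y))
        + (\<Sum>\<alpha>\<in>I. sm (\<lambda>p. act X (eta \<alpha> Y) p - act Y (eta \<alpha> X) p - eta \<alpha> (br X Y) p) (\<xi> \<alpha>)) = 0"
    and a: "\<alpha> \<in> I"
  shows "killing (\<xi> \<alpha>)"
proof -
  note xa [simp] = xi_V[OF a]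
  have etaF [simp]: "eta \<beta> X \<in> F" if "\<beta> \<in> I" "X \<in> V" for \<beta> X
    unfolding eta_def using that by simp
  have br0: "br X 0 = 0" if "X \<in> V" for X using that by (simp add: torsion_free D_0_left D_0_right)
  have br_skew: "br X Y = - br Y X" if "X \<in> V" "Y \<in> V" for X Y using that by (simp add: torsion_free)
  have eta_xi: "act X (eta \<beta> (\<xi> \<alpha>)) p = 0" if "\<beta> \<in> I" "X \<in> V" for X \<beta> p
  proof -
    have "act X (eta \<beta> (\<xi> \<alpha>)) p = act X (\<lambda>_. \<epsilon> \<beta> * (if \<alpha> = \<beta> then \<epsilon> \<alpha> else 0)) p"
      by (rule act_cong) (use that a ortho in \<open>auto simp: eta_def\<close>)
    then show ?thesis using that by (simp add: act_const)
  qed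
  \<comment> \<open>The contact identity with first argument \<open>\<xi> \<alpha>\<close>: its left
    side is a multiple of \<open>eta \<alpha> (ph X)\<close>, which is 0, and
    \<open>eta \<beta>\<close> takes a constant value on \<open>\<xi> \<alpha>\<close>, so that
    derivative drops out as well.\<close>
  have L_eta: "eta \<beta> (br (\<xi> \<alpha>) X) = act (\<xi> \<alpha>) (eta \<beta> X)" if b: "\<beta> \<in> I" and X: "X \<in> V" for \<beta> X
  proof
    fix p
    have "gg (\<xi> \<alpha>) (ph X) p = \<epsilon> \<alpha> * eta \<alpha> (ph X) p"
      unfolding eta_def using sign[OF a] X gg_sym[of "\<xi> \<alpha>" "ph X" p] by (simp flip: mult.assoc)
    then have "gg (\<xi> \<alpha>) (ph X) p = 0" using eta_ph[OF a X] by simp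
    then show "eta \<beta> (br (\<xi> \<alpha>) X) p = act (\<xi> \<alpha>) (eta \<beta> X) p"
      using contact[OF b xa X, of p] eta_xi[OF b X, of p] by simp
  qed
  \<comment> \<open>With second argument \<open>\<xi> \<alpha>\<close>, normality collapses to ph^2
    [X, \<xi>] = ph [ph X, \<xi>]. Applying \<open>ph\<close> once more, \<open>ph3\<close> and
    \<open>ph2\<close> give commutation up to \<open>eta\<close> components, which vanish by
    \<open>L_eta\<close>.\<close>
  have L_ph: "br (\<xi> \<alpha>) (ph X) = ph (br (\<xi> \<alpha>) X)" if X: "X \<in> V" for X
  proof -
    have "(\<lambda>p. act X (eta \<beta> (\<xi> \<alpha>)) p - act (\<xi> \<alpha>) (eta \<beta> X) p - eta \<beta> (br X (\<xi> \<alpha>)) p) = (\<lambda>p. 0)"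
      if "\<beta> \<in> I" for \<beta>
    proof
      fix p
      have "2 * gg X (ph (\<xi> \<alpha>)) p = 0" using X by (simp add: ph_xi[OF a] gg_0_right)
      then show "act X (eta \<beta> (\<xi> \<alpha>)) p - act (\<xi> \<alpha>) (eta \<beta> X) p - eta \<beta> (br X (\<xi> \<alpha>)) p = 0"
        using contact[OF that X xa, of p] by simp
    qed
    then have "(\<Sum>\<beta>\<in>I. sm (\<lambda>p. act X (eta \<beta> (\<xi> \<alpha>)) p - act (\<xi> \<alpha>) (eta \<beta> X) p
        - eta \<beta> (br X (\<xi> \<alpha>)) p) (\<xi> \<beta>)) = 0"
      by (intro sum.neutral) (simp add: sm_const)
    then have "ph (ph (br X (\<xi> \<alpha>))) = ph (br (ph X) (\<xi> \<alpha>))"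
      using normal[OF X xa] X by (simp add: ph_xi[OF a] br0 ph_0)
    then have "ph (ph (ph (br X (\<xi> \<alpha>)))) = ph (ph (br (ph X) (\<xi> \<alpha>)))" by simp
    then have e: "ph (br X (\<xi> \<alpha>)) =
        br (ph X) (\<xi> \<alpha>) - (\<Sum>\<beta>\<in>I. sm (eta \<beta> (br (ph X) (\<xi> \<alpha>))) (\<xi> \<beta>))"
      using X ph3[of "br X (\<xi> \<alpha>)"] ph2[of "br (ph X) (\<xi> \<alpha>)"]
      by (simp add: eq_neg_iff_add_eq_0 algebra_simps)
    have z: "eta \<beta> (br (ph X) (\<xi> \<alpha>)) = (\<lambda>p. 0)" if b: "\<beta> \<in> I" for \<beta>
    proof
      fix p
      have "eta \<beta> (br (\<xi> \<alpha>) (ph X)) p = act (\<xi> \<alpha>) (\<lambda>_. 0) p"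
        unfolding L_eta[OF b ph_V[OF X]] by (rule act_cong) (use eta_ph[OF b X] in auto)
      then show "eta \<beta> (br (ph X) (\<xi> \<alpha>)) p = 0"
        using br_skew[of "ph X" "\<xi> \<alpha>"] X b by (simp add: act_const eta_def gg_minus_left)
    qed
    have "ph (br X (\<xi> \<alpha>)) = br (ph X) (\<xi> \<alpha>)"
      unfolding e by (simp add: z sm_const)
    then show ?thesis
      using br_skew[of "\<xi> \<alpha>" "ph X"] br_skew[of "\<xi> \<alpha>" X] ph_minus[of "br X (\<xi> \<alpha>)"] X by simp
  qed
  \<comment> \<open>The Lie derivative commutes with d and kills \<open>eta \<alpha>\<close>, so it
    kills the form g(X, ph Y). This is verified by hand from three instances of the contact
    identity, with the Jacobi identity splitting the double bracket.\<close>
  have L_Phi: "act (\<xi> \<alpha>) (gg X (ph Y)) p = gg (br (\<xi> \<alpha>) X) (ph Y) p + gg X (ph (br (\<xi> \<alpha>) Y)) p"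
    if X: "X \<in> V" and Y: "Y \<in> V" for X Y p
  proof -
    have c: "gg X (ph Y) = (\<lambda>p. (1 / 2) * (act X (eta \<alpha> Y) p - act Y (eta \<alpha> X) p - eta \<alpha> (br X Y) p))"
    proof
      fix p show "gg X (ph Y) p = (1 / 2) * (act X (eta \<alpha> Y) p - act Y (eta \<alpha> X) p - eta \<alpha> (br X Y) p)"
        using contact[OF a X Y, of p] by simp
    qed
    have "act (\<xi> \<alpha>) (gg X (ph Y)) p = (1 / 2) * (act (\<xi> \<alpha>) (act X (eta \<alpha> Y)) p
        - act (\<xi> \<alpha>) (act Y (eta \<alpha> X)) p - act (\<xi> \<alpha>) (eta \<alpha> (br X Y)) p)"
      unfolding c using a X Y by (subst act_cmul_fun) (simp_all add: act_diff_fun)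
    moreover have "2 * gg (br (\<xi> \<alpha>) X) (ph Y) p = act (br (\<xi> \<alpha>) X) (eta \<alpha> Y) p
        - act Y (act (\<xi> \<alpha>) (eta \<alpha> X)) p - eta \<alpha> (br (br (\<xi> \<alpha>) X) Y) p"
      using contact[OF a _ Y, of "br (\<xi> \<alpha>) X" p] a X by (simp add: L_eta)
    moreover have "2 * gg X (ph (br (\<xi> \<alpha>) Y)) p = act X (act (\<xi> \<alpha>) (eta \<alpha> Y)) p
        - act (br (\<xi> \<alpha>) Y) (eta \<alpha> X) p - eta \<alpha> (br X (br (\<xi> \<alpha>) Y)) p"
      using contact[OF a X, of "br (\<xi> \<alpha>) Y" p] a Y by (simp add: L_eta)
    moreover have "act (\<xi> \<alpha>) (eta \<alpha> (br X Y)) p = eta \<alpha> (br (\<xi> \<alpha>) (br X Y)) p"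
      using L_eta[OF a, of "br X Y"] X Y by simp
    moreover have "br (\<xi> \<alpha>) (br X Y) = br (br (\<xi> \<alpha>) X) Y + br X (br (\<xi> \<alpha>) Y)"
    proof -
      have "br X (br Y (\<xi> \<alpha>)) = - br X (br (\<xi> \<alpha>) Y)"
        using X Y by (simp add: torsion_free D_lin)
      moreover have "br Y (br (\<xi> \<alpha>) X) = - br (br (\<xi> \<alpha>) X) Y"
        using X Y br_skew[of Y "br (\<xi> \<alpha>) X"] by simp
      ultimately have "br (\<xi> \<alpha>) (br X Y) - br X (br (\<xi> \<alpha>) Y) - br (br (\<xi> \<alpha>) X) Y = 0"
        using br_jacobi[OF xa X Y] by simp
      then show ?thesis by (simp add: diff_eq_eq)
    qed
    moreover have "eta \<alpha> (br (br (\<xi> \<alpha>) X) Y + br X (br (\<xi> \<alpha>) Y)) p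
        = eta \<alpha> (br (br (\<xi> \<alpha>) X) Y) p + eta \<alpha> (br X (br (\<xi> \<alpha>) Y)) p"
      using X Y a unfolding eta_def by (simp add: gg_add_left algebra_simps)
    ultimately show ?thesis using a X Y by (simp add: act_br)
  qed
  \<comment> \<open>By metric compatibility and vanishing torsion this is the Lie derivative of the
    metric along \<open>\<xi> \<alpha>\<close>.\<close>
  define K where "K X Y p = gg (D X (\<xi> \<alpha>)) Y p + gg (D Y (\<xi> \<alpha>)) X p" for X Y p
  have K: "K X Y p = act (\<xi> \<alpha>) (gg X Y) p - gg (br (\<xi> \<alpha>) X) Y p - gg X (br (\<xi> \<alpha>) Y) p"
    if X: "X \<in> V" and Y: "Y \<in> V" for X Y p
    unfolding K_def using X Y gg_sym[of X "D (\<xi> \<alpha>) Y" p] gg_sym[of X "D Y (\<xi> \<alpha>)" p]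
    by (simp add: metric torsion_free gg_diff_left gg_diff_right)
  have K_ph: "K X (ph Y) p = 0" if X: "X \<in> V" and Y: "Y \<in> V" for X Y p
    using K[OF X, of "ph Y"] L_Phi[OF X Y] L_ph[OF Y] Y by simp
  \<comment> \<open>The bracket of two \<xi> fields is killed by \<open>ph\<close> according to
    \<open>L_ph\<close> and has no \<open>eta\<close> components according to \<open>L_eta\<close>,
    so it is 0. What is left of \<open>K\<close> vanishes by \<open>L_eta\<close> after cancelling
    the sign \<open>\<epsilon> \<beta>\<close>.\<close>
  have K_xi: "K X (\<xi> \<beta>) p = 0" if X: "X \<in> V" and b: "\<beta> \<in> I" for X \<beta> p
  proof -
    note xb = xi_V[OF b]
    have "ph (ph (br (\<xi> \<alpha>) (\<xi> \<beta>))) = 0"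
      using L_ph[OF xb] xb by (simp add: ph_xi[OF b] br0 ph_0)
    moreover have "eta \<gamma> (br (\<xi> \<alpha>) (\<xi> \<beta>)) = (\<lambda>p. 0)" if g: "\<gamma> \<in> I" for \<gamma>
    proof
      fix p
      have "act (\<xi> \<alpha>) (eta \<gamma> (\<xi> \<beta>)) p = act (\<xi> \<alpha>) (\<lambda>_. \<epsilon> \<gamma> * (if \<beta> = \<gamma> then \<epsilon> \<beta> else 0)) p"
        by (rule act_cong) (use b g ortho in \<open>auto simp: eta_def\<close>)
      then show "eta \<gamma> (br (\<xi> \<alpha>) (\<xi> \<beta>)) p = 0" using L_eta[OF g xb] by (simp add: act_const)
    qed
    ultimately have "br (\<xi> \<alpha>) (\<xi> \<beta>) = 0"
      using ph2[of "br (\<xi> \<alpha>) (\<xi> \<beta>)"] xb by (simp add: sm_const)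
    then have Kb: "K X (\<xi> \<beta>) p = act (\<xi> \<alpha>) (gg X (\<xi> \<beta>)) p - gg (br (\<xi> \<alpha>) X) (\<xi> \<beta>) p"
      using K[OF X xb] X by (simp add: gg_0_right)
    have "eta \<beta> (br (\<xi> \<alpha>) X) p = \<epsilon> \<beta> * act (\<xi> \<alpha>) (gg X (\<xi> \<beta>)) p"
    proof -
      have "act (\<xi> \<alpha>) (eta \<beta> X) p = \<epsilon> \<beta> * act (\<xi> \<alpha>) (gg X (\<xi> \<beta>)) p"
        unfolding eta_def using X xb by (simp add: act_cmul_fun)
      then show ?thesis by (simp add: L_eta[OF b X])
    qed
    then have "\<epsilon> \<beta> * (\<epsilon> \<beta> * gg (br (\<xi> \<alpha>) X) (\<xi> \<beta>) p) = \<epsilon> \<beta> * (\<epsilon> \<beta> * act (\<xi> \<alpha>) (gg X (\<xi> \<beta>)) p)"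
      unfolding eta_def by simp
    moreover have "\<epsilon> \<beta> \<noteq> 0"
    proof
      assume "\<epsilon> \<beta> = 0" then show False using sign[OF b] by simp
    qed
    ultimately have "gg (br (\<xi> \<alpha>) X) (\<xi> \<beta>) p = act (\<xi> \<alpha>) (gg X (\<xi> \<beta>)) p" by simp
    then show ?thesis using Kb by simp
  qed
  have "K X Y p = 0" if X: "X \<in> V" and Y: "Y \<in> V" for X Y p
  proof -
    \<comment> \<open>\<open>ph2\<close> splits every field into \<xi> components and an element of
      the image of \<open>ph\<close>, the two cases just settled.\<close>
    have Yd: "Y = (\<Sum>\<beta>\<in>I. sm (eta \<beta> Y) (\<xi> \<beta>)) - ph (ph Y)" using ph2[OF Y] by simp
    have "K X Y p = K X ((\<Sum>\<beta>\<in>I. sm (eta \<beta> Y) (\<xi> \<beta>)) - ph (ph Y)) p"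
      using Yd by simp
    also have "\<dots> = K X (\<Sum>\<beta>\<in>I. sm (eta \<beta> Y) (\<xi> \<beta>)) p - K X (ph (ph Y)) p"
      unfolding K_def using X Y by (simp add: gg_diff_left gg_diff_right D_lin)
    also have "K X (\<Sum>\<beta>\<in>I. sm (eta \<beta> Y) (\<xi> \<beta>)) p = (\<Sum>\<beta>\<in>I. eta \<beta> Y p * K X (\<xi> \<beta>) p)"
    proof -
      have "D (\<Sum>\<beta>\<in>I. sm (eta \<beta> Y) (\<xi> \<beta>)) (\<xi> \<alpha>) = (\<Sum>\<beta>\<in>I. sm (eta \<beta> Y) (D (\<xi> \<beta>) (\<xi> \<alpha>)))"
        using Y by (subst D_sum_left) (auto simp: D_sm_left)
      then show ?thesis
        unfolding K_def using X Y
        by (simp add: gg_sum_left gg_sum_right gg_sm_left gg_sm_right sum.distrib[symmetric] distrib_left)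
    qed
    finally show ?thesis using X Y by (simp add: K_xi K_ph)
  qed
  then show ?thesis unfolding killing_def K_def by simp
qed

section \<open>Bilinear forms and traces over orthonormal frames\<close>

definition tensor_at :: "'p \<Rightarrow> ('v \<Rightarrow> 'v \<Rightarrow> real) \<Rightarrow> bool" where
  "tensor_at p T \<longleftrightarrow>
     (\<forall>A\<in>V. \<forall>B\<in>V. \<forall>C\<in>V. T (A + B) C = T A C + T B C \<and> T C (A + B) = T C A + T C B) \<and>
     (\<forall>f\<in>F. \<forall>A\<in>V. \<forall>B\<in>V. T (sm f A) B = f p * T A B \<and> T A (sm f B) = f p * T A B)"

lemma tensor_at_sum:
  assumes T: "tensor_at p T" and Z: "Z \<in> V" and "\<And>i. i \<in> I \<Longrightarrow> X i \<in> V"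
  shows "T (\<Sum>i\<in>I. X i) Z = (\<Sum>i\<in>I. T (X i) Z)" "T Z (\<Sum>i\<in>I. X i) = (\<Sum>i\<in>I. T Z (X i))"
proof -
  have "T (0 + 0) Z = T 0 Z + T 0 Z \<and> T Z (0 + 0) = T Z 0 + T Z 0"
    using T Z V_0 unfolding tensor_at_def by blast
  then have z: "T 0 Z = 0" "T Z 0 = 0" by auto
  have add: "T (A + B) Z = T A Z + T B Z \<and> T Z (A + B) = T Z A + T Z B" if "A \<in> V" "B \<in> V" for A B
    using T Z that unfolding tensor_at_def by blast
  show "T (\<Sum>i\<in>I. X i) Z = (\<Sum>i\<in>I. T (X i) Z)" "T Z (\<Sum>i\<in>I. X i) = (\<Sum>i\<in>I. T Z (X i))"
    using assms(3) by (induction I rule: infinite_finite_induct) (auto simp: z add)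
qed

lemma tensor_at_sm:
  assumes "tensor_at p T" "f \<in> F" "A \<in> V" "B \<in> V"
  shows "T (sm f A) B = f p * T A B" "T A (sm f B) = f p * T A B"
  using assms unfolding tensor_at_def by simp_all

text \<open>The signs \<open>e i\<close> are constants, so they commute with derivatives. The
  expansion is an equation between fields, so additive operators can be applied to it
  directly.\<close>

definition frame :: "nat \<Rightarrow> (nat \<Rightarrow> 'v) \<Rightarrow> (nat \<Rightarrow> real) \<Rightarrow> bool" where
  "frame m E e \<longleftrightarrow> (\<forall>i<m. E i \<in> V \<and> e i * e i = 1) \<and>
     (\<forall>p\<in>U. \<forall>i<m. \<forall>j<m. gg (E i) (E j) p = (if i = j then e i else 0)) \<and>
     (\<forall>X\<in>V. X = (\<Sum>i<m. sm (\<lambda>p. e i * gg X (E i) p) (E i)))"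

context
  fixes m E e assumes frame: "frame m E e"
begin

lemma frame_V [simp]: "i < m \<Longrightarrow> E i \<in> V" using frame unfolding frame_def by blast

lemma frame_sign: "i < m \<Longrightarrow> e i * e i = 1" using frame unfolding frame_def by blast

lemma frame_orthonormal:
  "p \<in> U \<Longrightarrow> i < m \<Longrightarrow> j < m \<Longrightarrow> gg (E i) (E j) p = (if i = j then e i else 0)"
  using frame unfolding frame_def by blast

lemma frame_expand: "X \<in> V \<Longrightarrow> X = (\<Sum>i<m. sm (\<lambda>p. e i * gg X (E i) p) (E i))"
  using frame unfolding frame_def by blast

lemma coeff_F [simp]: "X \<in> V \<Longrightarrow> i < m \<Longrightarrow> (\<lambda>p. e i * gg X (E i) p) \<in> F"
  by (intro F_mult F_const gg_F frame_V)

lemma tensor_expand_left: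
  assumes T: "tensor_at p T" and A: "A \<in> V" and B: "B \<in> V"
  shows "T A B = (\<Sum>i<m. e i * gg A (E i) p * T (E i) B)"
proof -
  have "T A B = T (\<Sum>i<m. sm (\<lambda>p. e i * gg A (E i) p) (E i)) B"
    using frame_expand[OF A] by simp
  also have "\<dots> = (\<Sum>i<m. T (sm (\<lambda>p. e i * gg A (E i) p) (E i)) B)"
    by (rule tensor_at_sum[OF T B]) (use A in auto)
  finally show ?thesis using A B by (simp add: tensor_at_sm(1)[OF T])
qed

lemma tensor_expand_right:
  assumes T: "tensor_at p T" and A: "A \<in> V" and B: "B \<in> V"
  shows "T B A = (\<Sum>i<m. e i * gg A (E i) p * T B (E i))"
proof -
  have "T B A = T B (\<Sum>i<m. sm (\<lambda>p. e i * gg A (E i) p) (E i))"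
    using frame_expand[OF A] by simp
  also have "\<dots> = (\<Sum>i<m. T B (sm (\<lambda>p. e i * gg A (E i) p) (E i)))"
    by (rule tensor_at_sum[OF T B]) (use A in auto)
  finally show ?thesis using A B by (simp add: tensor_at_sm(2)[OF T])
qed

lemma tensor_gg: "tensor_at p (\<lambda>A B. gg A B p)"
  unfolding tensor_at_def by (simp add: gg_add_left gg_add_right gg_sm_left gg_sm_right)

lemma parseval:
  assumes A: "A \<in> V" and B: "B \<in> V"
  shows "(\<Sum>i<m. e i * gg A (E i) p * gg B (E i) p) = gg A B p"
  using tensor_expand_left[OF tensor_gg A B] B by (simp add: gg_sym[OF _ B])

lemma act_expand:
  assumes A: "A \<in> V"
  shows "(\<Sum>i<m. e i * gg A (E i) p * act (E i) f p) = act A f p"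
proof -
  have "act A f p = act (\<Sum>i<m. sm (\<lambda>p. e i * gg A (E i) p) (E i)) f p"
    using frame_expand[OF A] by simp
  also have "\<dots> = (\<Sum>i<m. act (sm (\<lambda>p. e i * gg A (E i) p) (E i)) f p)"
    by (rule act_sum) (use A in auto)
  finally show ?thesis by (simp add: act_sm)
qed

lemma parseval':
  assumes A: "A \<in> V" and B: "B \<in> V"
  shows "(\<Sum>i<m. e i * (gg (E i) A p * gg (E i) B p)) = gg A B p"
  unfolding parseval[OF assms, symmetric]
  by (intro sum.cong refl) (simp add: gg_sym[OF A] gg_sym[OF B])

lemma act_expand':
  assumes A: "A \<in> V"
  shows "(\<Sum>i<m. e i * gg (E i) A p * act (E i) f p) = act A f p"
  unfolding act_expand[OF assms, symmetric]
  by (intro sum.cong refl) (simp add: gg_sym[OF A])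

text \<open>The connection coefficients of an orthonormal frame are skew.\<close>

lemma trace_connection:
  assumes T: "tensor_at p T" and X: "X \<in> V" and p: "p \<in> U"
  shows "(\<Sum>i<m. e i * (T (D X (E i)) (E i) + T (E i) (D X (E i)))) = 0"
proof -
  define w where "w i j = gg (D X (E i)) (E j) p" for i j
  have w: "w i j = - w j i" if "i < m" "j < m" for i j
  proof -
    have "act X (gg (E i) (E j)) p = act X (\<lambda>_. if i = j then e i else 0) p"
      using X by (rule act_cong) (use frame_orthonormal that in auto)
    then have "gg (D X (E i)) (E j) p + gg (E i) (D X (E j)) p = 0"
      using X that by (simp add: act_const metric)
    then show ?thesis using X that gg_sym[of "E i" "D X (E j)" p] unfolding w_def by simp
  qed
  \<comment> \<open>Coefficients skew in the two indices multiply a symmetrised tensor, so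
    exchanging the indices reverses the sign of the double sum.\<close>
  define a where "a i j = e i * e j * w i j * (T (E i) (E j) + T (E j) (E i))" for i j
  have "e i * (T (D X (E i)) (E i) + T (E i) (D X (E i))) = (\<Sum>j<m. a i j)" if "i < m" for i
    unfolding tensor_expand_left[OF T D_V[OF X frame_V[OF that]] frame_V[OF that]]
      tensor_expand_right[OF T D_V[OF X frame_V[OF that]] frame_V[OF that]]
    by (simp add: a_def w_def sum_distrib_left sum.distrib distrib_left mult_ac)
  then have s: "(\<Sum>i<m. e i * (T (D X (E i)) (E i) + T (E i) (D X (E i)))) = (\<Sum>i<m. \<Sum>j<m. a i j)"
    by simp
  have "a i j = - a j i" if "i < m" "j < m" for i j
    unfolding a_def w[OF that] by (simp add: algebra_simps)
  then have "(\<Sum>i<m. \<Sum>j<m. a i j) = (\<Sum>i<m. \<Sum>j<m. - a j i)"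
    by (intro sum.cong refl) blast
  also have "\<dots> = - (\<Sum>i<m. \<Sum>j<m. a i j)"
    by (subst sum.swap) (simp add: sum_negf)
  finally show ?thesis using s by simp
qed

text \<open>Both arguments are expanded in \<open>E\<close>; the sum over \<open>E'\<close> is then
  Parseval for \<open>E'\<close> and returns the Gram matrix of \<open>E\<close>. This is what frees
  the Ricci tensor from the frame picked by the choice operator.\<close>

lemma trace_frame_independent:
  assumes T: "tensor_at p T" and p: "p \<in> U" and frame': "field_calculus.frame U V sm gg m' E' e'"
  shows "(\<Sum>i<m'. e' i * T (E' i) (E' i)) = (\<Sum>i<m. e i * T (E i) (E i))"
proof -
  have V': "E' i \<in> V" if "i < m'" for i using frame' that unfolding frame_def by blast
  have P: "(\<Sum>i<m'. e' i * gg A (E' i) p * gg B (E' i) p) = gg A B p" if "A \<in> V" "B \<in> V" for A B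
    using field_calculus.parseval[OF field_calculus_axioms frame' that] .
  have "(\<Sum>i<m'. e' i * T (E' i) (E' i)) =
      (\<Sum>i<m'. \<Sum>j<m. \<Sum>k<m. e j * e k * T (E j) (E k) * (e' i * gg (E j) (E' i) p * gg (E k) (E' i) p))"
  proof (rule sum.cong[OF refl])
    fix i assume "i \<in> {..<m'}"
    then have E': "E' i \<in> V" using V' by simp
    have "T (E' i) (E' i) = (\<Sum>j<m. e j * gg (E' i) (E j) p * T (E j) (E' i))"
      by (rule tensor_expand_left[OF T E' E'])
    also have "\<dots> = (\<Sum>j<m. e j * gg (E' i) (E j) p * (\<Sum>k<m. e k * gg (E' i) (E k) p * T (E j) (E k)))"
      by (intro sum.cong refl) (simp add: tensor_expand_right[OF T E'])
    finally show "e' i * T (E' i) (E' i) =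
      (\<Sum>j<m. \<Sum>k<m. e j * e k * T (E j) (E k) * (e' i * gg (E j) (E' i) p * gg (E k) (E' i) p))"
      using E' by (simp add: sum_distrib_left gg_sym[OF E'] mult_ac)
  qed
  also have "\<dots> = (\<Sum>j<m. \<Sum>i<m'. \<Sum>k<m. e j * e k * T (E j) (E k) *
      (e' i * gg (E j) (E' i) p * gg (E k) (E' i) p))"
    by (rule sum.swap)
  also have "\<dots> = (\<Sum>j<m. \<Sum>k<m. \<Sum>i<m'. e j * e k * T (E j) (E k) *
      (e' i * gg (E j) (E' i) p * gg (E k) (E' i) p))"
    by (rule sum.cong[OF refl], rule sum.swap)
  also have "\<dots> = (\<Sum>j<m. \<Sum>k<m. e j * e k * T (E j) (E k) *
       (\<Sum>i<m'. e' i * gg (E j) (E' i) p * gg (E k) (E' i) p))"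
    by (simp add: sum_distrib_left)
  also have "\<dots> = (\<Sum>j<m. \<Sum>k<m. e j * e k * T (E j) (E k) * (if j = k then e j else 0))"
    using P p by (simp add: frame_orthonormal)
  also have "\<dots> = (\<Sum>j<m. e j * e j * T (E j) (E j) * e j)"
    by (simp add: if_distrib[of "\<lambda>x. _ * x"] cong: if_cong)
  also have "\<dots> = (\<Sum>j<m. e j * T (E j) (E j))"
    by (intro sum.cong refl) (simp add: frame_sign)
  finally show ?thesis .
qed

section \<open>Ricci tensor, divergence and the Schur argument\<close>

definition Ric where "Ric X Y p = (\<Sum>j<m. e j * gg (R Y (E j) (E j)) X p)"

text \<open>The covariant derivative of \<open>S\<close>, traced over the direction of
  differentiation and the first slot of \<open>S\<close>.\<close>

definition divg :: "('v \<Rightarrow> 'v \<Rightarrow> 'p \<Rightarrow> real) \<Rightarrow> 'v \<Rightarrow> 'p \<Rightarrow> real" where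
  "divg S X p = (\<Sum>i<m. e i * (act (E i) (S (E i) X) p - S (E i) (D (E i) X) p - S (D (E i) (E i)) X p))"

lemma Ric_F [simp]:
  assumes "X \<in> V" "Y \<in> V"
  shows "Ric X Y \<in> F"
proof -
  have "(\<lambda>p. \<Sum>j<m. e j * gg (R Y (E j) (E j)) X p) \<in> F"
    using assms by (intro F_sum F_mult F_const) auto
  then show ?thesis by (simp add: Ric_def[abs_def])
qed

lemma tensor_R_23: "X \<in> V \<Longrightarrow> Y \<in> V \<Longrightarrow> tensor_at p (\<lambda>A B. gg (R X A B) Y p)"
  unfolding tensor_at_def by (simp add: R_add_2 R_add_3 R_sm_2 R_sm_3 gg_add_left gg_sm_left)

lemma tensor_R_14: "X \<in> V \<Longrightarrow> Y \<in> V \<Longrightarrow> tensor_at p (\<lambda>A B. gg (R A X Y) B p)"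
  unfolding tensor_at_def
  by (simp add: R_add_1 R_sm_1 gg_add_left gg_sm_left gg_add_right gg_sm_right)

lemma gg_nabla_R:
  assumes "X \<in> V" "Y \<in> V" "Z \<in> V" "W \<in> V" "Q \<in> V"
  shows "gg (nabla_R X Y Z W) Q p = act X (gg (R Y Z W) Q) p - gg (R Y Z W) (D X Q) p
    - gg (R (D X Y) Z W) Q p - gg (R Y (D X Z) W) Q p - gg (R Y Z (D X W)) Q p"
  using assms by (simp add: nabla_R_def metric gg_diff_left)

lemma act_Ric:
  assumes "A \<in> V" "X \<in> V" "Y \<in> V"
  shows "act A (Ric X Y) p = (\<Sum>j<m. e j * act A (gg (R Y (E j) (E j)) X) p)"
  using assms unfolding Ric_def[abs_def]
  by (subst act_sum_fun) (auto simp: act_cmul_fun)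

text \<open>A double trace of the second Bianchi identity: one cyclic term gives the derivative of
  the scalar curvature, and the symmetries of \<open>nabla_R\<close> turn each of the other two into
  minus the divergence.\<close>

lemma contracted_bianchi:
  assumes X: "X \<in> V" and p: "p \<in> U"
  shows "act X (\<lambda>q. \<Sum>i<m. e i * Ric (E i) (E i) q) p = 2 * divg Ric X p"
proof -
  \<comment> \<open>The inner trace is the covariant derivative of \<open>Ric\<close> along
    \<open>E i\<close>, evaluated on \<open>E i\<close> and \<open>X\<close>; derivatives of the
    traced frame fields drop out by \<open>trace_connection\<close>.\<close>
  define S where "S i = (\<Sum>j<m. e j * gg (nabla_R (E i) X (E j) (E j)) (E i) p)" for i
  have S: "S i = act (E i) (Ric (E i) X) p - Ric (E i) (D (E i) X) p - Ric (D (E i) (E i)) X p"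
    if i: "i < m" for i
  proof -
    have "S i = (\<Sum>j<m. e j * act (E i) (gg (R X (E j) (E j)) (E i)) p)
        - (\<Sum>j<m. e j * gg (R X (E j) (E j)) (D (E i) (E i)) p)
        - (\<Sum>j<m. e j * gg (R (D (E i) X) (E j) (E j)) (E i) p)
        - (\<Sum>j<m. e j * (gg (R X (D (E i) (E j)) (E j)) (E i) p + gg (R X (E j) (D (E i) (E j))) (E i) p))"
      unfolding S_def sum_subtractf[symmetric] using X i
      by (intro sum.cong refl) (simp add: gg_nabla_R algebra_simps)
    moreover have "(\<Sum>j<m. e j * (gg (R X (D (E i) (E j)) (E j)) (E i) p
        + gg (R X (E j) (D (E i) (E j))) (E i) p)) = 0"
      using trace_connection[OF tensor_R_23[OF X frame_V[OF i]] frame_V[OF i] p] .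
    ultimately show ?thesis using X i by (simp add: act_Ric Ric_def)
  qed
  then have divS: "divg Ric X p = (\<Sum>i<m. e i * S i)" unfolding divg_def by simp
  \<comment> \<open>Traces commute with covariant differentiation: the derivatives of
    \<open>E i\<close> and of \<open>E j\<close> form two sums of the shape treated in
    \<open>trace_connection\<close>, one for each trace.\<close>
  have T1: "(\<Sum>i<m. \<Sum>j<m. e i * e j * gg (nabla_R X (E i) (E j) (E j)) (E i) p)
     = act X (\<lambda>q. \<Sum>i<m. e i * Ric (E i) (E i) q) p"
  proof -
    have "(\<Sum>i<m. \<Sum>j<m. e i * e j * gg (nabla_R X (E i) (E j) (E j)) (E i) p)
      = (\<Sum>i<m. \<Sum>j<m. e i * e j * act X (gg (R (E i) (E j) (E j)) (E i)) p)
      - (\<Sum>i<m. \<Sum>j<m. e i * e j * (gg (R (D X (E i)) (E j) (E j)) (E i) p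
            + gg (R (E i) (E j) (E j)) (D X (E i)) p))
      - (\<Sum>i<m. \<Sum>j<m. e i * e j * (gg (R (E i) (D X (E j)) (E j)) (E i) p
            + gg (R (E i) (E j) (D X (E j))) (E i) p))"
      unfolding sum_subtractf[symmetric] using X
      by (intro sum.cong refl) (simp add: gg_nabla_R algebra_simps)
    moreover have "(\<Sum>i<m. \<Sum>j<m. e i * e j * (gg (R (D X (E i)) (E j) (E j)) (E i) p
            + gg (R (E i) (E j) (E j)) (D X (E i)) p)) =
        (\<Sum>j<m. e j * (\<Sum>i<m. e i * (gg (R (D X (E i)) (E j) (E j)) (E i) p
            + gg (R (E i) (E j) (E j)) (D X (E i)) p)))"
      by (subst sum.swap) (simp add: sum_distrib_left mult_ac)
    moreover have "\<dots> = 0"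
      using trace_connection[OF tensor_R_14 X p] by simp
    moreover have "(\<Sum>i<m. \<Sum>j<m. e i * e j * (gg (R (E i) (D X (E j)) (E j)) (E i) p
            + gg (R (E i) (E j) (D X (E j))) (E i) p)) =
        (\<Sum>i<m. e i * (\<Sum>j<m. e j * (gg (R (E i) (D X (E j)) (E j)) (E i) p
            + gg (R (E i) (E j) (D X (E j))) (E i) p)))"
      by (simp add: sum_distrib_left mult_ac)
    moreover have "\<dots> = 0"
      using trace_connection[OF tensor_R_23 X p] by simp
    moreover have "act X (\<lambda>q. \<Sum>i<m. e i * Ric (E i) (E i) q) p =
        (\<Sum>i<m. \<Sum>j<m. e i * e j * act X (gg (R (E i) (E j) (E j)) (E i)) p)"
      using X by (subst act_sum_fun)
        (auto simp: act_cmul_fun act_Ric sum_distrib_left mult.assoc)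
    ultimately show ?thesis by simp
  qed
  \<comment> \<open>Skew-symmetry of the curvature in its first two arguments.\<close>
  have T2: "(\<Sum>i<m. \<Sum>j<m. e i * e j * gg (nabla_R (E i) (E j) X (E j)) (E i) p) = - divg Ric X p"
  proof -
    have "gg (nabla_R (E i) (E j) X (E j)) (E i) p = - gg (nabla_R (E i) X (E j) (E j)) (E i) p"
      if "i < m" "j < m" for i j
    proof -
      have "nabla_R (E i) (E j) X (E j) = - nabla_R (E i) X (E j) (E j)"
        using that X R_swap[of "E j" X "E j"] R_swap[of "D (E i) (E j)" X "E j"]
          R_swap[of "E j" "D (E i) X" "E j"] R_swap[of "E j" X "D (E i) (E j)"]
          D_diff_right[of 0 "R X (E j) (E j)" "E i"]
        by (simp add: nabla_R_def D_0_right)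
      then show ?thesis using X that by (simp add: gg_minus_left)
    qed
    then show ?thesis unfolding divS S_def by (simp add: sum_distrib_left mult.assoc sum_negf)
  qed
  \<comment> \<open>After the two indices are exchanged, skew-symmetry in the last pair.\<close>
  have T3: "(\<Sum>i<m. \<Sum>j<m. e i * e j * gg (nabla_R (E j) X (E i) (E j)) (E i) p) = - divg Ric X p"
  proof -
    have "(\<Sum>i<m. \<Sum>j<m. e i * e j * gg (nabla_R (E j) X (E i) (E j)) (E i) p)
        = (\<Sum>i<m. \<Sum>j<m. e j * e i * gg (nabla_R (E i) X (E j) (E i)) (E j) p)"
      by (rule sum.swap)
    also have "\<dots> = (\<Sum>i<m. \<Sum>j<m. - (e i * (e j * gg (nabla_R (E i) X (E j) (E j)) (E i) p)))"
    proof (intro sum.cong refl)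
      fix i j assume "i \<in> {..<m}" "j \<in> {..<m}"
      then show "e j * e i * gg (nabla_R (E i) X (E j) (E i)) (E j) p =
          - (e i * (e j * gg (nabla_R (E i) X (E j) (E j)) (E i) p))"
        using X nabla_R_skew[of "E i" X "E j" "E i" "E j" p] by simp
    qed
    also have "\<dots> = - divg Ric X p"
      unfolding divS S_def by (simp add: sum_distrib_left sum_negf)
    finally show ?thesis .
  qed
  have "gg (nabla_R X (E i) (E j) (E j)) (E i) p + gg (nabla_R (E i) (E j) X (E j)) (E i) p
      + gg (nabla_R (E j) X (E i) (E j)) (E i) p = 0" if "i < m" "j < m" for i j
  proof -
    have "gg (nabla_R X (E i) (E j) (E j) + nabla_R (E i) (E j) X (E j) + nabla_R (E j) X (E i) (E j))
        (E i) p = 0"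
      using second_bianchi[of X "E i" "E j" "E j"] that X by (simp add: gg_0_left)
    then show ?thesis using that X by (simp add: gg_add_left)
  qed
  then have "(\<Sum>i<m. \<Sum>j<m. e i * e j * (gg (nabla_R X (E i) (E j) (E j)) (E i) p
      + gg (nabla_R (E i) (E j) X (E j)) (E i) p + gg (nabla_R (E j) X (E i) (E j)) (E i) p)) = 0"
    by simp
  then show ?thesis using T1 T2 T3 by (simp add: distrib_left sum.distrib)
qed

lemma divg_gg: "X \<in> V \<Longrightarrow> divg gg X p = 0"
  unfolding divg_def by (simp add: metric)

lemma divg_killing_square:
  assumes Z: "killing Z" and c: "\<And>q. q \<in> U \<Longrightarrow> gg Z Z q = c" and X: "X \<in> V" and p: "p \<in> U"
  shows "divg (\<lambda>A B q. gg A Z q * gg B Z q) X p = 0"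
proof -
  have ZV: "Z \<in> V" using Z unfolding killing_def by blast
  have K: "gg (D A Z) B p = - gg (D B Z) A p" if "A \<in> V" "B \<in> V" for A B
  proof -
    have "gg (D A Z) B p + gg (D B Z) A p = 0" using Z p that unfolding killing_def by blast
    then show ?thesis by simp
  qed
  have "act X (gg Z Z) p = act X (\<lambda>_. c) p" by (rule act_cong[OF X]) (rule c)
  then have "gg (D X Z) Z p = 0"
    using X ZV gg_sym[of Z "D X Z" p] by (simp add: act_const metric)
  then have ZZ: "gg (D Z Z) X p = 0" using K[OF X ZV] by simp
  have "divg (\<lambda>A B q. gg A Z q * gg B Z q) X p
      = (\<Sum>i<m. e i * (gg (E i) Z p * gg X (D (E i) Z) p + gg X Z p * gg (E i) (D (E i) Z) p))"
    unfolding divg_def using X ZV by (simp add: act_mult_fun metric algebra_simps)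
  \<comment> \<open>The Killing equation makes \<open>gg (E i) (D (E i) Z) p\<close> vanish, which
    is where div Z disappears, and moves the other factor onto \<open>D X Z\<close>. Parseval then
    sums to minus half the derivative of the constant length.\<close>
  also have "\<dots> = (\<Sum>i<m. - (e i * gg Z (E i) p * gg (D X Z) (E i) p))"
  proof (rule sum.cong[OF refl])
    fix i assume "i \<in> {..<m}"
    then have i: "E i \<in> V" by simp
    have "gg (E i) (D (E i) Z) p = 0" using K[OF i i] gg_sym[of "E i" "D (E i) Z" p] i ZV by simp
    moreover have "gg X (D (E i) Z) p = - gg (D X Z) (E i) p"
      using K[OF X i] gg_sym[of X "D (E i) Z" p] i ZV X by simp
    ultimately show "e i * (gg (E i) Z p * gg X (D (E i) Z) p + gg X Z p * gg (E i) (D (E i) Z) p)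
        = - (e i * gg Z (E i) p * gg (D X Z) (E i) p)"
      using gg_sym[OF i ZV] by simp
  qed
  also have "\<dots> = - gg Z (D X Z) p"
    using X ZV by (simp add: sum_negf parseval)
  also have "\<dots> = 0" using \<open>gg (D X Z) Z p = 0\<close> X ZV gg_sym[of Z "D X Z" p] by simp
  finally show ?thesis .
qed

text \<open>Schur's argument for Einstein metrics, based on the contracted Bianchi identity. Since
  \<open>k\<close> is a number, its term adds nothing to the derivative of the trace and, by
  \<open>divg_killing_square\<close>, nothing to the divergence.\<close>

lemma schur:
  fixes \<xi> :: "'i \<Rightarrow> 'v" and \<epsilon> :: "'i \<Rightarrow> real" and n :: nat
  assumes n: "n \<ge> 2" and I: "finite I" and m: "m = 2 * n + card I"
    and kill: "\<And>\<alpha>. \<alpha> \<in> I \<Longrightarrow> killing (\<xi> \<alpha>)"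
    and ortho: "\<And>\<alpha> \<beta> q. \<alpha> \<in> I \<Longrightarrow> \<beta> \<in> I \<Longrightarrow> q \<in> U \<Longrightarrow>
        gg (\<xi> \<alpha>) (\<xi> \<beta>) q = (if \<alpha> = \<beta> then \<epsilon> \<alpha> else 0)"
    and sign: "\<And>\<alpha>. \<alpha> \<in> I \<Longrightarrow> \<epsilon> \<alpha> * \<epsilon> \<alpha> = 1"
    and h: "h \<in> F"
    and Ric: "\<And>A B q. A \<in> V \<Longrightarrow> B \<in> V \<Longrightarrow> q \<in> U \<Longrightarrow> Ric A B q =
        h q * (gg A B q - (\<Sum>\<alpha>\<in>I. \<epsilon> \<alpha> * (gg A (\<xi> \<alpha>) q * gg B (\<xi> \<alpha>) q)))
        + k * (gg A (\<Sum>\<alpha>\<in>I. \<xi> \<alpha>) q * gg B (\<Sum>\<alpha>\<in>I. \<xi> \<alpha>) q)"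
    and X: "X \<in> V" and p: "p \<in> U"
  shows "act X h p = 0"
proof -
  have xi [simp]: "\<xi> \<alpha> \<in> V" if "\<alpha> \<in> I" for \<alpha> using kill that unfolding killing_def by blast
  define Z where "Z = (\<Sum>\<alpha>\<in>I. \<xi> \<alpha>)"
  have "killing Z" unfolding Z_def by (rule killing_sum) (rule kill)
  then have Z: "Z \<in> V" "killing Z" by (simp_all add: killing_def)
  \<comment> \<open>For mixed signs this length may be negative or 0, so \<open>Z\<close> may be
    null; what matters below is that it is constant.\<close>
  have ZZ: "gg Z Z q = (\<Sum>\<alpha>\<in>I. \<epsilon> \<alpha>)" if "q \<in> U" for q
    unfolding Z_def by (simp add: gg_sum_left gg_sum_right ortho that I)
  \<comment> \<open>The trace of the metric is 2n plus the number of \<xi> fields, and each of their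
    squares takes away \<epsilon>^2 = 1; this leaves the factor 2n.\<close>
  have tau: "(\<Sum>i<m. e i * Ric (E i) (E i) q) = 2 * real n * h q + k * (\<Sum>\<alpha>\<in>I. \<epsilon> \<alpha>)" if q: "q \<in> U" for q
  proof -
    have "(\<Sum>i<m. e i * Ric (E i) (E i) q) = (\<Sum>i<m. h q * (e i * gg (E i) (E i) q)
        - h q * (\<Sum>\<alpha>\<in>I. e i * (\<epsilon> \<alpha> * (gg (E i) (\<xi> \<alpha>) q * gg (E i) (\<xi> \<alpha>) q)))
        + k * (e i * (gg (E i) Z q * gg (E i) Z q)))"
      unfolding sum_distrib_left[symmetric]
      by (intro sum.cong refl) (simp add: Ric q Z_def[symmetric] right_diff_distrib distrib_left mult_ac)
    also have "\<dots> = h q * ((\<Sum>i<m. e i * gg (E i) (E i) q)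
        - (\<Sum>i<m. \<Sum>\<alpha>\<in>I. e i * (\<epsilon> \<alpha> * (gg (E i) (\<xi> \<alpha>) q * gg (E i) (\<xi> \<alpha>) q))))
        + k * (\<Sum>i<m. e i * (gg (E i) Z q * gg (E i) Z q))"
      by (simp only: sum.distrib sum_subtractf sum_distrib_left[symmetric] right_diff_distrib)
    finally have "(\<Sum>i<m. e i * Ric (E i) (E i) q) = h q * ((\<Sum>i<m. e i * gg (E i) (E i) q)
        - (\<Sum>i<m. \<Sum>\<alpha>\<in>I. e i * (\<epsilon> \<alpha> * (gg (E i) (\<xi> \<alpha>) q * gg (E i) (\<xi> \<alpha>) q))))
        + k * (\<Sum>i<m. e i * (gg (E i) Z q * gg (E i) Z q))" .
    moreover have "(\<Sum>i<m. e i * gg (E i) (E i) q) = real m"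
      using q frame_sign by (simp add: frame_orthonormal)
    moreover have "(\<Sum>i<m. \<Sum>\<alpha>\<in>I. e i * (\<epsilon> \<alpha> * (gg (E i) (\<xi> \<alpha>) q * gg (E i) (\<xi> \<alpha>) q))) = real (card I)"
    proof -
      have "(\<Sum>i<m. \<Sum>\<alpha>\<in>I. e i * (\<epsilon> \<alpha> * (gg (E i) (\<xi> \<alpha>) q * gg (E i) (\<xi> \<alpha>) q)))
        = (\<Sum>\<alpha>\<in>I. \<epsilon> \<alpha> * (\<Sum>i<m. e i * (gg (E i) (\<xi> \<alpha>) q * gg (E i) (\<xi> \<alpha>) q)))"
        by (subst sum.swap) (simp add: sum_distrib_left mult_ac)
      also have "\<dots> = (\<Sum>\<alpha>\<in>I. \<epsilon> \<alpha> * \<epsilon> \<alpha>)" using q by (simp add: parseval' ortho)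
      also have "\<dots> = real (card I)" by (simp add: sign)
      finally show ?thesis .
    qed
    moreover have "(\<Sum>i<m. e i * (gg (E i) Z q * gg (E i) Z q)) = (\<Sum>\<alpha>\<in>I. \<epsilon> \<alpha>)"
      using parseval'[OF Z(1) Z(1), of q] ZZ[OF q] by simp
    ultimately show ?thesis by (simp add: m)
  qed
  have lhs: "act A (\<lambda>q. \<Sum>i<m. e i * Ric (E i) (E i) q) q = 2 * real n * act A h q" if A: "A \<in> V" for A q
  proof -
    have "act A (\<lambda>q. \<Sum>i<m. e i * Ric (E i) (E i) q) q
        = act A (\<lambda>q. 2 * real n * h q + k * (\<Sum>\<alpha>\<in>I. \<epsilon> \<alpha>)) q"
      by (rule act_cong[OF A tau])
    then show ?thesis using A h by (simp add: act_add_fun act_const act_cmul_fun)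
  qed
  \<comment> \<open>The part of the metric orthogonal to the \<xi> fields, the abstract form of
    g(\<phi>A, \<phi>B). It differs from the parallel metric by squares of Killing fields of
    constant length, so it is divergence free.\<close>
  define H where "H A B q = gg A B q - (\<Sum>\<alpha>\<in>I. \<epsilon> \<alpha> * (gg A (\<xi> \<alpha>) q * gg B (\<xi> \<alpha>) q))" for A B q
  have HF: "H A B \<in> F" if "A \<in> V" "B \<in> V" for A B
    unfolding H_def[abs_def] using that by simp
  have RicH: "Ric A B q = h q * H A B q + k * (gg A Z q * gg B Z q)" if "A \<in> V" "B \<in> V" "q \<in> U" for A B q
    using Ric[OF that] unfolding H_def Z_def .
  have divH: "divg H A p = 0" if A: "A \<in> V" for A
  proof -
    have "act (E i) (H (E i) A) p = act (E i) (gg (E i) A) p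
       - (\<Sum>\<alpha>\<in>I. \<epsilon> \<alpha> * act (E i) (\<lambda>q. gg (E i) (\<xi> \<alpha>) q * gg A (\<xi> \<alpha>) q) p)" if "i < m" for i
      unfolding H_def using A that by (simp add: act_diff_fun act_sum_fun act_cmul_fun)
    then have "divg H A p = divg gg A p - (\<Sum>i<m. \<Sum>\<alpha>\<in>I. \<epsilon> \<alpha> * (e i *
        (act (E i) (\<lambda>q. gg (E i) (\<xi> \<alpha>) q * gg A (\<xi> \<alpha>) q) p
         - gg (E i) (\<xi> \<alpha>) p * gg (D (E i) A) (\<xi> \<alpha>) p
         - gg (D (E i) (E i)) (\<xi> \<alpha>) p * gg A (\<xi> \<alpha>) p)))"
      unfolding divg_def sum_subtractf[symmetric]
      by (intro sum.cong refl)
        (simp add: H_def right_diff_distrib sum_subtractf sum_distrib_left mult_ac)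
    also have "\<dots> = divg gg A p
       - (\<Sum>\<alpha>\<in>I. \<epsilon> \<alpha> * divg (\<lambda>A B q. gg A (\<xi> \<alpha>) q * gg B (\<xi> \<alpha>) q) A p)"
      unfolding divg_def by (subst sum.swap) (simp add: sum_distrib_left)
    finally have "divg H A p = divg gg A p
       - (\<Sum>\<alpha>\<in>I. \<epsilon> \<alpha> * divg (\<lambda>A B q. gg A (\<xi> \<alpha>) q * gg B (\<xi> \<alpha>) q) A p)" .
    moreover have "divg (\<lambda>A B q. gg A (\<xi> \<alpha>) q * gg B (\<xi> \<alpha>) q) A p = 0" if "\<alpha> \<in> I" for \<alpha>
      by (rule divg_killing_square[OF kill[OF that] _ A p]) (use ortho that in simp)
    ultimately show ?thesis using A by (simp add: divg_gg)
  qed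
  \<comment> \<open>Since \<open>H\<close> and the square of \<open>Z\<close> are divergence free,
    only the derivative of \<open>h\<close> contracted with \<open>H\<close> survives, and
    \<open>act_expand'\<close> evaluates the frame sum.\<close>
  have divRic: "divg Ric A p = act A h p - (\<Sum>\<alpha>\<in>I. \<epsilon> \<alpha> * (gg A (\<xi> \<alpha>) p * act (\<xi> \<alpha>) h p))"
    if A: "A \<in> V" for A
  proof -
    have "act (E i) (Ric (E i) A) p = H (E i) A p * act (E i) h p + h p * act (E i) (H (E i) A) p
       + k * act (E i) (\<lambda>q. gg (E i) Z q * gg A Z q) p" if i: "i < m" for i
    proof -
      have "act (E i) (Ric (E i) A) p = act (E i) (\<lambda>q. h q * H (E i) A q + k * (gg (E i) Z q * gg A Z q)) p"
        by (rule act_cong) (use RicH A i in auto)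
      then show ?thesis using A i h HF Z by (simp add: act_add_fun act_cmul_fun act_mult_fun)
    qed
    then have "divg Ric A p = (\<Sum>i<m. e i * H (E i) A p * act (E i) h p)
       + h p * divg H A p + k * divg (\<lambda>A B q. gg A Z q * gg B Z q) A p"
      unfolding divg_def sum_distrib_left sum.distrib[symmetric] using A p
      by (intro sum.cong refl)
        (simp add: RicH distrib_left right_diff_distrib mult_ac)
    also have "\<dots> = (\<Sum>i<m. e i * H (E i) A p * act (E i) h p)"
      using divH[OF A] divg_killing_square[OF Z(2) ZZ A p] by simp
    also have "\<dots> = (\<Sum>i<m. e i * gg (E i) A p * act (E i) h p)
       - (\<Sum>i<m. \<Sum>\<alpha>\<in>I. \<epsilon> \<alpha> * gg A (\<xi> \<alpha>) p * (e i * gg (E i) (\<xi> \<alpha>) p * act (E i) h p))"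
      unfolding H_def sum_subtractf[symmetric]
      by (intro sum.cong refl)
        (simp add: right_diff_distrib left_diff_distrib sum_distrib_left sum_distrib_right mult_ac)
    also have "(\<Sum>i<m. \<Sum>\<alpha>\<in>I. \<epsilon> \<alpha> * gg A (\<xi> \<alpha>) p * (e i * gg (E i) (\<xi> \<alpha>) p * act (E i) h p))
       = (\<Sum>\<alpha>\<in>I. \<epsilon> \<alpha> * gg A (\<xi> \<alpha>) p * (\<Sum>i<m. e i * gg (E i) (\<xi> \<alpha>) p * act (E i) h p))"
      by (subst sum.swap) (simp add: sum_distrib_left)
    also have "(\<Sum>i<m. e i * gg (E i) A p * act (E i) h p)
       - (\<Sum>\<alpha>\<in>I. \<epsilon> \<alpha> * gg A (\<xi> \<alpha>) p * (\<Sum>i<m. e i * gg (E i) (\<xi> \<alpha>) p * act (E i) h p))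
       = act A h p - (\<Sum>\<alpha>\<in>I. \<epsilon> \<alpha> * gg A (\<xi> \<alpha>) p * act (\<xi> \<alpha>) h p)"
      using A by (simp add: act_expand')
    finally show ?thesis by (simp only: mult.assoc)
  qed
  have eq: "2 * real n * act A h p = 2 * (act A h p - (\<Sum>\<alpha>\<in>I. \<epsilon> \<alpha> * (gg A (\<xi> \<alpha>) p * act (\<xi> \<alpha>) h p)))"
    if "A \<in> V" for A
    using contracted_bianchi[OF that p] lhs[OF that] divRic[OF that] by simp
  have xih: "act (\<xi> \<beta>) h p = 0" if b: "\<beta> \<in> I" for \<beta>
  proof -
    \<comment> \<open>Orthogonality leaves the summand for \<beta>, in which the two signs multiply
      to 1, so the right side of \<open>eq\<close> is 0.\<close>
    have "(\<Sum>\<alpha>\<in>I. \<epsilon> \<alpha> * (gg (\<xi> \<beta>) (\<xi> \<alpha>) p * act (\<xi> \<alpha>) h p))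
        = (\<Sum>\<alpha>\<in>I. if \<alpha> = \<beta> then act (\<xi> \<alpha>) h p else 0)"
    proof (rule sum.cong[OF refl])
      fix \<alpha> assume a: "\<alpha> \<in> I"
      then show "\<epsilon> \<alpha> * (gg (\<xi> \<beta>) (\<xi> \<alpha>) p * act (\<xi> \<alpha>) h p) = (if \<alpha> = \<beta> then act (\<xi> \<alpha>) h p else 0)"
        using ortho[OF b a p] sign[OF a] by (cases "\<alpha> = \<beta>") (simp_all flip: mult.assoc)
    qed
    then have "2 * real n * act (\<xi> \<beta>) h p = 0" using eq[OF xi[OF b]] b I by simp
    then show ?thesis using n by simp
  qed
  have "2 * real n * act X h p = 2 * act X h p" using eq[OF X] by (simp add: xih)
  then show ?thesis using n by auto
qed

end

end


section \<open>Orthonormal frames and the Levi-Civita connection\<close>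

text \<open>Gram-Schmidt for an indefinite form can run into null vectors. The form is still
  nondegenerate on the orthogonal complement of the family, and polarisation finds a vector of
  nonzero length there.\<close>

lemma nondegenerate_extend:
  fixes G :: "'e::euclidean_space \<Rightarrow> 'e \<Rightarrow> real"
  assumes lin: "\<And>u. linear (G u)" and sym: "\<And>u v. G u v = G v u"
    and nd: "\<And>u. (\<And>v. G u v = 0) \<Longrightarrow> u = 0"
    and k: "k < DIM('e)"
    and ortho: "\<And>i j. i < k \<Longrightarrow> j < k \<Longrightarrow> G (a i) (a j) = (if i = j then e i else 0)"
    and sign: "\<And>i. i < k \<Longrightarrow> e i * e i = 1"
  obtains v where "\<And>i. i < k \<Longrightarrow> G v (a i) = 0" "G v v \<noteq> 0"
proof -
  \<comment> \<open>Projection to the orthogonal complement; division by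
    \<open>G (a i) (a i)\<close> is multiplication by \<open>e i\<close>, since each sign is its own
    inverse.\<close>
  define pr where "pr w = w - (\<Sum>i<k. (e i * G w (a i)) *\<^sub>R a i)" for w
  have G_pr: "G u (pr w) = G u w - (\<Sum>i<k. e i * G w (a i) * G u (a i))" for u w
    unfolding pr_def by (simp add: linear_diff[OF lin] linear_sum[OF lin] linear_cmul[OF lin])
  have orth: "G (pr w) (a j) = 0" if j: "j < k" for w j
  proof -
    have "(\<Sum>i<k. e i * G w (a i) * G (a j) (a i)) = (\<Sum>i<k. if i = j then e j * e j * G w (a j) else 0)"
      using j by (intro sum.cong refl) (auto simp: ortho)
    then have "G (a j) (pr w) = 0" using j by (simp add: G_pr sign sym[of w])
    then show ?thesis by (simp only: sym[of "pr w"])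
  qed
  have "dim (a ` {..<k}) \<le> card (a ` {..<k})" by (rule dim_le_card') simp
  also have "\<dots> \<le> k" using card_image_le[of "{..<k}" a] by simp
  finally have "span (a ` {..<k}) \<noteq> UNIV" using k by (metis dim_UNIV dim_span not_less)
  then obtain w where w: "w \<notin> span (a ` {..<k})" by blast
  have "(\<Sum>i<k. (e i * G w (a i)) *\<^sub>R a i) \<in> span (a ` {..<k})"
    by (intro span_sum span_scale span_base) simp
  then have "pr w \<noteq> 0" using w unfolding pr_def by auto
  then obtain z where z: "G (pr w) z \<noteq> 0" using nd by blast
  have z': "G (pr w) (pr z) \<noteq> 0"
    using z by (simp add: G_pr orth)
  have add: "G (u + v) (u + v) = G u u + 2 * G u v + G v v" for u v
    using sym[of "u + v" u] sym[of "u + v" v] sym[of v u] by (simp add: linear_add[OF lin])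
  \<comment> \<open>If all three values were 0, then \<open>add\<close> would force
    \<open>G (pr w) (pr z) = 0\<close>.\<close>
  consider "G (pr w) (pr w) \<noteq> 0" | "G (pr z) (pr z) \<noteq> 0"
    | "G (pr w + pr z) (pr w + pr z) \<noteq> 0"
    using z' add by fastforce
  then show ?thesis
  proof cases
    case 3
    have "G (pr w + pr z) (a i) = 0" if "i < k" for i
      unfolding sym[of _ "a i"] by (simp add: linear_add[OF lin] orth[OF that] sym[of "a i"])
    then show ?thesis using that 3 by blast
  qed (use that orth in blast)+
qed

text \<open>Orthonormality gives independence, so the family is a basis by its size; the difference
  of the two sides is orthogonal to it and vanishes by nondegeneracy.\<close>

lemma orthonormal_expand:
  fixes G :: "'e::euclidean_space \<Rightarrow> 'e \<Rightarrow> real"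
  assumes lin: "\<And>u. linear (G u)" and sym: "\<And>u v. G u v = G v u"
    and nd: "\<And>u. (\<And>v. G u v = 0) \<Longrightarrow> u = 0"
    and ortho: "\<And>i j. i < DIM('e) \<Longrightarrow> j < DIM('e) \<Longrightarrow> G (a i) (a j) = (if i = j then e i else 0)"
    and sign: "\<And>i. i < DIM('e) \<Longrightarrow> e i * e i = 1"
  shows "w = (\<Sum>i<DIM('e). (e i * G w (a i)) *\<^sub>R a i)"
proof -
  let ?m = "DIM('e)" and ?B = "a ` {..<DIM('e)}"
  have e0: "e i \<noteq> 0" if "i < ?m" for i using sign[OF that] by auto
  have inj: "inj_on a {..<?m}"
  proof (rule inj_onI)
    fix i j assume ij: "i \<in> {..<?m}" "j \<in> {..<?m}" "a i = a j"
    then have "G (a i) (a j) = e i" using ortho[of i i] by simp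
    then show "i = j" using ortho[of i j] ij e0[of i] by (auto split: if_splits)
  qed
  have "independent ?B"
  proof
    assume "dependent ?B"
    then obtain u j where u: "(\<Sum>v\<in>?B. u v *\<^sub>R v) = 0" and j: "j < ?m" "u (a j) \<noteq> 0"
      by (auto simp: dependent_finite)
    have "0 = G (a j) (\<Sum>v\<in>?B. u v *\<^sub>R v)" unfolding u by (simp add: linear_0[OF lin])
    also have "\<dots> = (\<Sum>i<?m. u (a i) * G (a j) (a i))"
      by (simp add: linear_sum[OF lin] linear_cmul[OF lin] sum.reindex[OF inj])
    also have "\<dots> = (\<Sum>i<?m. if i = j then u (a j) * e j else 0)"
      using j by (intro sum.cong refl) (auto simp: ortho)
    also have "\<dots> = u (a j) * e j" using j by simp
    finally show False using j e0 by simp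
  qed
  then have span: "span ?B = UNIV"
    using card_ge_dim_independent[of ?B UNIV] card_image[OF inj] by auto
  define d where "d = w - (\<Sum>i<?m. (e i * G w (a i)) *\<^sub>R a i)"
  have orth: "G d (a j) = 0" if j: "j < ?m" for j
  proof -
    have "(\<Sum>i<?m. e i * G w (a i) * G (a j) (a i)) = (\<Sum>i<?m. if i = j then e j * e j * G w (a j) else 0)"
      using j by (intro sum.cong refl) (auto simp: ortho)
    then have "G (a j) d = 0" unfolding d_def using j
      by (simp add: linear_diff[OF lin] linear_sum[OF lin] linear_cmul[OF lin] sign sym[of w])
    then show ?thesis by (simp only: sym[of d])
  qed
  have "G d v = 0" for v
    by (rule linear_eq_0_on_span[OF lin, of ?B]) (use orth span in auto)
  then have "d = 0" by (rule nd)
  then show ?thesis by (simp add: d_def)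
qed

section \<open>Maps that are linear on a subspace\<close>

lemma lin_on_scale: "lin_on V F \<Longrightarrow> v \<in> V \<Longrightarrow> F (a *\<^sub>R v) = a *\<^sub>R F v"
  unfolding lin_on_def by (metis add.right_neutral scaleR_zero_left)

lemma lin_on_add: "lin_on V F \<Longrightarrow> u \<in> V \<Longrightarrow> v \<in> V \<Longrightarrow> F (u + v) = F u + F v"
  unfolding lin_on_def by (metis scaleR_one)

lemma lin_on_0: "lin_on V F \<Longrightarrow> subspace V \<Longrightarrow> F 0 = 0"
  using lin_on_scale[of V F 0 0] by (simp add: subspace_0)

lemma lin_on_sum:
  assumes "lin_on V F" "subspace V" "\<And>i. i \<in> I \<Longrightarrow> x i \<in> V"
  shows "F (\<Sum>i\<in>I. c i *\<^sub>R x i) = (\<Sum>i\<in>I. c i *\<^sub>R F (x i))"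
  using assms(3)
proof (induction I rule: infinite_finite_induct)
  case (insert i I)
  then have "(\<Sum>i\<in>I. c i *\<^sub>R x i) \<in> V" "c i *\<^sub>R x i \<in> V"
    using assms(2) by (auto intro!: subspace_sum subspace_scale)
  then show ?case
    using insert by (simp add: lin_on_add[OF assms(1)] lin_on_scale[OF assms(1)])
qed (auto simp: lin_on_0[OF assms(1,2)])

section \<open>Functions with vanishing differential\<close>

context smooth_mfd
begin

text \<open>On a coordinate ball, which is convex, a vanishing derivative makes the function
  constant; connectedness spreads this over the manifold.\<close>

lemma constant_if_all_derivatives_vanish:
  assumes h: "smooth_fun M P h" and z: "\<And>p v. p \<in> P \<Longrightarrow> v \<in> T p \<Longrightarrow> v h = 0"
  shows "h constant_on P"
proof -
  have opnP: "opn P" by simp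
  have n: "near p h" if "p \<in> P" for p using h that by (simp add: smooth_fun_iff[OF opnP])
  have loc: "\<exists>V. opn V \<and> p \<in> V \<and> (\<forall>q\<in>V. h q = h p)" if p: "p \<in> P" for p
  proof -
    obtain U x where c: "(U, x) \<in> atlas M" "p \<in> U" using chart_at[OF p] by blast
    have "open (x ` U)" using is_chart[OF c(1)] unfolding is_chart_def by blast
    then obtain r where r: "r > 0" "ball (x p) r \<subseteq> x ` U"
      using c(2) open_contains_ball by blast
    have "((h \<circ> inv_into U x) has_derivative (\<lambda>_. 0)) (at y within ball (x p) r)"
      if y: "y \<in> ball (x p) r" for y
    proof -
      obtain q where q: "q \<in> U" "y = x q" using y r by blast
      have qP: "q \<in> P" using q chart_subset[OF c(1)] by blast
      have "frechet_derivative (h \<circ> inv_into U x) (at (x q)) a = 0" for a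
      proof -
        have "dir_deriv M U x q a \<in> T q" unfolding tangent_space_chart[OF c(1) q(1)] by (rule rangeI)
        then have "dir_deriv M U x q a h = 0" by (rule z[OF qP])
        then show ?thesis using n[OF qP] by (simp add: dir_deriv_def)
      qed
      then have "frechet_derivative (h \<circ> inv_into U x) (at (x q)) = (\<lambda>_. 0)" by (rule ext)
      then have "((h \<circ> inv_into U x) has_derivative (\<lambda>_. 0)) (at y)"
        using has_frechet_derivative[OF near_chart_diff[OF c(1) q(1) n[OF qP]]] by (simp only: q(2))
      then show ?thesis by (rule has_derivative_at_withinI)
    qed
    then obtain k where k: "\<And>y. y \<in> ball (x p) r \<Longrightarrow> (h \<circ> inv_into U x) y = k"
      using has_derivative_zero_constant[OF convex_ball, of "x p" r "h \<circ> inv_into U x"] by blast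
    have kk: "h q = k" if "q \<in> U" "x q \<in> ball (x p) r" for q
      using k[OF that(2)] that(1) c(1) by simp
    show ?thesis
    proof (intro exI conjI ballI)
      show "opn {q \<in> U. x q \<in> ball (x p) r}" by (rule chart_vimage_open[OF c(1)]) simp
      show "p \<in> {q \<in> U. x q \<in> ball (x p) r}" using c(2) r(1) by simp
      fix q assume "q \<in> {q \<in> U. x q \<in> ball (x p) r}"
      then show "h q = h p" using kk[of q] kk[of p] c(2) r(1) by simp
    qed
  qed
  show ?thesis
  proof (cases "P = {}")
    case True
    then show ?thesis by (simp add: constant_on_def)
  next
    case False
    then obtain p0 where p0: "p0 \<in> P" by blast
    \<comment> \<open>Local constancy makes every set described by the value of \<open>h\<close>
      open, in particular a level set and its complement.\<close>
    have "opn {q \<in> P. Q (h q)}" for Q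
    proof (subst openin_subopen, intro ballI)
      fix q assume q: "q \<in> {q \<in> P. Q (h q)}"
      then obtain V where V: "opn V" "q \<in> V" "\<forall>r\<in>V. h r = h q" using loc by blast
      have "V \<subseteq> {q \<in> P. Q (h q)}"
      proof
        fix r assume r: "r \<in> V"
        have "h r = h q" using V(3) r by (rule bspec)
        then show "r \<in> {q \<in> P. Q (h q)}" using q openin_subset[OF V(1)] r by auto
      qed
      then show "\<exists>V. opn V \<and> q \<in> V \<and> V \<subseteq> {q \<in> P. Q (h q)}" using V by blast
    qed
    note o = this[of "\<lambda>y. y = h p0"] this[of "\<lambda>y. y \<noteq> h p0"]
    have cs: "connected_space (mtop M)" using smooth_manifold unfolding smooth_manifold_def by (elim conjE)
    have "{q \<in> P. h q \<noteq> h p0} = {}"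
    proof (rule ccontr)
      assume "{q \<in> P. h q \<noteq> h p0} \<noteq> {}"
      then have "\<exists>E1 E2. opn E1 \<and> opn E2 \<and> P \<subseteq> E1 \<union> E2 \<and> E1 \<inter> E2 = {} \<and> E1 \<noteq> {} \<and> E2 \<noteq> {}"
        using o p0 by (intro exI[of _ "{q \<in> P. h q = h p0}"] exI[of _ "{q \<in> P. h q \<noteq> h p0}"]) auto
      then show False using cs unfolding connected_space_def by (rule notE[rotated])
    qed
    then show ?thesis unfolding constant_on_def by blast
  qed
qed

end

section \<open>The metric on tangent spaces and local orthonormal frames\<close>

locale levi_civita_mfd = smooth_mfd M
  for M :: "('a, 'e::euclidean_space) mfd" +
  fixes g :: "'a \<Rightarrow> 'a tvec \<Rightarrow> 'a tvec \<Rightarrow> real" and D :: "'a vfield \<Rightarrow> 'a vfield \<Rightarrow> 'a vfield"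
  assumes metric: "semi_riemannian_metric M g" and levi_civita: "levi_civita M g D"
begin

context
  fixes p assumes p: "p \<in> P"
begin

lemma metric_at:
  assumes "u \<in> T p"
  shows "lin_on (T p) (g p u) \<and> (\<forall>v\<in>T p. g p u v = g p v u) \<and> ((\<forall>v\<in>T p. g p u v = 0) \<longrightarrow> u = 0)"
proof -
  have m: "\<forall>p\<in>P. \<forall>u\<in>T p. lin_on (T p) (g p u) \<and> (\<forall>v\<in>T p. g p u v = g p v u) \<and>
      ((\<forall>v\<in>T p. g p u v = 0) \<longrightarrow> u = 0)"
    using metric unfolding semi_riemannian_metric_def by (elim conjE)
  show ?thesis by (rule bspec[OF bspec[OF m p] assms])
qed

lemma g_lin: "u \<in> T p \<Longrightarrow> lin_on (T p) (g p u)"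
  by (simp add: metric_at)

lemma g_sym: "u \<in> T p \<Longrightarrow> v \<in> T p \<Longrightarrow> g p u v = g p v u"
  using metric_at[of u] by blast

lemma g_nondegenerate: "u \<in> T p \<Longrightarrow> (\<And>v. v \<in> T p \<Longrightarrow> g p u v = 0) \<Longrightarrow> u = 0"
  using metric_at[of u] by blast

lemma g_add_left: "u \<in> T p \<Longrightarrow> v \<in> T p \<Longrightarrow> w \<in> T p \<Longrightarrow> g p (u + v) w = g p u w + g p v w"
  using g_sym[of "u + v" w] g_sym[of u w] g_sym[of v w] subspace_add[OF subspace_T[OF p], of u v]
    lin_on_add[OF g_lin, of w u v] by simp

lemma g_scale_left: "u \<in> T p \<Longrightarrow> w \<in> T p \<Longrightarrow> g p (a *\<^sub>R u) w = a * g p u w"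
  using g_sym[of "a *\<^sub>R u" w] g_sym[of u w] subspace_scale[OF subspace_T[OF p], of u a]
    lin_on_scale[OF g_lin, of w u a] by simp

text \<open>Tangent vectors live in a large space of operators. A chart pulls the metric back to the
  Euclidean model space, where the dimension arguments for nondegenerate forms apply.\<close>

lemma pullback_metric:
  assumes c: "(U, x) \<in> atlas M" "p \<in> U"
  defines "G \<equiv> \<lambda>a b. g p (dir_deriv M U x p a) (dir_deriv M U x p b)"
  shows "linear (G u)" "G u v = G v u" "(\<And>v. G u v = 0) \<Longrightarrow> u = 0"
proof -
  have JT: "dir_deriv M U x p a \<in> T p" for a using tangent_space_chart[OF c] by blast
  note J = linear_dir_deriv[OF c]
  show "linear (G u)"
    unfolding G_def
    by (intro linearI)
      (simp_all add: linear_add[OF J] linear_cmul[OF J] lin_on_add[OF g_lin[OF JT] JT JT]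
        lin_on_scale[OF g_lin[OF JT] JT])
  show "G u v = G v u" unfolding G_def by (rule g_sym[OF JT JT])
  assume "\<And>v. G u v = 0"
  then have "dir_deriv M U x p u = 0"
    using tangent_space_chart[OF c] by (intro g_nondegenerate[OF JT]) (auto simp: G_def)
  then show "u = 0" using inj_dir_deriv[OF c] linear_0[OF J] by (metis injD)
qed

lemma orthonormal_extend:
  assumes k: "k < DIM('e)" and T: "\<And>i. i < k \<Longrightarrow> u i \<in> T p"
    and ortho: "\<And>i j. i < k \<Longrightarrow> j < k \<Longrightarrow> g p (u i) (u j) = (if i = j then e i else 0)"
    and sign: "\<And>i. i < k \<Longrightarrow> e i * e i = 1"
  obtains v where "v \<in> T p" "\<And>i. i < k \<Longrightarrow> g p v (u i) = 0" "g p v v \<noteq> 0"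
proof -
  obtain U x where c: "(U, x) \<in> atlas M" "p \<in> U" using chart_at[OF p] by blast
  define J where "J = dir_deriv M U x p"
  define a where "a i = inv J (u i)" for i
  have TJ: "T p = range J" unfolding J_def by (rule tangent_space_chart[OF c])
  have J: "J (a i) = u i" if "i < k" for i
    unfolding a_def using T[OF that] TJ by (simp add: f_inv_into_f)
  obtain v where "\<And>i. i < k \<Longrightarrow> g p (J v) (J (a i)) = 0" "g p (J v) (J v) \<noteq> 0"
    using nondegenerate_extend[OF pullback_metric[OF c] k, of a e] ortho sign J
    unfolding J_def by auto
  then show ?thesis using that[of "J v"] J TJ by auto
qed

lemma orthonormal_expand_tvec:
  assumes T: "\<And>i. i < DIM('e) \<Longrightarrow> u i \<in> T p"
    and ortho: "\<And>i j. i < DIM('e) \<Longrightarrow> j < DIM('e) \<Longrightarrow> g p (u i) (u j) = (if i = j then e i else 0)"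
    and sign: "\<And>i. i < DIM('e) \<Longrightarrow> e i * e i = 1"
    and w: "w \<in> T p"
  shows "w = (\<Sum>i<DIM('e). (e i * g p w (u i)) *\<^sub>R u i)"
proof -
  obtain U x where c: "(U, x) \<in> atlas M" "p \<in> U" using chart_at[OF p] by blast
  define J where "J = dir_deriv M U x p"
  define a where "a i = inv J (u i)" for i
  have TJ: "T p = range J" unfolding J_def by (rule tangent_space_chart[OF c])
  have J: "J (a i) = u i" if "i < DIM('e)" for i
    unfolding a_def using T[OF that] TJ by (simp add: f_inv_into_f)
  obtain b where b: "w = J b" using w TJ by blast
  have lin: "linear J" unfolding J_def by (rule linear_dir_deriv[OF c])
  have be: "b = (\<Sum>i<DIM('e). (e i * g p (J b) (J (a i))) *\<^sub>R a i)"
    unfolding J_def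
    by (rule orthonormal_expand[OF pullback_metric[OF c]])
      (use ortho sign J in \<open>auto simp: J_def[symmetric]\<close>)
  have "J b = (\<Sum>i<DIM('e). (e i * g p (J b) (J (a i))) *\<^sub>R J (a i))"
    unfolding linear_cmul[OF lin, symmetric] linear_sum[OF lin, symmetric]
    by (rule arg_cong[OF be])
  then show ?thesis unfolding b using J by simp
qed

end

lemma g_near:
  "opn U \<Longrightarrow> X \<in> vfields M U \<Longrightarrow> Y \<in> vfields M U \<Longrightarrow> p \<in> U \<Longrightarrow> near p (\<lambda>q. g q (X q) (Y q))"
  using metric smooth_fun_iff[of U "\<lambda>q. g q (X q) (Y q)"] unfolding semi_riemannian_metric_def by blast

text \<open>Indefinite Gram-Schmidt with parameters: a non-null vector orthogonal to the previous
  fields at \<open>p\<close> is extended to a field, made orthogonal to them on the neighbourhood,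
  and normalised where its squared length keeps its sign.\<close>

lemma local_frame:
  assumes p: "p \<in> P" and "k \<le> DIM('e)"
  shows "\<exists>U E e. opn U \<and> p \<in> U \<and> (\<forall>i<k. E i \<in> vfields M U \<and> e i * e i = (1::real)) \<and>
    (\<forall>q\<in>U. \<forall>i<k. \<forall>j<k. g q (E i q) (E j q) = (if i = j then e i else 0))"
  using assms(2)
proof (induction k)
  case 0
  show ?case using p by (intro exI[of _ P]) auto
next
  case (Suc k)
  from Suc.IH[OF Suc_leD[OF Suc.prems]] obtain U E e where U: "opn U" "p \<in> U"
    and "\<forall>i<k. E i \<in> vfields M U \<and> e i * e i = (1::real)"
    and "\<forall>q\<in>U. \<forall>i<k. \<forall>j<k. g q (E i q) (E j q) = (if i = j then e i else 0)"
    by blast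
  then have E: "\<And>i. i < k \<Longrightarrow> E i \<in> vfields M U" and e: "\<And>i. i < k \<Longrightarrow> e i * e i = (1::real)"
    and o: "\<And>q i j. q \<in> U \<Longrightarrow> i < k \<Longrightarrow> j < k \<Longrightarrow> g q (E i q) (E j q) = (if i = j then e i else 0)"
    by blast+
  have k: "k < DIM('e)" using Suc by simp
  have ET: "E i q \<in> T q" if "q \<in> U" "i < k" for q i using vfields_T[OF E] that by blast
  obtain v where v: "v \<in> T p" "\<And>i. i < k \<Longrightarrow> g p v (E i p) = 0" "g p v v \<noteq> 0"
    using orthonormal_extend[OF p k, of "\<lambda>i. E i p" e] ET[OF U(2)] o[OF U(2)] e by blast
  obtain X0 where X0: "X0 \<in> vfields M P" "X0 p = v" using extend_tvec[OF p v(1)] by blast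
  have X: "X0 \<in> vfields M U" using vfields_subset[OF X0(1)] openin_subset[OF U(1)] by blast
  \<comment> \<open>The correction vanishes at \<open>p\<close>, because \<open>v\<close> is already
    orthogonal to the frame there; hence \<open>Y p = v\<close>, and \<open>Y\<close> is not null at
    \<open>p\<close>.\<close>
  define Y where "Y q = X0 q + (\<Sum>i<k. (- (e i * g q (X0 q) (E i q))) *\<^sub>R E i q)" for q
  have Y: "Y \<in> vfields M U" unfolding Y_def
  proof (intro vfields_add vfields_sum vfields_scale U X E)
    fix i assume "i \<in> {..<k}"
    then have "near q (\<lambda>q. - (e i * g q (X0 q) (E i q)))" if "q \<in> U" for q
      using that near_uminus[OF near_mult[OF near_const[of q "e i"] g_near[OF U(1) X E that]]]
        openin_subset[OF U(1)] by blast
    then show "smooth_fun M U (\<lambda>q. - (e i * g q (X0 q) (E i q)))"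
      by (simp add: smooth_fun_iff[OF U(1)])
  qed auto
  have YE: "g q (Y q) (E j q) = 0" if q: "q \<in> U" and j: "j < k" for q j
  proof -
    have qP: "q \<in> P" using q openin_subset[OF U(1)] by blast
    note S = subspace_T[OF qP]
    have XT: "X0 q \<in> T q" using vfields_T[OF X q] .
    have lin: "lin_on (T q) (g q (E j q))" using g_lin[OF qP ET[OF q j]] .
    have sumT: "(\<Sum>i<k. (- (e i * g q (X0 q) (E i q))) *\<^sub>R E i q) \<in> T q"
      using ET[OF q] by (intro subspace_sum[OF S] subspace_scale[OF S]) auto
    have "g q (E j q) (Y q) = g q (E j q) (X0 q)
        + (\<Sum>i<k. - (e i * g q (X0 q) (E i q)) * g q (E j q) (E i q))"
      unfolding Y_def lin_on_add[OF lin XT sumT]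
      by (subst lin_on_sum[OF lin S]) (use ET[OF q] in auto)
    also have "(\<Sum>i<k. - (e i * g q (X0 q) (E i q)) * g q (E j q) (E i q))
        = (\<Sum>i<k. if i = j then - (e j * e j * g q (X0 q) (E j q)) else 0)"
      using j by (intro sum.cong refl) (auto simp: o[OF q])
    also have "\<dots> = - g q (X0 q) (E j q)" using j e by simp
    finally have "g q (E j q) (Y q) = 0" using g_sym[OF qP XT ET[OF q j]] by simp
    then show ?thesis using g_sym[OF qP vfields_T[OF Y q] ET[OF q j]] by simp
  qed
  define f where "f q = g q (Y q) (Y q)" for q
  have f: "near q f" if "q \<in> U" for q unfolding f_def using g_near[OF U(1) Y Y that] .
  have "Y p = v" unfolding Y_def using X0(2) v(2) by simp
  then have fp: "f p \<noteq> 0" using v(3) by (simp add: f_def)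
  \<comment> \<open>Positivity of this product means that \<open>f q\<close> has the sign of
    \<open>f p\<close>, so one constant sign serves for the whole neighbourhood.\<close>
  have "near p (\<lambda>q. f q * f p)" using near_mult[OF f[OF U(2)] near_const[OF p]] .
  moreover have "f p * f p \<in> {0<..}" using fp by (simp add: zero_less_mult_iff) linarith
  ultimately obtain W0 where W0: "opn W0" "p \<in> W0" "\<And>q. q \<in> W0 \<Longrightarrow> f q * f p \<in> {0<..}"
    using near_continuous[of p "\<lambda>q. f q * f p" "{0<..}"] by auto
  define W where "W = U \<inter> W0"
  have W: "opn W" "p \<in> W" "W \<subseteq> U" "W \<subseteq> P" unfolding W_def using U W0 openin_subset by auto
  have fW: "f q \<noteq> 0" "sgn (f q) = sgn (f p)" if "q \<in> W" for q
    using W0(3)[of q] that by (auto simp: W_def sgn_if zero_less_mult_iff)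
  define E' where "E' i = (if i < k then E i else (\<lambda>q. inverse (sqrt \<bar>f q\<bar>) *\<^sub>R Y q))" for i
  define e' where "e' i = (if i < k then e i else sgn (f p))" for i
  have "near q (\<lambda>q. inverse (sqrt \<bar>f q\<bar>))" if "q \<in> W" for q
    by (rule near_compose[OF f _ _ smooth_on_inverse_sqrt_abs]) (use fW that W in auto)
  then have "(\<lambda>q. inverse (sqrt \<bar>f q\<bar>) *\<^sub>R Y q) \<in> vfields M W"
    using vfields_subset[OF Y W(3)] W(1) by (intro vfields_scale) (auto simp: smooth_fun_iff)
  then have E': "E' i \<in> vfields M W" if "i < Suc k" for i
    using vfields_subset[OF E W(3)] by (simp add: E'_def)
  have e': "e' i * e' i = 1" if "i < Suc k" for i using e fp by (simp add: e'_def sgn_if)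
  have "g q (E' i q) (E' j q) = (if i = j then e' i else 0)"
    if q: "q \<in> W" and ij: "i < Suc k" "j < Suc k" for q i j
  proof -
    have qU: "q \<in> U" and qP: "q \<in> P" using q W by auto
    define r where "r = inverse (sqrt \<bar>f q\<bar>)"
    have YT: "Y q \<in> T q" using vfields_T[OF Y qU] .
    have rY: "r *\<^sub>R Y q \<in> T q" using subspace_scale[OF subspace_T[OF qP] YT] .
    have c1: "g q (r *\<^sub>R Y q) (E l q) = 0" if "l < k" for l
      using g_scale_left[OF qP YT ET[OF qU that]] YE[OF qU that] by simp
    then have c2: "g q (E l q) (r *\<^sub>R Y q) = 0" if "l < k" for l
      using that g_sym[OF qP rY ET[OF qU that]] by simp
    have "g q (r *\<^sub>R Y q) (r *\<^sub>R Y q) = r * (r * f q)"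
      using g_scale_left[OF qP YT rY] g_scale_left[OF qP YT YT] g_sym[OF qP YT rY]
      by (simp add: f_def)
    also have "\<dots> = f q / \<bar>f q\<bar>"
      by (simp add: r_def field_simps)
    also have "\<dots> = sgn (f p)" using fW[OF q] by (simp add: sgn_if split: if_splits)
    finally have c3: "g q (r *\<^sub>R Y q) (r *\<^sub>R Y q) = sgn (f p)" .
    have "l = k" if "l < Suc k" "\<not> l < k" for l using that by simp
    then show ?thesis using o[OF qU, of i j] c1 c2 c3 ij
      by (cases "i < k"; cases "j < k") (auto simp: E'_def e'_def r_def[symmetric])
  qed
  then show ?case using W(1,2) E' e' by blast
qed

section \<open>Locality of the connection and of the curvature\<close>

lemma connection_D: "connection M D"
  using levi_civita unfolding levi_civita_def by blast

context
  fixes U assumes U: "opn U"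
begin

lemma connection_at:
  assumes "X \<in> vfields M U" "Y \<in> vfields M U"
  shows "D X Y \<in> vfields M U \<and>
      (\<forall>Z\<in>vfields M U. \<forall>p\<in>U.
        D (X + Z) Y p = D X Y p + D Z Y p \<and> D X (Y + Z) p = D X Y p + D X Z p) \<and>
      (\<forall>f. smooth_fun M U f \<longrightarrow> (\<forall>p\<in>U.
        D (\<lambda>q. f q *\<^sub>R X q) Y p = f p *\<^sub>R D X Y p \<and>
        D X (\<lambda>q. f q *\<^sub>R Y q) p = X p f *\<^sub>R Y p + f p *\<^sub>R D X Y p))"
  using bspec[OF bspec[OF mp[OF spec[OF connection_D[unfolded connection_def]] U] assms(1)] assms(2)] .

lemma levi_civita_at:
  assumes "X \<in> vfields M U" "Y \<in> vfields M U" "p \<in> U"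
  shows "D X Y p - D Y X p = lie_bracket M X Y p \<and>
      (\<forall>Z\<in>vfields M U. X p (\<lambda>q. g q (Y q) (Z q)) = g p (D X Y p) (Z p) + g p (Y p) (D X Z p))"
  using bspec[OF bspec[OF bspec[OF mp[OF spec[OF
    conjunct2[OF levi_civita[unfolded levi_civita_def]]] U] assms(1)] assms(2)] assms(3)] .

lemma D_vf: "X \<in> vfields M U \<Longrightarrow> Y \<in> vfields M U \<Longrightarrow> D X Y \<in> vfields M U"
  by (simp add: connection_at)

lemma D_add_left: "X \<in> vfields M U \<Longrightarrow> Y \<in> vfields M U \<Longrightarrow> Z \<in> vfields M U \<Longrightarrow> p \<in> U \<Longrightarrow>
    D (X + Z) Y p = D X Y p + D Z Y p"
  using connection_at[of X Y] by simp

lemma D_add_right: "X \<in> vfields M U \<Longrightarrow> Y \<in> vfields M U \<Longrightarrow> Z \<in> vfields M U \<Longrightarrow> p \<in> U \<Longrightarrow>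
    D X (Y + Z) p = D X Y p + D X Z p"
  using connection_at[of X Y] by simp

lemma D_scale_left: "X \<in> vfields M U \<Longrightarrow> Y \<in> vfields M U \<Longrightarrow> smooth_fun M U f \<Longrightarrow> p \<in> U \<Longrightarrow>
    D (\<lambda>q. f q *\<^sub>R X q) Y p = f p *\<^sub>R D X Y p"
  using connection_at[of X Y] by simp

lemma D_scale_right: "X \<in> vfields M U \<Longrightarrow> Y \<in> vfields M U \<Longrightarrow> smooth_fun M U f \<Longrightarrow> p \<in> U \<Longrightarrow>
    D X (\<lambda>q. f q *\<^sub>R Y q) p = X p f *\<^sub>R Y p + f p *\<^sub>R D X Y p"
  using connection_at[of X Y] by simp

lemma D_torsion: "X \<in> vfields M U \<Longrightarrow> Y \<in> vfields M U \<Longrightarrow> p \<in> U \<Longrightarrow>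
    lie_bracket M X Y p = D X Y p - D Y X p"
  using levi_civita_at[of X Y p] by simp

lemma D_metric: "X \<in> vfields M U \<Longrightarrow> Y \<in> vfields M U \<Longrightarrow> Z \<in> vfields M U \<Longrightarrow> p \<in> U \<Longrightarrow>
    X p (\<lambda>q. g q (Y q) (Z q)) = g p (D X Y p) (Z p) + g p (Y p) (D X Z p)"
  using levi_civita_at[of X Y p] by simp

lemma vfields_diff: "X \<in> vfields M U \<Longrightarrow> Y \<in> vfields M U \<Longrightarrow> (\<lambda>p. X p - Y p) \<in> vfields M U"
  using vfields_add[OF U, of X "\<lambda>p. - 1 *\<^sub>R Y p"]
    vfields_scale[OF U, of Y "\<lambda>_. - 1"] near_const openin_subset[OF U]
  by (auto simp: smooth_fun_iff[OF U])

lemma lie_bracket_vf: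
  assumes X: "X \<in> vfields M U" and Y: "Y \<in> vfields M U"
  shows "lie_bracket M X Y \<in> vfields M U"
  using U D_torsion[OF X Y] by (intro vfields_cong[OF _ _ vfields_diff[OF D_vf[OF X Y] D_vf[OF Y X]]]) auto

text \<open>A field vanishing on the open set equals \<open>f\<close> times itself for a function \<open>f\<close> that is \<open>0\<close> on
  that set and \<open>1\<close> elsewhere, and \<open>f\<close> is smooth on the open set.\<close>

lemma D_vanishing:
  assumes Z: "Z \<in> vfields M U" and z: "\<And>q. q \<in> U \<Longrightarrow> Z q = 0" and Y: "Y \<in> vfields M U" and p: "p \<in> U"
  shows "D Z Y p = 0" "D Y Z p = 0"
proof -
  define f where "f q = (if q \<in> U then 0 else 1 :: real)" for q
  have "near q f" if "q \<in> U" for q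
    by (rule near_cong_imp[OF U that, of "\<lambda>_. 0"])
      (use that openin_subset[OF U] in \<open>auto simp: f_def intro: near_const\<close>)
  then have f: "smooth_fun M U f" by (simp add: smooth_fun_iff[OF U])
  have e: "(\<lambda>q. f q *\<^sub>R Z q) = Z" using z by (auto simp: f_def)
  show "D Z Y p = 0" using D_scale_left[OF Z Y f p] p unfolding e by (simp add: f_def)
  show "D Y Z p = 0" using D_scale_right[OF Y Z f p] p z unfolding e by (simp add: f_def)
qed

text \<open>The differences of the fields vanish on \<open>U\<close>, and additivity together with
  \<open>D_vanishing\<close> removes them. Fields may thus be altered outside an open set, which is
  what truncation relies on.\<close>

lemma D_cong:
  assumes "X \<in> vfields M U" "X' \<in> vfields M U" "\<And>q. q \<in> U \<Longrightarrow> X q = X' q"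
    "Y \<in> vfields M U" "Y' \<in> vfields M U" "\<And>q. q \<in> U \<Longrightarrow> Y q = Y' q" "p \<in> U"
  shows "D X Y p = D X' Y' p"
proof -
  define Z where "Z q = X' q - X q" for q
  define Z' where "Z' q = Y' q - Y q" for q
  have Z: "Z \<in> vfields M U" "Z' \<in> vfields M U" unfolding Z_def Z'_def
    using assms by (auto intro: vfields_diff)
  have z: "Z q = 0" "Z' q = 0" if "q \<in> U" for q using assms that by (auto simp: Z_def Z'_def)
  have e: "X + Z = X'" "Y + Z' = Y'" by (auto simp: Z_def Z'_def)
  have "D X' Y' p = D X Y' p"
    using D_add_left[OF assms(1,5) Z(1) assms(7)] D_vanishing(1)[OF Z(1) z(1) assms(5,7)]
    unfolding e by simp
  also have "\<dots> = D X Y p"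
    using D_add_right[OF assms(1,4) Z(2) assms(7)] D_vanishing(2)[OF Z(2) z(2) assms(1,7)]
    unfolding e by simp
  finally show ?thesis by simp
qed

lemma curv_op_cong:
  assumes "X \<in> vfields M U" "X' \<in> vfields M U" "\<And>q. q \<in> U \<Longrightarrow> X q = X' q"
    "Y \<in> vfields M U" "Y' \<in> vfields M U" "\<And>q. q \<in> U \<Longrightarrow> Y q = Y' q"
    "Z \<in> vfields M U" "Z' \<in> vfields M U" "\<And>q. q \<in> U \<Longrightarrow> Z q = Z' q" "p \<in> U"
  shows "curv_op M D X Y Z p = curv_op M D X' Y' Z' p"
proof -
  have "D X Z q = D X' Z' q" "D Y Z q = D Y' Z' q" if "q \<in> U" for q
    using D_cong assms that by blast+
  then have "D X (D Y Z) p = D X' (D Y' Z') p" "D Y (D X Z) p = D Y' (D X' Z') p"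
    by (intro D_cong assms D_vf; simp)+
  moreover have "D (lie_bracket M X Y) Z p = D (lie_bracket M X' Y') Z' p"
  proof (intro D_cong assms lie_bracket_vf)
    fix q assume q: "q \<in> U"
    show "lie_bracket M X Y q = lie_bracket M X' Y' q"
      by (rule lie_bracket_cong[OF U q]) (use assms q vfields_T in auto)
  qed
  ultimately show ?thesis by (simp add: curv_op_def)
qed

end

text \<open>Extending by zero outside \<open>W\<close> turns identities that hold on \<open>W\<close> into equations between fields.\<close>

definition tr :: "'a set \<Rightarrow> 'a vfield \<Rightarrow> 'a vfield" where
  "tr W X = (\<lambda>p. if p \<in> W then X p else 0)"

definition fields :: "'a set \<Rightarrow> 'a vfield set" where
  "fields W = {X \<in> vfields M W. \<forall>p. p \<notin> W \<longrightarrow> X p = 0}"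

definition g_on :: "'a set \<Rightarrow> 'a vfield \<Rightarrow> 'a vfield \<Rightarrow> 'a \<Rightarrow> real" where
  "g_on W X Y p = (if p \<in> W then g p (X p) (Y p) else 0)"

abbreviation D_on :: "'a set \<Rightarrow> 'a vfield \<Rightarrow> 'a vfield \<Rightarrow> 'a vfield" where
  "D_on W X Y \<equiv> tr W (D X Y)"

abbreviation br_on :: "'a set \<Rightarrow> 'a vfield \<Rightarrow> 'a vfield \<Rightarrow> 'a vfield" where
  "br_on W X Y \<equiv> tr W (lie_bracket M X Y)"

section \<open>The calculus of truncated fields\<close>

lemma tr_apply: "p \<in> W \<Longrightarrow> tr W X p = X p" by (simp add: tr_def)

lemma tr_fields: "opn W \<Longrightarrow> X \<in> vfields M W \<Longrightarrow> tr W X \<in> fields W"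
  unfolding fields_def using vfields_cong[of W X "tr W X"] by (auto simp: tr_def)

lemma fields_vf: "X \<in> fields W \<Longrightarrow> X \<in> vfields M W" by (simp add: fields_def)

lemma fields_out: "X \<in> fields W \<Longrightarrow> p \<notin> W \<Longrightarrow> X p = 0" by (simp add: fields_def)

text \<open>On \<open>W\<close> each axiom is a property of derivations, of the metric or of the
  connection; outside \<open>W\<close> the fields and the truncated operations are 0, so the
  equations hold at every point. Functions stay untruncated, as outside \<open>W\<close> they only
  multiply zeros or are differentiated by the zero vector.\<close>

lemma field_calculus_on:
  assumes W: "opn W"
  shows "field_calculus W (fields W) {f. smooth_fun M W f} (\<lambda>f X p. f p *\<^sub>R X p) (\<lambda>X f p. X p f)
    (D_on W) (br_on W) (g_on W)"
proof -
  note sf = smooth_fun_iff[OF W]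
  have WP: "p \<in> P" if "p \<in> W" for p using openin_subset[OF W] that by blast
  have FT: "X p \<in> T p" if "X \<in> fields W" "p \<in> W" for X p using vfields_T fields_vf that by blast
  have sub: "subspace (fields W)"
  proof (rule subspaceI)
    show "0 \<in> fields W" using vfields_zero[OF W] by (auto simp: fields_def zero_fun_def)
    fix X Y c assume X: "X \<in> fields W"
    show "X + Y \<in> fields W" if Y: "Y \<in> fields W"
    proof -
      have e: "X + Y = (\<lambda>p. X p + Y p)" by (rule ext) simp
      show ?thesis unfolding e fields_def
        using vfields_add[OF W fields_vf[OF X] fields_vf[OF Y]] fields_out[OF X] fields_out[OF Y]
        by simp
    qed
    have "smooth_fun M W (\<lambda>_. c)" using near_const WP by (simp add: sf)
    then show "c *\<^sub>R X \<in> fields W"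
      using vfields_scale[OF W fields_vf[OF X], of "\<lambda>_. c"] fields_out[OF X]
      by (simp add: fields_def scaleR_fun_def[of c X])
  qed
  have br: "br_on W X Y \<in> fields W" if "X \<in> fields W" "Y \<in> fields W" for X Y
    using tr_fields[OF W lie_bracket_vf[OF W]] that fields_vf by blast
  have DF: "D_on W X Y \<in> fields W" if "X \<in> fields W" "Y \<in> fields W" for X Y
    using tr_fields[OF W D_vf[OF W]] that fields_vf by blast
  have out: "X p f = 0" if "X \<in> fields W" "p \<notin> W" for X p f using fields_out that by simp
  show ?thesis
  proof
    show "subspace (fields W)" by (rule sub)
  next
    fix c show "(\<lambda>_. c) \<in> {f. smooth_fun M W f}" using near_const WP by (simp add: sf)
  next
    fix f f' assume "f \<in> {f. smooth_fun M W f}" "f' \<in> {f. smooth_fun M W f}"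
    then show "(\<lambda>p. f p + f' p) \<in> {f. smooth_fun M W f}" by (simp add: sf near_add)
  next
    fix f f' assume "f \<in> {f. smooth_fun M W f}" "f' \<in> {f. smooth_fun M W f}"
    then show "(\<lambda>p. f p * f' p) \<in> {f. smooth_fun M W f}" by (simp add: sf near_mult)
  next
    fix f X assume "f \<in> {f. smooth_fun M W f}" "X \<in> fields W"
    then show "(\<lambda>p. f p *\<^sub>R X p) \<in> fields W" using vfields_scale[OF W] by (simp add: fields_def)
  next
    fix c :: real and X :: "'a vfield" show "(\<lambda>p. c *\<^sub>R X p) = c *\<^sub>R X" by (simp add: scaleR_fun_def[of c X])
  next
    fix f and X Y :: "'a vfield"
    show "(\<lambda>p. f p *\<^sub>R (X + Y) p) = (\<lambda>p. f p *\<^sub>R X p) + (\<lambda>p. f p *\<^sub>R Y p)"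
      by (simp add: fun_eq_iff[where 'a='a] scaleR_add_right)
  next
    fix f f' and X :: "'a vfield"
    show "(\<lambda>p. (f p + f' p) *\<^sub>R X p) = (\<lambda>p. f p *\<^sub>R X p) + (\<lambda>p. f' p *\<^sub>R X p)"
      by (simp add: fun_eq_iff[where 'a='a] scaleR_add_left)
  next
    fix f f' and X :: "'a vfield"
    show "(\<lambda>p. f p *\<^sub>R (f' p *\<^sub>R X p)) = (\<lambda>p. (f p * f' p) *\<^sub>R X p)" by simp
  next
    fix X f assume "X \<in> fields W" "f \<in> {f. smooth_fun M W f}"
    then show "(\<lambda>p. X p f) \<in> {f. smooth_fun M W f}"
      using vfields_near[OF fields_vf W] by (simp add: sf)
  next
    fix X f f' p assume "X \<in> fields W" "f \<in> {f. smooth_fun M W f}" "f' \<in> {f. smooth_fun M W f}"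
    then show "X p (\<lambda>p. f p + f' p) = X p f + X p f'"
      using tv_add[OF WP FT] out[of X p] by (cases "p \<in> W") (simp_all add: sf)
  next
    fix X f f' p assume "X \<in> fields W" "f \<in> {f. smooth_fun M W f}" "f' \<in> {f. smooth_fun M W f}"
    then show "X p (\<lambda>p. f p * f' p) = f p * X p f' + f' p * X p f"
      using tv_mult[OF WP FT] out[of X p] by (cases "p \<in> W") (simp_all add: sf)
  next
    fix X c p assume "X \<in> fields W"
    then show "X p (\<lambda>_. c) = 0"
      using tv_const[OF WP FT] out[of X p] by (cases "p \<in> W") simp_all
  next
    fix X p and f f' :: "'a \<Rightarrow> real" assume "X \<in> fields W" "\<And>q. q \<in> W \<Longrightarrow> f q = f' q"
    then show "X p f = X p f'"
      using tv_cong[OF WP FT W, of p X f f'] out[of X p] by (cases "p \<in> W") simp_all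
  next
    fix X Y :: "'a vfield" and f p show "(X + Y) p f = X p f + Y p f" by simp
  next
    fix X :: "'a vfield" and f' f p show "(f' p *\<^sub>R X p) f = f' p * X p f" by (simp add: scaleR_fun_def)
  next
    fix X Y assume "X \<in> fields W" "Y \<in> fields W"
    then have "near p (\<lambda>q. g q (X q) (Y q))" if "p \<in> W" for p
      using g_near[OF W] fields_vf that by blast
    then have "near p (g_on W X Y)" if "p \<in> W" for p
      using near_cong_imp[OF W that, of "\<lambda>q. g q (X q) (Y q)" "g_on W X Y"] that by (simp add: g_on_def)
    then show "g_on W X Y \<in> {f. smooth_fun M W f}" by (simp add: sf)
  next
    fix X Y p assume "X \<in> fields W" "Y \<in> fields W"
    then show "g_on W X Y p = g_on W Y X p" using g_sym[OF WP FT FT] by (simp add: g_on_def)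
  next
    fix X Y Z p assume "X \<in> fields W" "Y \<in> fields W" "Z \<in> fields W"
    then show "g_on W (X + Y) Z p = g_on W X Z p + g_on W Y Z p"
      using g_add_left[OF WP FT FT FT] by (simp add: g_on_def)
  next
    fix f X Y p assume "f \<in> {f. smooth_fun M W f}" "X \<in> fields W" "Y \<in> fields W"
    then show "g_on W (\<lambda>p. f p *\<^sub>R X p) Y p = f p * g_on W X Y p"
      using g_scale_left[OF WP FT FT] by (simp add: g_on_def)
  next
    fix X Y assume "X \<in> fields W" "Y \<in> fields W"
    then show "D_on W X Y \<in> fields W" by (rule DF)
  next
    fix X Y Z assume "X \<in> fields W" "Y \<in> fields W" "Z \<in> fields W"
    then show "D_on W (X + Y) Z = D_on W X Z + D_on W Y Z"
      using D_add_left[OF W] fields_vf by (simp add: fun_eq_iff[where 'a='a] tr_def)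
  next
    fix X Y Z assume "X \<in> fields W" "Y \<in> fields W" "Z \<in> fields W"
    then show "D_on W Z (X + Y) = D_on W Z X + D_on W Z Y"
      using D_add_right[OF W] fields_vf by (simp add: fun_eq_iff[where 'a='a] tr_def)
  next
    fix f X Y assume "f \<in> {f. smooth_fun M W f}" "X \<in> fields W" "Y \<in> fields W"
    then show "D_on W (\<lambda>p. f p *\<^sub>R X p) Y = (\<lambda>p. f p *\<^sub>R D_on W X Y p)"
      using D_scale_left[OF W] fields_vf by (simp add: fun_eq_iff[where 'a='a] tr_def)
  next
    fix f X Y assume "f \<in> {f. smooth_fun M W f}" "X \<in> fields W" "Y \<in> fields W"
    then show "D_on W X (\<lambda>p. f p *\<^sub>R Y p) = (\<lambda>p. X p f *\<^sub>R Y p) + (\<lambda>p. f p *\<^sub>R D_on W X Y p)"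
      using D_scale_right[OF W] fields_vf fields_out by (simp add: fun_eq_iff[where 'a='a] tr_def)
  next
    fix X Y assume "X \<in> fields W" "Y \<in> fields W"
    then show "br_on W X Y = D_on W X Y - D_on W Y X"
      using D_torsion[OF W] fields_vf by (simp add: fun_eq_iff[where 'a='a] tr_def)
  next
    fix X Y f p assume XY: "X \<in> fields W" "Y \<in> fields W" and f: "f \<in> {f. smooth_fun M W f}"
    then show "br_on W X Y p f = X p (\<lambda>p. Y p f) - Y p (\<lambda>p. X p f)"
      using fields_out by (simp add: tr_def lie_bracket_def sf)
  next
    fix X Y Z assume V: "X \<in> fields W" "Y \<in> fields W" "Z \<in> fields W"
    \<comment> \<open>The outer bracket sees the inner one only on \<open>W\<close>, where
      truncation changes nothing.\<close>
    have b: "br_on W A (br_on W B C) p = lie_bracket M A (lie_bracket M B C) p"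
      if "A \<in> fields W" "B \<in> fields W" "C \<in> fields W" "p \<in> W" for A B C p
      unfolding tr_apply[OF that(4)]
      by (rule lie_bracket_cong[OF W that(4)])
        (use that FT[OF that(1)] FT[OF br[OF that(2,3)]] in \<open>auto simp: tr_apply\<close>)
    have "(br_on W X (br_on W Y Z) + br_on W Y (br_on W Z X) + br_on W Z (br_on W X Y)) p = 0" for p
    proof (cases "p \<in> W")
      case True
      then show ?thesis using jacobi[OF W True fields_vf fields_vf fields_vf, OF V] V by (simp add: b)
    qed (simp add: tr_def)
    then show "br_on W X (br_on W Y Z) + br_on W Y (br_on W Z X) + br_on W Z (br_on W X Y) = 0"
      by (simp add: fun_eq_iff[where 'a='a])
  next
    fix X Y Z p assume V: "X \<in> fields W" "Y \<in> fields W" "Z \<in> fields W"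
    show "X p (g_on W Y Z) = g_on W (D_on W X Y) Z p + g_on W Y (D_on W X Z) p"
    proof (cases "p \<in> W")
      case True
      have "X p (g_on W Y Z) = X p (\<lambda>q. g q (Y q) (Z q))"
        by (rule tv_cong[OF WP[OF True] FT[OF V(1) True] W True]) (simp add: g_on_def)
      then show ?thesis
        using D_metric[OF W fields_vf fields_vf fields_vf, OF V True] True by (simp add: g_on_def tr_def)
    qed (use out[OF V(1)] in \<open>simp add: g_on_def\<close>)
  qed
qed

end


section \<open>The Ricci tensor of an S-manifold\<close>

lemma sum_fun_apply: "(\<Sum>i\<in>I. F i) p = (\<Sum>i\<in>I. F i p)"
  by (induction I rule: infinite_finite_induct) auto

context levi_civita_mfd
begin

section \<open>Frames, curvature and the Ricci tensor on an open set\<close>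

abbreviation scale :: "('a \<Rightarrow> real) \<Rightarrow> 'a vfield \<Rightarrow> 'a vfield" where
  "scale f X \<equiv> (\<lambda>p. f p *\<^sub>R X p)"

abbreviation frame_on :: "'a set \<Rightarrow> (nat \<Rightarrow> 'a vfield) \<Rightarrow> (nat \<Rightarrow> real) \<Rightarrow> bool" where
  "frame_on W \<equiv> field_calculus.frame W (fields W) scale (g_on W) DIM('e)"

lemma frame_onI:
  assumes W: "opn W" and E: "\<And>i. i < DIM('e) \<Longrightarrow> E i \<in> vfields M W \<and> e i * e i = 1"
    and ortho: "\<And>q i j. q \<in> W \<Longrightarrow> i < DIM('e) \<Longrightarrow> j < DIM('e) \<Longrightarrow>
      g q (E i q) (E j q) = (if i = j then e i else 0)"
  shows "frame_on W (\<lambda>i. tr W (E i)) e"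
proof -
  interpret fW: field_calculus W "fields W" "{f. smooth_fun M W f}" scale "\<lambda>X f p. X p f"
    "D_on W" "br_on W" "g_on W" by (rule field_calculus_on[OF W])
  have expand: "X = (\<Sum>i<DIM('e). scale (\<lambda>p. e i * g_on W X (tr W (E i)) p) (tr W (E i)))"
    if X: "X \<in> fields W" for X
  proof
    fix p
    show "X p = (\<Sum>i<DIM('e). scale (\<lambda>p. e i * g_on W X (tr W (E i)) p) (tr W (E i))) p"
    proof (cases "p \<in> W")
      case True
      have "X p = (\<Sum>i<DIM('e). (e i * g p (X p) (E i p)) *\<^sub>R E i p)"
      proof (rule orthonormal_expand_tvec)
        show "p \<in> P" using openin_subset[OF W] True by blast
        show "E i p \<in> T p" if "i < DIM('e)" for i using vfields_T E that True by blast
        show "X p \<in> T p" using vfields_T[OF fields_vf[OF X] True] .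
      qed (use ortho True E in auto)
      then show ?thesis using True by (simp add: sum_fun_apply g_on_def tr_apply)
    next
      case False
      then show ?thesis using fields_out[OF X False] by (simp add: sum_fun_apply tr_def)
    qed
  qed
  show ?thesis unfolding fW.frame_def
  proof (intro conjI ballI allI impI)
    fix i assume "i < DIM('e)"
    then show "tr W (E i) \<in> fields W" "e i * e i = 1" using tr_fields[OF W] E by blast+
  next
    fix p i j assume "p \<in> W" "i < DIM('e)" "j < DIM('e)"
    then show "g_on W (tr W (E i)) (tr W (E j)) p = (if i = j then e i else 0)"
      using ortho[of p i j] by (simp add: g_on_def tr_apply)
  next
    fix X assume "X \<in> fields W"
    then show "X = (\<Sum>i<DIM('e). scale (\<lambda>p. e i * g_on W X (tr W (E i)) p) (tr W (E i)))"
      by (rule expand)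
  qed
qed

text \<open>Truncation changes the intermediate fields only outside \<open>W\<close>, which by
  \<open>D_cong\<close> does not affect derivatives at points of \<open>W\<close>.\<close>

lemma R_on:
  assumes W: "opn W" and V: "X \<in> fields W" "Y \<in> fields W" "Z \<in> fields W" and p: "p \<in> W"
  shows "field_calculus.R (D_on W) (br_on W) X Y Z p = curv_op M D X Y Z p"
proof -
  interpret fW: field_calculus W "fields W" "{f. smooth_fun M W f}" scale "\<lambda>X f p. X p f"
    "D_on W" "br_on W" "g_on W" by (rule field_calculus_on[OF W])
  note vf = V[THEN fields_vf]
  have DD: "D A (D_on W B Z) p = D A (D B Z) p" if A: "A \<in> vfields M W" and B: "B \<in> vfields M W" for A B
    by (rule D_cong[OF W])
      (use A B p D_vf[OF W B vf(3)] fields_vf[OF tr_fields[OF W D_vf[OF W B vf(3)]]] in \<open>auto simp: tr_apply\<close>)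
  have "D (br_on W X Y) Z p = D (lie_bracket M X Y) Z p"
    by (rule D_cong[OF W])
      (use vf p lie_bracket_vf[OF W vf(1,2)] fields_vf[OF tr_fields[OF W lie_bracket_vf[OF W vf(1,2)]]]
        in \<open>auto simp: tr_apply\<close>)
  then show ?thesis
    using DD[OF vf(1,2)] DD[OF vf(2,1)] p by (simp add: fW.R_def curv_op_def tr_apply)
qed

text \<open>\<open>orthonormal_frame\<close> fixes only the absolute value of each squared length,
  while \<open>frame\<close> asks for constant signs; a continuous function with values 1 and -1 is
  locally constant.\<close>

lemma constant_sign_nhd:
  assumes U: "opn U" "p \<in> U" and X: "X \<in> vfields M U"
    and one: "\<And>q. q \<in> U \<Longrightarrow> \<bar>g q (X q) (X q)\<bar> = 1"
  shows "\<exists>V. opn V \<and> p \<in> V \<and> V \<subseteq> U \<and> (\<forall>q\<in>V. g q (X q) (X q) = g p (X p) (X p))"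
proof -
  define f where "f q = g q (X q) (X q)" for q
  have pm: "f q = 1 \<or> f q = -1" if "q \<in> U" for q using one[OF that] unfolding f_def by arith
  have "near p f" unfolding f_def by (rule g_near[OF U(1) X X U(2)])
  moreover have "p \<in> P" using U openin_subset by blast
  ultimately have "near p (\<lambda>q. f q * f p)" by (intro near_mult near_const)
  moreover have "f p * f p \<in> {0<..}" using pm[OF U(2)] by auto
  ultimately obtain V where V: "opn V" "p \<in> V" "\<And>q. q \<in> V \<Longrightarrow> f q * f p \<in> {0<..}"
    using near_continuous[of p "\<lambda>q. f q * f p" "{0<..}", OF _ open_greaterThan] by blast
  have "f q = f p" if "q \<in> U \<inter> V" for q
    using pm[of q] pm[of p] V(3)[of q] U(2) that by auto
  then have "\<forall>q\<in>U \<inter> V. f q = f p" by blast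
  moreover have "opn (U \<inter> V)" "p \<in> U \<inter> V" using U V by auto
  ultimately show ?thesis unfolding f_def by blast
qed

text \<open>\<open>Ricci\<close> is computed in an unspecified frame near \<open>p\<close>. On a
  smaller neighbourhood that frame and \<open>E\<close> both have constant signs, so they give the
  same trace of one tensor; there the global fields may also be exchanged for \<open>X0\<close> and
  \<open>Y0\<close>.\<close>

lemma Ricci_in_frame:
  assumes W: "opn W" and frame: "frame_on W E e"
    and V: "opn V" "p \<in> V" "V \<subseteq> W"
    and X: "X \<in> vfields M P" "X0 \<in> fields W" "\<And>q. q \<in> V \<Longrightarrow> X q = X0 q"
    and Y: "Y \<in> vfields M P" "Y0 \<in> fields W" "\<And>q. q \<in> V \<Longrightarrow> Y q = Y0 q"
  shows "Ricci M g D X Y p = field_calculus.Ric (D_on W) (br_on W) (g_on W) DIM('e) E e X0 Y0 p"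
proof -
  let ?m = "DIM('e)"
  interpret fW: field_calculus W "fields W" "{f. smooth_fun M W f}" scale "\<lambda>X f p. X p f"
    "D_on W" "br_on W" "g_on W" by (rule field_calculus_on[OF W])
  have p: "p \<in> W" using V by blast
  have E: "E i \<in> fields W" "e i * e i = 1" if "i < ?m" for i
    using fW.frame_V[OF frame that] fW.frame_sign[OF frame that] by auto
  have gE: "g q (E i q) (E j q) = (if i = j then e i else 0)" if "q \<in> W" "i < ?m" "j < ?m" for q i j
    using fW.frame_orthonormal[OF frame that] that(1) by (simp add: g_on_def)
  have abs_e: "\<bar>e i\<bar> = 1" if "i < ?m" for i
    using E(2)[OF that] abs_mult_self_eq[of "e i"] by (metis abs_square_eq_1 power2_eq_square)
  have "orthonormal_frame M g W E"
    unfolding orthonormal_frame_def using fields_vf E(1) gE abs_e by auto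
  then have ex: "\<exists>E U. opn U \<and> p \<in> U \<and> orthonormal_frame M g U E" using W p by blast
  define E' where "E' = (SOME E. \<exists>U. opn U \<and> p \<in> U \<and> orthonormal_frame M g U E)"
  obtain U' where U': "opn U'" "p \<in> U'" and on: "orthonormal_frame M g U' E'"
    using someI_ex[OF ex] unfolding E'_def by blast
  have E'vf: "E' i \<in> vfields M U'" if "i < ?m" for i using on that unfolding orthonormal_frame_def by blast
  have E'1: "\<bar>g q (E' i q) (E' i q)\<bar> = 1" if "q \<in> U'" "i < ?m" for q i
    using on that unfolding orthonormal_frame_def by (metis (full_types))
  have E'0: "g q (E' i q) (E' j q) = 0" if "q \<in> U'" "i < ?m" "j < ?m" "i \<noteq> j" for q i j
    using on that unfolding orthonormal_frame_def by (metis (full_types))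
  define e' where "e' i = g p (E' i p) (E' i p)" for i
  have "\<forall>i\<in>{..<?m}. \<exists>V. opn V \<and> p \<in> V \<and> V \<subseteq> U' \<and> (\<forall>q\<in>V. g q (E' i q) (E' i q) = e' i)"
    unfolding e'_def using constant_sign_nhd[OF U' E'vf E'1] by blast
  then obtain N where N: "\<And>i. i < ?m \<Longrightarrow> opn (N i) \<and> p \<in> N i \<and> N i \<subseteq> U' \<and> (\<forall>q\<in>N i. g q (E' i q) (E' i q) = e' i)"
    using bchoice[of "{..<?m}" "\<lambda>i V. opn V \<and> p \<in> V \<and> V \<subseteq> U' \<and> (\<forall>q\<in>V. g q (E' i q) (E' i q) = e' i)"]
    by (auto simp: Ball_def)
  define W' where "W' = V \<inter> U' \<inter> (\<Inter>i\<in>{..<?m}. N i)"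
  \<comment> \<open>Positive dimension makes the index set nonempty; an empty intersection would be
    the whole type, which need not be an open set of the manifold.\<close>
  have "opn (\<Inter>i\<in>{..<?m}. N i)" using N DIM_positive[where 'a='e] by (intro openin_INT2) (auto simp: lessThan_empty_iff)
  then have W': "opn W'" unfolding W'_def using V U' by (intro openin_Int)
  have pW': "p \<in> W'" unfolding W'_def using V U' N by auto
  have sub: "W' \<subseteq> V" "W' \<subseteq> U'" "W' \<subseteq> W" "W' \<subseteq> P" using V U' openin_subset by (auto simp: W'_def)
  interpret fV: field_calculus W' "fields W'" "{f. smooth_fun M W' f}" scale "\<lambda>X f p. X p f"
    "D_on W'" "br_on W'" "g_on W'" by (rule field_calculus_on[OF W'])
  have F: "frame_on W' (\<lambda>i. tr W' (E i)) e"
    by (rule frame_onI[OF W']) (use E vfields_subset[OF fields_vf sub(3)] gE sub in auto)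
  have F': "frame_on W' (\<lambda>i. tr W' (E' i)) e'"
  proof (rule frame_onI[OF W'])
    fix i assume i: "i < ?m"
    have "\<bar>e' i\<bar> = 1" unfolding e'_def using E'1[OF U'(2) i] .
    then show "E' i \<in> vfields M W' \<and> e' i * e' i = 1"
      using vfields_subset[OF E'vf[OF i] sub(2)] by (auto simp: abs_if split: if_splits)
  next
    fix q i j assume "q \<in> W'" "i < ?m" "j < ?m"
    moreover from this have "g q (E' i q) (E' i q) = e' i" using N by (auto simp: W'_def)
    ultimately show "g q (E' i q) (E' j q) = (if i = j then e' i else 0)" using E'0 sub by auto
  qed
  have XW: "X \<in> vfields M W'" "Y \<in> vfields M W'" using X Y vfields_subset sub by blast+
  \<comment> \<open>The curvature form whose trace is the Ricci tensor, evaluated at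
    \<open>p\<close> in the calculus on \<open>W'\<close>, where both frames are available.\<close>
  define C where "C A B = g_on W' (fV.R (tr W' Y) A B) (tr W' X) p" for A B
  have C: "C (tr W' A) (tr W' A) = g p (curv_op M D Y A A p) (X p)" if A: "A \<in> vfields M W'" for A
  proof -
    note fl = tr_fields[OF W']
    have "fV.R (tr W' Y) (tr W' A) (tr W' A) p = curv_op M D (tr W' Y) (tr W' A) (tr W' A) p"
      by (rule R_on[OF W' fl[OF XW(2)] fl[OF A] fl[OF A] pW'])
    also have "\<dots> = curv_op M D Y A A p"
      by (rule curv_op_cong[OF W'])
        (use A XW fl[OF A, THEN fields_vf] fl[OF XW(2), THEN fields_vf] pW' in \<open>auto simp: tr_apply\<close>)
    finally show ?thesis unfolding C_def using pW' by (simp add: g_on_def tr_apply)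
  qed
  have "fV.tensor_at p C" unfolding C_def
    by (rule fV.tensor_R_23[OF F]) (use tr_fields[OF W'] XW in auto)
  then have tr: "(\<Sum>i<?m. e' i * C (tr W' (E' i)) (tr W' (E' i))) = (\<Sum>i<?m. e i * C (tr W' (E i)) (tr W' (E i)))"
    by (rule fV.trace_frame_independent[OF F _ pW' F'])
  have "Ricci M g D X Y p = (\<Sum>i<?m. e' i * C (tr W' (E' i)) (tr W' (E' i)))"
    unfolding Ricci_def E'_def[symmetric] Let_def curv_def e'_def[symmetric]
    by (intro sum.cong refl) (use C vfields_subset[OF E'vf sub(2)] in auto)
  also have "\<dots> = (\<Sum>i<?m. e i * g p (curv_op M D Y (E i) (E i) p) (X p))"
    unfolding tr by (intro sum.cong refl) (use C vfields_subset[OF fields_vf[OF E(1)] sub(3)] in auto)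
  also have "\<dots> = fW.Ric ?m E e X0 Y0 p"
    unfolding fW.Ric_def[OF frame]
  proof (intro sum.cong refl)
    fix i assume "i \<in> {..<?m}"
    then have i: "i < ?m" by simp
    have VV: "A \<in> vfields M V" if "A \<in> fields W" for A using vfields_subset[OF fields_vf[OF that] V(3)] .
    have "Y \<in> vfields M V" using vfields_subset[OF Y(1) openin_subset[OF V(1)]] .
    then have "curv_op M D Y (E i) (E i) p = curv_op M D Y0 (E i) (E i) p"
      by (intro curv_op_cong[OF V(1)] VV[OF E(1)[OF i]] VV[OF Y(2)] Y(3) V(2)) auto
    also have "\<dots> = fW.R Y0 (E i) (E i) p" using R_on[OF W Y(2) E(1)[OF i] E(1)[OF i] p] by simp
    finally show "e i * g p (curv_op M D Y (E i) (E i) p) (X p) = e i * g_on W (fW.R Y0 (E i) (E i)) X0 p"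
      using X(3)[OF V(2)] p by (simp add: g_on_def)
  qed
  finally show ?thesis .
qed

section \<open>Pointwise algebra of the S-structure\<close>

context
  fixes n s :: nat and \<phi> :: "'a \<Rightarrow> 'a tvec \<Rightarrow> 'a tvec" and \<xi> :: "nat \<Rightarrow> 'a vfield"
    and \<eta> :: "nat \<Rightarrow> 'a \<Rightarrow> 'a tvec \<Rightarrow> real" and \<epsilon> :: "nat \<Rightarrow> real"
  assumes S: "indefinite_S_manifold n s M \<phi> \<xi> \<eta> g \<epsilon>"
begin

lemma gff: "gff_manifold n s M \<phi> \<xi> \<eta>"
  using S unfolding indefinite_S_manifold_def indefinite_gff_manifold_def by (elim conjE)

lemma dim_eq: "DIM('e) = 2 * n + s"
  using gff unfolding gff_manifold_def by (elim conjE)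

lemma phi_tensor: "tensor_1_1 M \<phi>"
  using gff unfolding gff_manifold_def by (elim conjE)

lemma xi_eta: "\<forall>\<alpha>\<in>{1..s}. \<xi> \<alpha> \<in> vfields M P \<and> one_form M (\<eta> \<alpha>)"
  using gff unfolding gff_manifold_def by (elim conjE)

lemma xi_vf: "\<alpha> \<in> {1..s} \<Longrightarrow> \<xi> \<alpha> \<in> vfields M P"
  using bspec[OF xi_eta] by (rule conjunct1)

lemma gff_at: "\<forall>p\<in>P.
    dim (\<phi> p ` T p) = 2 * n \<and> inj_on (\<lambda>\<alpha>. \<xi> \<alpha> p) {1..s} \<and> independent ((\<lambda>\<alpha>. \<xi> \<alpha> p) ` {1..s}) \<and>
    (\<forall>v\<in>T p. \<phi> p (\<phi> p (\<phi> p v)) + \<phi> p v = 0 \<and>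
       \<phi> p (\<phi> p v) = - v + (\<Sum>\<alpha>=1..s. \<eta> \<alpha> p v *\<^sub>R \<xi> \<alpha> p)) \<and>
    (\<forall>\<alpha>\<in>{1..s}. \<forall>\<beta>\<in>{1..s}. \<eta> \<alpha> p (\<xi> \<beta> p) = (if \<alpha> = \<beta> then 1 else 0))"
  using gff unfolding gff_manifold_def by (elim conjE)

lemma eps: "\<forall>\<alpha>\<in>{1..s}. \<epsilon> \<alpha> \<in> {1, -1} \<and> (\<forall>p\<in>P. g p (\<xi> \<alpha> p) (\<xi> \<alpha> p) = \<epsilon> \<alpha>)"
  using S unfolding indefinite_S_manifold_def indefinite_gff_manifold_def by (elim conjE)

lemma eps_sq: "\<alpha> \<in> {1..s} \<Longrightarrow> \<epsilon> \<alpha> * \<epsilon> \<alpha> = 1"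
  using bspec[OF eps] by fastforce

lemma compatible: "\<forall>p\<in>P. \<forall>u\<in>T p. \<forall>v\<in>T p.
    g p (\<phi> p u) (\<phi> p v) = g p u v - (\<Sum>\<alpha>=1..s. \<epsilon> \<alpha> * \<eta> \<alpha> p u * \<eta> \<alpha> p v)"
  using S unfolding indefinite_S_manifold_def indefinite_gff_manifold_def by (elim conjE)

lemma normality: "\<forall>X\<in>vfields M P. \<forall>Y\<in>vfields M P. \<forall>p\<in>P.
    nijenhuis M \<phi> X Y p + 2 *\<^sub>R (\<Sum>\<alpha>=1..s. ext_deriv M (\<eta> \<alpha>) X Y p *\<^sub>R \<xi> \<alpha> p) = 0"
  using S unfolding indefinite_S_manifold_def normal_gff_def by (elim conjE)

lemma contact_condition: "\<forall>\<alpha>\<in>{1..s}. \<forall>X\<in>vfields M P. \<forall>Y\<in>vfields M P. \<forall>p\<in>P.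
    fundamental_form \<phi> g X Y p = ext_deriv M (\<eta> \<alpha>) X Y p"
  using S unfolding indefinite_S_manifold_def by (elim conjE)

lemma phi_vf: "X \<in> vfields M P \<Longrightarrow> (\<lambda>p. \<phi> p (X p)) \<in> vfields M P"
proof -
  assume X: "X \<in> vfields M P"
  have "\<forall>U. opn U \<longrightarrow> (\<forall>X\<in>vfields M U. (\<lambda>p. \<phi> p (X p)) \<in> vfields M U)"
    using phi_tensor unfolding tensor_1_1_def by (elim conjE)
  then show ?thesis using X openin_topspace by blast
qed

context
  fixes p assumes p: "p \<in> P"
begin

lemma phi_lin: "lin_on (T p) (\<phi> p)"
  using phi_tensor p unfolding tensor_1_1_def by blast

lemma phi_T: "v \<in> T p \<Longrightarrow> \<phi> p v \<in> T p"
  using phi_tensor p unfolding tensor_1_1_def by blast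

lemma xi_T: "\<alpha> \<in> {1..s} \<Longrightarrow> \<xi> \<alpha> p \<in> T p"
  using vfields_T[OF xi_vf p] .

lemma phi_3: "v \<in> T p \<Longrightarrow> \<phi> p (\<phi> p (\<phi> p v)) = - \<phi> p v"
  unfolding eq_neg_iff_add_eq_0 using bspec[OF gff_at p] by blast

lemma phi_2: "v \<in> T p \<Longrightarrow> \<phi> p (\<phi> p v) = - v + (\<Sum>\<alpha>=1..s. \<eta> \<alpha> p v *\<^sub>R \<xi> \<alpha> p)"
  using bspec[OF gff_at p] by blast

lemma eta_xi: "\<alpha> \<in> {1..s} \<Longrightarrow> \<beta> \<in> {1..s} \<Longrightarrow> \<eta> \<alpha> p (\<xi> \<beta> p) = (if \<alpha> = \<beta> then 1 else 0)"
  using bspec[OF gff_at p] by blast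

lemma phi_0: "\<phi> p 0 = 0"
  using lin_on_0[OF phi_lin subspace_T[OF p]] .

lemma phi_minus: "v \<in> T p \<Longrightarrow> \<phi> p (- v) = - \<phi> p v"
  using lin_on_scale[OF phi_lin, of v "-1"] by simp

text \<open>Duality and \<open>phi_2\<close> show that \<phi>^2 kills the field, and \<phi> =
  -\<phi>^3 then kills it as well.\<close>

lemma phi_xi:
  assumes a: "\<alpha> \<in> {1..s}" shows "\<phi> p (\<xi> \<alpha> p) = 0"
proof -
  have "(\<Sum>\<beta>=1..s. \<eta> \<beta> p (\<xi> \<alpha> p) *\<^sub>R \<xi> \<beta> p) = (\<Sum>\<beta>\<in>{1..s}. if \<beta> = \<alpha> then \<xi> \<alpha> p else 0)"
    using a by (intro sum.cong refl) (simp add: eta_xi)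
  then have "(\<Sum>\<beta>=1..s. \<eta> \<beta> p (\<xi> \<alpha> p) *\<^sub>R \<xi> \<beta> p) = \<xi> \<alpha> p" using a by simp
  then have "\<phi> p (\<phi> p (\<xi> \<alpha> p)) = 0" using phi_2[OF xi_T[OF a]] by simp
  then show ?thesis using phi_3[OF xi_T[OF a]] by (simp add: phi_0)
qed

text \<open>Compatibility with \<open>\<xi> \<alpha> p\<close> as second argument: the left side is
  0 by \<open>phi_xi\<close>, and duality collapses the sum to one term.\<close>

lemma eta_eq:
  assumes a: "\<alpha> \<in> {1..s}" and v: "v \<in> T p"
  shows "\<eta> \<alpha> p v = \<epsilon> \<alpha> * g p v (\<xi> \<alpha> p)"
proof -
  have "(\<Sum>\<beta>=1..s. \<epsilon> \<beta> * \<eta> \<beta> p v * \<eta> \<beta> p (\<xi> \<alpha> p)) = (\<Sum>\<beta>\<in>{1..s}. if \<beta> = \<alpha> then \<epsilon> \<alpha> * \<eta> \<alpha> p v else 0)"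
    using a by (intro sum.cong refl) (simp add: eta_xi)
  then have s: "(\<Sum>\<beta>=1..s. \<epsilon> \<beta> * \<eta> \<beta> p v * \<eta> \<beta> p (\<xi> \<alpha> p)) = \<epsilon> \<alpha> * \<eta> \<alpha> p v" using a by simp
  have "g p (\<phi> p v) (\<phi> p (\<xi> \<alpha> p)) = g p v (\<xi> \<alpha> p) - \<epsilon> \<alpha> * \<eta> \<alpha> p v"
    unfolding s[symmetric] using bspec[OF bspec[OF bspec[OF compatible p] v] xi_T[OF a]] .
  moreover have "g p (\<phi> p v) (\<phi> p (\<xi> \<alpha> p)) = 0"
    unfolding phi_xi[OF a] using lin_on_0[OF g_lin[OF p phi_T[OF v]] subspace_T[OF p]] .
  ultimately have "\<epsilon> \<alpha> * g p v (\<xi> \<alpha> p) = (\<epsilon> \<alpha> * \<epsilon> \<alpha>) * \<eta> \<alpha> p v" by simp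
  then show ?thesis using eps_sq[OF a] by simp
qed

lemma g_xi:
  assumes "\<alpha> \<in> {1..s}" "\<beta> \<in> {1..s}"
  shows "g p (\<xi> \<alpha> p) (\<xi> \<beta> p) = (if \<alpha> = \<beta> then \<epsilon> \<alpha> else 0)"
proof -
  have "\<epsilon> \<beta> * (\<epsilon> \<beta> * g p (\<xi> \<alpha> p) (\<xi> \<beta> p)) = \<epsilon> \<beta> * (if \<beta> = \<alpha> then 1 else 0)"
    using eta_xi[of \<beta> \<alpha>] eta_eq[OF assms(2) xi_T[OF assms(1)]] assms by simp
  moreover have "\<epsilon> \<beta> * (\<epsilon> \<beta> * g p (\<xi> \<alpha> p) (\<xi> \<beta> p)) = g p (\<xi> \<alpha> p) (\<xi> \<beta> p)"
    using eps_sq[OF assms(2)] by (simp flip: mult.assoc)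
  ultimately show ?thesis by simp
qed

text \<open>Comparing \<open>phi_2\<close> at \<open>\<phi> p v\<close> with \<open>phi_3\<close>
  leaves a vanishing combination of the \<xi> fields, whose coefficients are read off by
  orthogonality.\<close>

lemma eta_phi:
  assumes a: "\<alpha> \<in> {1..s}" and v: "v \<in> T p"
  shows "\<eta> \<alpha> p (\<phi> p v) = 0"
proof -
  note pv = phi_T[OF v]
  have z: "(\<Sum>\<beta>=1..s. \<eta> \<beta> p (\<phi> p v) *\<^sub>R \<xi> \<beta> p) = 0"
    using phi_2[OF pv] phi_3[OF v] by simp
  have "0 = g p (\<xi> \<alpha> p) (\<Sum>\<beta>=1..s. \<eta> \<beta> p (\<phi> p v) *\<^sub>R \<xi> \<beta> p)"
    unfolding z using lin_on_0[OF g_lin[OF p xi_T[OF a]] subspace_T[OF p]] by simp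
  also have "\<dots> = (\<Sum>\<beta>=1..s. \<eta> \<beta> p (\<phi> p v) *\<^sub>R g p (\<xi> \<alpha> p) (\<xi> \<beta> p))"
    by (rule lin_on_sum[OF g_lin[OF p xi_T[OF a]] subspace_T[OF p]]) (rule xi_T)
  also have "\<dots> = (\<Sum>\<beta>\<in>{1..s}. if \<beta> = \<alpha> then \<eta> \<alpha> p (\<phi> p v) * \<epsilon> \<alpha> else 0)"
    using a by (intro sum.cong refl) (auto simp: g_xi)
  also have "\<dots> = \<eta> \<alpha> p (\<phi> p v) * \<epsilon> \<alpha>" using a by simp
  finally show ?thesis using eps_sq[OF a] by auto
qed

end

text \<open>Normality and the contact condition are given for global fields, so the abstract lemma
  is instantiated on the whole manifold, where truncation affects only points outside
  \<open>pts M\<close>.\<close>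

lemma killing_xi:
  assumes a: "\<alpha> \<in> {1..s}"
  shows "field_calculus.killing P (fields P) (D_on P) (g_on P) (tr P (\<xi> \<alpha>))"
proof -
  have P: "opn P" by simp
  interpret fP: field_calculus P "fields P" "{f. smooth_fun M P f}" scale "\<lambda>X f p. X p f"
    "D_on P" "br_on P" "g_on P" by (rule field_calculus_on[OF P])
  define ph where "ph X = tr P (\<lambda>p. \<phi> p (X p))" for X
  define eta where "eta \<beta> X p = \<epsilon> \<beta> * g_on P X (tr P (\<xi> \<beta>)) p" for \<beta> X p
  have FT: "X p \<in> T p" if "X \<in> fields P" "p \<in> P" for X p using vfields_T[OF fields_vf] that by blast
  have etaP: "eta \<beta> X p = \<eta> \<beta> p (X p)" if "\<beta> \<in> {1..s}" "X \<in> fields P" "p \<in> P" for \<beta> X p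
    using eta_eq[OF that(3,1) FT[OF that(2,3)]] that(3) by (simp add: eta_def g_on_def tr_apply)
  have eta_out: "eta \<beta> X p = 0" if "p \<notin> P" for \<beta> X p using that by (simp add: eta_def g_on_def)
  have phP: "ph X p = \<phi> p (X p)" if "p \<in> P" for X p using that by (simp add: ph_def tr_apply)
  have ph_out: "ph X p = 0" if "p \<notin> P" for X p using that by (simp add: ph_def tr_def)
  have phF: "ph X \<in> fields P" if "X \<in> fields P" for X
    unfolding ph_def by (rule tr_fields[OF P phi_vf[OF fields_vf[OF that]]])
  have xiF: "tr P (\<xi> \<beta>) \<in> fields P" if "\<beta> \<in> {1..s}" for \<beta> by (rule tr_fields[OF P xi_vf[OF that]])
  have brF: "br_on P X Y \<in> fields P" if "X \<in> fields P" "Y \<in> fields P" for X Y using fP.br_V that .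
  \<comment> \<open>\<open>ext_deriv\<close> carries a factor 1/2; this is the origin of the 2 in
    the abstract contact identity, and it absorbs the 2 in the normality condition.\<close>
  have d: "X p (eta \<beta> Y) - Y p (eta \<beta> X) - eta \<beta> (br_on P X Y) p = 2 * ext_deriv M (\<eta> \<beta>) X Y p"
    if b: "\<beta> \<in> {1..s}" and X: "X \<in> fields P" and Y: "Y \<in> fields P" and p: "p \<in> P" for \<beta> X Y p
  proof -
    have "X p (eta \<beta> Y) = X p (\<lambda>q. \<eta> \<beta> q (Y q))"
      by (rule tv_cong[OF p FT[OF X p] P p]) (rule etaP[OF b Y])
    moreover have "Y p (eta \<beta> X) = Y p (\<lambda>q. \<eta> \<beta> q (X q))"
      by (rule tv_cong[OF p FT[OF Y p] P p]) (rule etaP[OF b X])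
    ultimately show ?thesis
      using etaP[OF b brF[OF X Y] p] p by (simp add: ext_deriv_def tr_apply)
  qed
  have br_eq: "br_on P X Y p = lie_bracket M X' Y' p"
    if "X \<in> fields P" "Y \<in> fields P" "p \<in> P" "\<And>q. q \<in> P \<Longrightarrow> X q = X' q" "\<And>q. q \<in> P \<Longrightarrow> Y q = Y' q" for X Y X' Y' p
    unfolding tr_apply[OF that(3)]
    by (rule lie_bracket_cong[of P p X X' Y Y', OF P that(3-5) FT[OF that(1,3)] FT[OF that(2,3)]])
  show ?thesis
  proof (rule fP.killing_of_normal_contact[where I="{1..s}" and \<xi>="\<lambda>\<beta>. tr P (\<xi> \<beta>)" and ph=ph and \<epsilon>=\<epsilon>],
      unfold eta_def[symmetric])
    show "tr P (\<xi> \<beta>) \<in> fields P" if "\<beta> \<in> {1..s}" for \<beta> using xiF[OF that] .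
    show "ph X \<in> fields P" if "X \<in> fields P" for X using phF[OF that] .
    show "ph 0 = 0"
    proof
      fix p show "ph 0 p = 0 p" by (cases "p \<in> P") (simp_all add: phP ph_out phi_0)
    qed
    show "ph (- X) = - ph X" if X: "X \<in> fields P" for X
    proof
      fix p show "ph (- X) p = (- ph X) p"
        using phi_minus FT[OF X] by (cases "p \<in> P") (simp_all add: phP ph_out)
    qed
    show "g_on P (tr P (\<xi> \<alpha>)) (tr P (\<xi> \<beta>)) p = (if \<alpha> = \<beta> then \<epsilon> \<alpha> else 0)"
      if "\<alpha> \<in> {1..s}" "\<beta> \<in> {1..s}" "p \<in> P" for \<alpha> \<beta> p
      using g_xi[OF that(3,1,2)] that(3) by (simp add: g_on_def tr_apply)
    show "\<epsilon> \<alpha> * \<epsilon> \<alpha> = 1" if "\<alpha> \<in> {1..s}" for \<alpha> using eps_sq[OF that] .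
    show "ph (ph X) = - X + (\<Sum>\<beta>\<in>{1..s}. scale (eta \<beta> X) (tr P (\<xi> \<beta>)))" if X: "X \<in> fields P" for X
    proof
      fix p
      show "ph (ph X) p = (- X + (\<Sum>\<beta>\<in>{1..s}. scale (eta \<beta> X) (tr P (\<xi> \<beta>)))) p"
      proof (cases "p \<in> P")
        case True
        have "(\<Sum>\<beta>=1..s. eta \<beta> X p *\<^sub>R tr P (\<xi> \<beta>) p) = (\<Sum>\<beta>=1..s. \<eta> \<beta> p (X p) *\<^sub>R \<xi> \<beta> p)"
          using True by (intro sum.cong refl) (simp add: etaP[OF _ X] tr_apply)
        then show ?thesis using phi_2[OF True FT[OF X True]] True by (simp add: phP sum_fun_apply)
      next
        case False
        then show ?thesis using fields_out[OF X] by (simp add: ph_out sum_fun_apply tr_def)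
      qed
    qed
    show "ph (ph (ph X)) = - ph X" if X: "X \<in> fields P" for X
    proof
      fix p show "ph (ph (ph X)) p = (- ph X) p"
        using phi_3 FT[OF X] by (cases "p \<in> P") (simp_all add: phP ph_out)
    qed
    show "ph (tr P (\<xi> \<beta>)) = 0" if b: "\<beta> \<in> {1..s}" for \<beta>
    proof
      fix p show "ph (tr P (\<xi> \<beta>)) p = 0 p"
        using phi_xi[OF _ b] by (cases "p \<in> P") (simp_all add: phP ph_out tr_apply)
    qed
    show "eta \<beta> (ph X) p = 0" if b: "\<beta> \<in> {1..s}" and X: "X \<in> fields P" for \<beta> X p
      using eta_phi[OF _ b] FT[OF X] by (cases "p \<in> P") (simp_all add: etaP[OF b phF[OF X]] phP eta_out)
    show "2 * g_on P X (ph Y) p = X p (eta \<beta> Y) - Y p (eta \<beta> X) - eta \<beta> (br_on P X Y) p"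
      if b: "\<beta> \<in> {1..s}" and X: "X \<in> fields P" and Y: "Y \<in> fields P" for \<beta> X Y p
    proof (cases "p \<in> P")
      case True
      have "fundamental_form \<phi> g X Y p = ext_deriv M (\<eta> \<beta>) X Y p"
        using bspec[OF bspec[OF bspec[OF bspec[OF contact_condition b] fields_vf[OF X]] fields_vf[OF Y]] True] .
      then show ?thesis using d[OF b X Y True] True by (simp add: fundamental_form_def g_on_def phP)
    next
      case False
      then show ?thesis using fields_out[OF X] fields_out[OF Y] by (simp add: g_on_def eta_out)
    qed
    show "ph (ph (br_on P X Y)) + br_on P (ph X) (ph Y) - ph (br_on P (ph X) Y) - ph (br_on P X (ph Y))
        + (\<Sum>\<beta>\<in>{1..s}. scale (\<lambda>p. X p (eta \<beta> Y) - Y p (eta \<beta> X) - eta \<beta> (br_on P X Y) p) (tr P (\<xi> \<beta>))) = 0"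
      if X: "X \<in> fields P" and Y: "Y \<in> fields P" for X Y
    proof
      fix p
      show "(ph (ph (br_on P X Y)) + br_on P (ph X) (ph Y) - ph (br_on P (ph X) Y) - ph (br_on P X (ph Y))
        + (\<Sum>\<beta>\<in>{1..s}. scale (\<lambda>p. X p (eta \<beta> Y) - Y p (eta \<beta> X) - eta \<beta> (br_on P X Y) p) (tr P (\<xi> \<beta>)))) p
        = 0 p"
      proof (cases "p \<in> P")
        case True
        have N: "nijenhuis M \<phi> X Y p + 2 *\<^sub>R (\<Sum>\<beta>=1..s. ext_deriv M (\<eta> \<beta>) X Y p *\<^sub>R \<xi> \<beta> p) = 0"
          using bspec[OF bspec[OF bspec[OF normality fields_vf[OF X]] fields_vf[OF Y]] True] .
        have "(\<Sum>\<beta>=1..s. (X p (eta \<beta> Y) - Y p (eta \<beta> X) - eta \<beta> (br_on P X Y) p) *\<^sub>R tr P (\<xi> \<beta>) p)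
            = 2 *\<^sub>R (\<Sum>\<beta>=1..s. ext_deriv M (\<eta> \<beta>) X Y p *\<^sub>R \<xi> \<beta> p)"
          unfolding scaleR_sum_right using True
          by (intro sum.cong refl) (simp add: d[OF _ X Y] tr_apply)
        moreover have "br_on P (ph X) (ph Y) p = lie_bracket M (\<lambda>q. \<phi> q (X q)) (\<lambda>q. \<phi> q (Y q)) p"
          by (rule br_eq) (use True phF X Y phP in auto)
        moreover have "br_on P (ph X) Y p = lie_bracket M (\<lambda>q. \<phi> q (X q)) Y p"
          by (rule br_eq) (use True phF X Y phP in auto)
        moreover have "br_on P X (ph Y) p = lie_bracket M X (\<lambda>q. \<phi> q (Y q)) p"
          by (rule br_eq) (use True phF X Y phP in auto)
        moreover have "br_on P X Y p = lie_bracket M X Y p" by (rule tr_apply[OF True])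
        ultimately show ?thesis
          using N True by (simp add: phP sum_fun_apply nijenhuis_def)
      next
        case False
        then show ?thesis by (simp add: ph_out sum_fun_apply tr_def)
      qed
    qed
    show "\<alpha> \<in> {1..s}" by (rule a)
  qed
qed

text \<open>Every tangent vector is the value of a global field, so it is enough to run the Schur
  argument on a frame domain around its base point.\<close>

lemma eta_Einstein_factor_constant:
  assumes n: "n \<ge> 2" and einstein: "eta_Einstein_with s M \<phi> \<eta> g \<epsilon> D h (\<lambda>p. 2 * real n)"
  shows "h constant_on P"
proof (rule constant_if_all_derivatives_vanish)
  have P: "opn P" by simp
  have h: "smooth_fun M P h" using einstein unfolding eta_Einstein_with_def by (elim conjE)
  then show "smooth_fun M P h" .
  fix p v assume p: "p \<in> P" and v: "v \<in> T p"
  obtain W E0 e where W: "opn W" "p \<in> W"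
    and E0: "\<forall>i<DIM('e). E0 i \<in> vfields M W \<and> e i * e i = (1::real)"
    and o: "\<forall>q\<in>W. \<forall>i<DIM('e). \<forall>j<DIM('e). g q (E0 i q) (E0 j q) = (if i = j then e i else 0)"
    using local_frame[OF p order_refl] by blast
  define E where "E i = tr W (E0 i)" for i
  have frame: "frame_on W E e"
    unfolding E_def by (rule frame_onI[OF W(1)]) (use E0 o in auto)
  interpret fW: field_calculus W "fields W" "{f. smooth_fun M W f}" scale "\<lambda>X f p. X p f"
    "D_on W" "br_on W" "g_on W" by (rule field_calculus_on[OF W(1)])
  interpret fP: field_calculus P "fields P" "{f. smooth_fun M P f}" scale "\<lambda>X f p. X p f"
    "D_on P" "br_on P" "g_on P" by (rule field_calculus_on[OF P])
  have WP: "W \<subseteq> P" using openin_subset[OF W(1)] .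
  define Xi where "Xi \<alpha> = tr W (\<xi> \<alpha>)" for \<alpha>
  have Xi: "Xi \<alpha> \<in> fields W" if "\<alpha> \<in> {1..s}" for \<alpha>
    unfolding Xi_def by (rule tr_fields[OF W(1) vfields_subset[OF xi_vf[OF that] WP]])
  have FT: "A q \<in> T q" if "A \<in> fields W" "q \<in> W" for A q using vfields_T[OF fields_vf] that by blast
  \<comment> \<open>Near \<open>q\<close> both fields agree with global ones, to which the
    hypotheses apply; intersecting the two neighbourhoods gives a common one.\<close>
  have ext: "\<exists>X' Y' V. X' \<in> vfields M P \<and> Y' \<in> vfields M P \<and> opn V \<and> q \<in> V \<and> V \<subseteq> W
      \<and> (\<forall>r\<in>V. X' r = X r \<and> Y' r = Y r)"
    if X: "X \<in> fields W" and Y: "Y \<in> fields W" and q: "q \<in> W" for X Y q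
  proof -
    obtain X' V where 1: "X' \<in> vfields M P" "opn V" "q \<in> V" "V \<subseteq> W" "\<And>r. r \<in> V \<Longrightarrow> X' r = X r"
      using extend_field[OF W(1) q fields_vf[OF X]] by metis
    obtain Y' V' where 2: "Y' \<in> vfields M P" "opn V'" "q \<in> V'" "V' \<subseteq> W" "\<And>r. r \<in> V' \<Longrightarrow> Y' r = Y r"
      using extend_field[OF W(1) q fields_vf[OF Y]] by metis
    show ?thesis
      by (intro exI[of _ X'] exI[of _ Y'] exI[of _ "V \<inter> V'"] conjI) (use 1 2 in auto)
  qed
  have kill: "fW.killing (Xi \<alpha>)" if a: "\<alpha> \<in> {1..s}" for \<alpha>
    unfolding fW.killing_def
  proof (intro conjI ballI)
    show "Xi \<alpha> \<in> fields W" by (rule Xi[OF a])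
    fix X Y q assume X: "X \<in> fields W" and Y: "Y \<in> fields W" and q: "q \<in> W"
    obtain X' Y' V where V: "X' \<in> vfields M P" "Y' \<in> vfields M P" "opn V" "q \<in> V" "V \<subseteq> W"
      "\<And>r. r \<in> V \<Longrightarrow> X' r = X r" "\<And>r. r \<in> V \<Longrightarrow> Y' r = Y r"
      using ext[OF X Y q] by blast
    have qP: "q \<in> P" using q WP by blast
    have VP: "V \<subseteq> P" using V(5) WP by blast
    \<comment> \<open>Locality of the connection: at \<open>q\<close> the derivative computed in the
      calculus on \<open>W\<close> is the one computed on the whole manifold with the extended
      field.\<close>
    have De: "D_on W Z (Xi \<alpha>) q = D_on P (tr P Z') (tr P (\<xi> \<alpha>)) q"
      if Z: "Z \<in> fields W" "Z' \<in> vfields M P" "\<And>r. r \<in> V \<Longrightarrow> Z' r = Z r" for Z Z'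
      unfolding tr_apply[OF q] tr_apply[OF qP]
    proof (rule D_cong[OF V(3)])
      show "Z \<in> vfields M V" using vfields_subset[OF fields_vf[OF Z(1)] V(5)] .
      show "tr P Z' \<in> vfields M V" using vfields_subset[OF fields_vf[OF tr_fields[OF P Z(2)]] VP] .
      show "Xi \<alpha> \<in> vfields M V" using vfields_subset[OF fields_vf[OF Xi[OF a]] V(5)] .
      show "tr P (\<xi> \<alpha>) \<in> vfields M V" using vfields_subset[OF fields_vf[OF tr_fields[OF P xi_vf[OF a]]] VP] .
      show "Z r = tr P Z' r" "Xi \<alpha> r = tr P (\<xi> \<alpha>) r" if "r \<in> V" for r
        using that Z(3) VP V(5) by (auto simp: tr_def Xi_def)
    qed (rule V(4))
    have "g_on P (D_on P (tr P X') (tr P (\<xi> \<alpha>))) (tr P Y') q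
        + g_on P (D_on P (tr P Y') (tr P (\<xi> \<alpha>))) (tr P X') q = 0"
      using killing_xi[OF a] tr_fields[OF P V(1)] tr_fields[OF P V(2)] qP unfolding fP.killing_def by blast
    moreover have "tr P X' q = X q" "tr P Y' q = Y q" using V(4,6,7) qP by (auto simp: tr_apply)
    ultimately show "g_on W (D_on W X (Xi \<alpha>)) Y q + g_on W (D_on W Y (Xi \<alpha>)) X q = 0"
      using De[OF X V(1,6)] De[OF Y V(2,7)] q qP by (simp add: g_on_def)
  qed
  have ortho: "g_on W (Xi \<alpha>) (Xi \<beta>) q = (if \<alpha> = \<beta> then \<epsilon> \<alpha> else 0)"
    if "\<alpha> \<in> {1..s}" "\<beta> \<in> {1..s}" "q \<in> W" for \<alpha> \<beta> q
    using g_xi[of q, OF _ that(1,2)] that(3) WP by (auto simp: g_on_def Xi_def tr_apply)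
  have Ric: "fW.Ric DIM('e) E e A B q =
      h q * (g_on W A B q - (\<Sum>\<alpha>\<in>{1..s}. \<epsilon> \<alpha> * (g_on W A (Xi \<alpha>) q * g_on W B (Xi \<alpha>) q)))
      + 2 * real n * (g_on W A (\<Sum>\<alpha>\<in>{1..s}. Xi \<alpha>) q * g_on W B (\<Sum>\<alpha>\<in>{1..s}. Xi \<alpha>) q)"
    if A: "A \<in> fields W" and B: "B \<in> fields W" and q: "q \<in> W" for A B q
  proof -
    obtain A' B' V where V: "A' \<in> vfields M P" "B' \<in> vfields M P" "opn V" "q \<in> V" "V \<subseteq> W"
      "\<And>r. r \<in> V \<Longrightarrow> A' r = A r" "\<And>r. r \<in> V \<Longrightarrow> B' r = B r"
      using ext[OF A B q] by blast
    have qP: "q \<in> P" using q WP by blast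
    have eta: "\<eta> \<alpha> q (C q) = \<epsilon> \<alpha> * g_on W C (Xi \<alpha>) q" if "\<alpha> \<in> {1..s}" "C \<in> fields W" for C \<alpha>
      using eta_eq[OF qP that(1) FT[OF that(2) q]] q by (simp add: g_on_def Xi_def tr_apply)
    \<comment> \<open>The sign in \<open>eta_bar\<close> cancels the one in \<open>eta_eq\<close>,
      so this form is dual to the plain sum of the \<xi> fields.\<close>
    have bar: "eta_bar s \<epsilon> \<eta> q (C q) = g_on W C (\<Sum>\<alpha>\<in>{1..s}. Xi \<alpha>) q" if C: "C \<in> fields W" for C
    proof -
      have "g_on W C (\<Sum>\<alpha>\<in>{1..s}. Xi \<alpha>) q = (\<Sum>\<alpha>\<in>{1..s}. g_on W C (Xi \<alpha>) q)"
        by (rule fW.gg_sum_right[OF Xi C])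
      also have "\<dots> = (\<Sum>\<alpha>=1..s. \<epsilon> \<alpha> * \<eta> \<alpha> q (C q))"
        using eps_sq by (intro sum.cong refl) (simp add: eta[OF _ C] flip: mult.assoc)
      finally show ?thesis by (simp add: eta_bar_def)
    qed
    have "\<forall>X\<in>vfields M P. \<forall>Y\<in>vfields M P. \<forall>p\<in>P. Ricci M g D X Y p =
        h p * g p (\<phi> p (X p)) (\<phi> p (Y p)) + 2 * real n * eta_bar s \<epsilon> \<eta> p (X p) * eta_bar s \<epsilon> \<eta> p (Y p)"
      using einstein unfolding eta_Einstein_with_def by (elim conjE)
    from bspec[OF bspec[OF bspec[OF this V(1)] V(2)] qP]
    have "Ricci M g D A' B' q = h q * g q (\<phi> q (A q)) (\<phi> q (B q))
        + 2 * real n * eta_bar s \<epsilon> \<eta> q (A q) * eta_bar s \<epsilon> \<eta> q (B q)"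
      using V(6,7)[OF V(4)] by simp
    moreover have "Ricci M g D A' B' q = fW.Ric DIM('e) E e A B q"
      by (rule Ricci_in_frame[OF W(1) frame V(3-5,1) A V(6) V(2) B V(7)])
    moreover have "g q (\<phi> q (A q)) (\<phi> q (B q)) =
        g_on W A B q - (\<Sum>\<alpha>\<in>{1..s}. \<epsilon> \<alpha> * (g_on W A (Xi \<alpha>) q * g_on W B (Xi \<alpha>) q))"
    proof -
      have "g q (\<phi> q (A q)) (\<phi> q (B q)) = g q (A q) (B q) - (\<Sum>\<alpha>=1..s. \<epsilon> \<alpha> * \<eta> \<alpha> q (A q) * \<eta> \<alpha> q (B q))"
        using bspec[OF bspec[OF bspec[OF compatible qP] FT[OF A q]] FT[OF B q]] .
      moreover have "(\<Sum>\<alpha>=1..s. \<epsilon> \<alpha> * \<eta> \<alpha> q (A q) * \<eta> \<alpha> q (B q))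
          = (\<Sum>\<alpha>\<in>{1..s}. \<epsilon> \<alpha> * (g_on W A (Xi \<alpha>) q * g_on W B (Xi \<alpha>) q))"
      proof (intro sum.cong refl)
        fix \<alpha> assume a: "\<alpha> \<in> {1..s}"
        \<comment> \<open>Each of the two \<open>\<eta>\<close> factors contributes a sign; these
          cancel, and a single \<open>\<epsilon> \<alpha>\<close> is left.\<close>
        show "\<epsilon> \<alpha> * \<eta> \<alpha> q (A q) * \<eta> \<alpha> q (B q) = \<epsilon> \<alpha> * (g_on W A (Xi \<alpha>) q * g_on W B (Xi \<alpha>) q)"
          unfolding eta[OF a A] eta[OF a B] using eps_sq[OF a] by (simp flip: mult.assoc)
      qed
      ultimately show ?thesis using q by (simp add: g_on_def)
    qed
    ultimately show ?thesis using bar[OF A] bar[OF B] by simp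
  qed
  obtain X where X: "X \<in> vfields M P" "X p = v" using extend_tvec[OF p v] by blast
  have "tr W X p h = 0"
  proof (rule fW.schur[OF frame n, where X="tr W X" and p=p and h=h and I="{1..s}" and \<xi>=Xi and \<epsilon>=\<epsilon> and k="2 * real n"])
    show "DIM('e) = 2 * n + card {1..s}" using dim_eq by simp
    show "h \<in> {f. smooth_fun M W f}" using smooth_fun_subset[OF h WP] by simp
    show "tr W X \<in> fields W" by (rule tr_fields[OF W(1) vfields_subset[OF X(1) WP]])
  qed (use kill ortho eps_sq Ric W(2) in auto)
  then show "v h = 0" using X(2) W(2) by (simp add: tr_apply)
qed

end

end

theorem theorem2p6:
  fixes n s :: nat
    and M :: "('a, 'e::euclidean_space) mfd"
    and \<phi> :: "'a \<Rightarrow> 'a tvec \<Rightarrow> 'a tvec"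
    and \<xi> :: "nat \<Rightarrow> 'a vfield"
    and \<eta> :: "nat \<Rightarrow> 'a \<Rightarrow> 'a tvec \<Rightarrow> real"
    and g :: "'a \<Rightarrow> 'a tvec \<Rightarrow> 'a tvec \<Rightarrow> real"
    and \<epsilon> :: "nat \<Rightarrow> real"
    and D :: "'a vfield \<Rightarrow> 'a vfield \<Rightarrow> 'a vfield"
    and h :: "'a \<Rightarrow> real"
  assumes "n \<ge> 2" and "s \<ge> 1"
    and "indefinite_S_manifold n s M \<phi> \<xi> \<eta> g \<epsilon>"
    and "levi_civita M g D"
    and "eta_Einstein_with s M \<phi> \<eta> g \<epsilon> D h (\<lambda>p. 2 * real n)"
  shows "h constant_on pts M"
proof -
  have "smooth_manifold M" "semi_riemannian_metric M g"
    using assms(3)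
    unfolding indefinite_S_manifold_def indefinite_gff_manifold_def gff_manifold_def by blast+
  then interpret levi_civita_mfd M g D
    using assms(4) by unfold_locales
  show ?thesis by (rule eta_Einstein_factor_constant[OF assms(3,1,5)])
qed

end
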